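(* Each of the following $kE$-modules $M$ is $\mathrm{GL}_n$-equivariant. Consequently, each has constant $r$-radical type and constant $r$-socle type for every $r>0$ (that is, for every $1\le r\le n$). \begin{enumerate} \item $M=\operatorname{Rad}^i(kE)/\operatorname{Rad}^j(kE)$ for any $0\le i<j$. \item $M=\operatorname{Rad}^i(\Lambda^*(\mathbb V))/\operatorname{Rad}^{i+2}(\Lambda^*(\mathbb V))$ for any $0\le i$. \item $M=S^{*\ge i}(\mathbb V)/S^{*\ge j}(\mathbb V)$ for any $0\le i$, $1\le j-i\le p$. \item $M=\operatorname{Rad}^i(kG)/\operatorname{Rad}^j(kG)$ for any $0\le i$, $1\le j-i\le p$, where $kG=S^*(\mathbb V)/(v^{p^m},v\in\mathbb V)\cong k[y_1,\dots,y_n]/(y_1^{p^m},\dots,y_n^{p^m})$ for some $m>0$. \end{enumerate}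
   Context: $k$ is an algebraically closed field of characteristic $p>0$, $E$ is an elementary abelian $p$-group of rank $n\ge1$, $\mathbb V\subset\operatorname{Rad}(kE)$ is a linear subspace such that $\mathbb V\hookrightarrow\operatorname{Rad}(kE)\to\operatorname{Rad}(kE)/\operatorname{Rad}^2(kE)$ is an isomorphism; this identifies $kE$ with $S^*(\mathbb V)/\langle v^p,v\in\mathbb V\rangle$. The group $\mathrm{GL}_n\cong\mathrm{GL}(\mathbb V)$ acts on $kE$ by algebra automorphisms induced by its standard action on $\mathbb V$. A $kE$-module $M$ is $\mathrm{GL}_n$-equivariant if it is provided with a linear action of $\mathrm{GL}(\mathbb V)$ such that $g(xm)=(gx)(gm)$ for all $g\in\mathrm{GL}(\mathbb V)$, $x\in kE$, $m\in M$. Module structures: in (1) the quotient of ideals of $kE$; in (2) $\operatorname{Rad}$ denotes the augmentation ideal of the exterior algebra $\Lambda^*(\mathbb V)$ and $v\in\mathbb V$ acts by left exterior multiplication by $v$; in (3) $S^{*\ge i}(\mathbb V)$ is the ideal of elements of degree $\ge i$ in $S^*(\mathbb V)$ and $v\in\mathbb V$ acts by multiplication (this factors through $kE$ since $j-i\le p$); in (4) $v\in \mathbb V$ acts by multiplication by (the class of) $v$ in $kG$ (again factoring through $kE$). The $\mathrm{GL}(\mathbb V)$-actions are those induced from the natural action on $\mathbb V$. For an $r$-plane (i.e. $r$-dimensional subspace) $U\subset\mathbb V$, $\operatorname{Rad}^\ell_U(M)$ is the span of all $u_1\cdots u_\ell m$ with $u_i\in U$, $m\in M$, and $\operatorname{Soc}^\ell_U(M)=\{m\in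 M:u_1\cdots u_\ell m=0\ \forall u_i\in U\}$. A finite dimensional $kE$-module $M$ has constant $r$-radical type (respectively, constant $r$-socle type) if for every $\ell$ with $1\le\ell\le(p-1)r$ the dimension of $\operatorname{Rad}^\ell_U(M)$ (resp. $\operatorname{Soc}^\ell_U(M)$) is independent of the choice of the $r$-plane $U\subset\mathbb V$. *)

theory Defs
  imports
    "HOL-Library.Poly_Mapping"
    "HOL-Algebra.QuotRing"
    "HOL-Algebra.Ideal_Product"
    "HOL-Algebra.Group_Action"
    "HOL-Algebra.Algebraic_Closure_Type"
    "Jordan_Normal_Form.Missing_VectorSpace"
begin

section \<open>The group algebra and its radical\<close>

text \<open>
  The group \<open>E\<close> is an additively written type \<open>'e\<close>; the convolution product of
  \<^theory>\<open>HOL-Library.Poly_Mapping\<close> makes \<open>'e \<Rightarrow>\<^sub>0 'k\<close> its group algebra.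
\<close>

type_synonym ('e, 'k) grp_alg = "'e \<Rightarrow>\<^sub>0 'k"

definition kE :: "('e::ab_group_add, 'k::field) grp_alg ring" where
  "kE = ring_of_type_algebra"

definition kscale :: "'k \<Rightarrow> ('e::ab_group_add, 'k::field) grp_alg \<Rightarrow> ('e, 'k) grp_alg" where
  "kscale c x = Poly_Mapping.single 0 c * x"

text \<open>The Jacobson radical of a commutative ring.\<close>

definition Rad :: "('a, 'b) ring_scheme \<Rightarrow> 'a set" where
  "Rad R = \<Inter> {I. maximalideal I R}"

primrec ideal_power :: "('a, 'b) ring_scheme \<Rightarrow> 'a set \<Rightarrow> nat \<Rightarrow> 'a set" where
  "ideal_power R I 0 = carrier R"
| "ideal_power R I (Suc i) = ideal_prod R (ideal_power R I i) I"

definition rad_complement :: "('e::ab_group_add, 'k::field) grp_alg set \<Rightarrow> bool" where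
  "rad_complement V \<longleftrightarrow>
     Modules.module.subspace kscale V \<and> V \<subseteq> Rad kE \<and>
     (let Q = ideal_power kE (Rad kE) 2 in
       bij_betw (\<lambda>v. Q +>\<^bsub>kE\<^esub> v) V ((\<lambda>x. Q +>\<^bsub>kE\<^esub> x) ` Rad kE))"

definition r_plane :: "('e::ab_group_add, 'k::field) grp_alg set \<Rightarrow> nat \<Rightarrow> ('e, 'k) grp_alg set \<Rightarrow> bool" where
  "r_plane V r U \<longleftrightarrow>
     Modules.module.subspace kscale U \<and> U \<subseteq> V \<and> vector_space.dim kscale U = r"

definition GL :: "('e::ab_group_add, 'k::field) grp_alg set
    \<Rightarrow> (('e, 'k) grp_alg \<Rightarrow> ('e, 'k) grp_alg) monoid" where
  "GL V = (BijGroup V)\<lparr>carrier := {g \<in> Bij V.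
     (\<forall>u\<in>V. \<forall>v\<in>V. g (u + v) = g u + g v) \<and> (\<forall>c. \<forall>v\<in>V. g (kscale c v) = kscale c (g v))}\<rparr>"


section \<open>Algebras generated by \<open>V\<close>\<close>

text \<open>
  Below, an algebra generated by the vector space \<open>V\<close> is a ring \<open>R\<close> together with a surjective
  ring homomorphism \<open>\<sigma>\<close> to \<open>R\<close> from the free associative algebra on symbols
  \<open>free_var v\<close> (\<open>v \<in> V\<close>), which carries both the \<open>k\<close>-algebra structure
  (\<open>c \<mapsto> \<sigma> (free_const c)\<close>) and the linear map from \<open>V\<close> to \<open>R\<close>
  (\<open>v \<mapsto> \<sigma> (free_var v)\<close>).
\<close>

datatype 'a free_mon = Free_mon (letters: "'a list")

instantiation free_mon :: (type) monoid_add
begin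

definition zero_free_mon :: "'a free_mon" where
  "zero_free_mon = Free_mon []"

definition plus_free_mon :: "'a free_mon \<Rightarrow> 'a free_mon \<Rightarrow> 'a free_mon" where
  "plus_free_mon v w = Free_mon (letters v @ letters w)"

instance
  by standard (auto simp: zero_free_mon_def plus_free_mon_def)

end

type_synonym ('e, 'k) free_alg = "('e, 'k) grp_alg free_mon \<Rightarrow>\<^sub>0 'k"

definition free_const :: "'k \<Rightarrow> ('e, 'k::field) free_alg" where
  "free_const c = Poly_Mapping.single 0 c"

definition free_var :: "('e, 'k) grp_alg \<Rightarrow> ('e, 'k::field) free_alg" where
  "free_var v = Poly_Mapping.single (Free_mon [v]) 1"

definition Free :: "('e, 'k) grp_alg set \<Rightarrow> ('e, 'k::field) free_alg ring" where
  "Free V = ring_of_type_algebra\<lparr>carrier := {t. \<forall>w\<in>Poly_Mapping.keys t. set (letters w) \<subseteq> V}\<rparr>"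

text \<open>The structure map of \<open>kE\<close>: the algebra homomorphism induced by the inclusion of \<open>V\<close>.\<close>

definition kE_map :: "('e, 'k) free_alg \<Rightarrow> ('e::ab_group_add, 'k::field) grp_alg" where
  "kE_map t = (\<Sum>w\<in>Poly_Mapping.keys t. kscale (Poly_Mapping.lookup t w) (prod_list (letters w)))"

definition linear_rels :: "('e::ab_group_add, 'k::field) grp_alg set \<Rightarrow> ('e, 'k) free_alg set" where
  "linear_rels V =
     {free_var (u + v) - (free_var u + free_var v) | u v. u \<in> V \<and> v \<in> V} \<union>
     {free_var (kscale c v) - free_const c * free_var v | c v. v \<in> V}"

text \<open>
  By the linear relations, \<open>Free V\<close> modulo \<open>rel_ideal V S\<close> is the tensor algebra of \<open>V\<close>
  modulo the two-sided ideal generated by \<open>S\<close>.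
\<close>

definition rel_ideal :: "('e::ab_group_add, 'k::field) grp_alg set
    \<Rightarrow> ('e, 'k) free_alg set \<Rightarrow> ('e, 'k) free_alg set" where
  "rel_ideal V S = Idl\<^bsub>Free V\<^esub> (linear_rels V \<union> S)"

definition sym_ideal :: "('e::ab_group_add, 'k::field) grp_alg set \<Rightarrow> ('e, 'k) free_alg set" where
  "sym_ideal V =
     rel_ideal V {free_var u * free_var v - free_var v * free_var u | u v. u \<in> V \<and> v \<in> V}"

definition Sym :: "('e::ab_group_add, 'k::field) grp_alg set \<Rightarrow> ('e, 'k) free_alg set ring" where
  "Sym V = Free V Quot sym_ideal V"

definition Sym_map :: "('e::ab_group_add, 'k::field) grp_alg set
    \<Rightarrow> ('e, 'k) free_alg \<Rightarrow> ('e, 'k) free_alg set" where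
  "Sym_map V t = sym_ideal V +>\<^bsub>Free V\<^esub> t"

definition ext_ideal :: "('e::ab_group_add, 'k::field) grp_alg set \<Rightarrow> ('e, 'k) free_alg set" where
  "ext_ideal V = rel_ideal V {free_var v * free_var v | v. v \<in> V}"

definition Ext :: "('e::ab_group_add, 'k::field) grp_alg set \<Rightarrow> ('e, 'k) free_alg set ring" where
  "Ext V = Free V Quot ext_ideal V"

definition Ext_map :: "('e::ab_group_add, 'k::field) grp_alg set
    \<Rightarrow> ('e, 'k) free_alg \<Rightarrow> ('e, 'k) free_alg set" where
  "Ext_map V t = ext_ideal V +>\<^bsub>Free V\<^esub> t"

definition Sym_ge :: "('e::ab_group_add, 'k::field) grp_alg set \<Rightarrow> nat \<Rightarrow> ('e, 'k) free_alg set set" where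
  "Sym_ge V i =
     Sym_map V ` {t \<in> carrier (Free V). \<forall>w\<in>Poly_Mapping.keys t. i \<le> length (letters w)}"

text \<open>
  The augmentation ideal of the exterior algebra, i.e. the kernel of the augmentation, which takes
  the class of \<open>t\<close> to the constant term \<open>lookup t 0\<close>.
\<close>

definition Ext_aug :: "('e::ab_group_add, 'k::field) grp_alg set \<Rightarrow> ('e, 'k) free_alg set set" where
  "Ext_aug V = Ext_map V ` {t \<in> carrier (Free V). Poly_Mapping.lookup t 0 = 0}"

definition power_ideal :: "nat \<Rightarrow> ('e::ab_group_add, 'k::field) grp_alg set
    \<Rightarrow> ('e, 'k) free_alg set set" where
  "power_ideal q V = Idl\<^bsub>Sym V\<^esub> {Sym_map V (free_var v) [^]\<^bsub>Sym V\<^esub> q | v. v \<in> V}"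

definition kG :: "nat \<Rightarrow> ('e::ab_group_add, 'k::field) grp_alg set
    \<Rightarrow> ('e, 'k) free_alg set set ring" where
  "kG q V = Sym V Quot power_ideal q V"

definition kG_map :: "nat \<Rightarrow> ('e::ab_group_add, 'k::field) grp_alg set
    \<Rightarrow> ('e, 'k) free_alg \<Rightarrow> ('e, 'k) free_alg set set" where
  "kG_map q V t = power_ideal q V +>\<^bsub>Sym V\<^esub> Sym_map V t"


section \<open>Subquotients as \<open>kE\<close>-modules\<close>

text \<open>
  \<open>I/J\<close> for ideals \<open>J \<subseteq> I\<close> of \<open>R\<close>, where \<open>x \<in> kE\<close> acts by left multiplication by
  any of the elements of \<open>L x \<subseteq> R\<close>. The union in the scalar multiplication is a single coset
  of \<open>J\<close> exactly when the product does not depend on the choices, so the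
  \<^locale>\<open>Module.module\<close> axioms include well-definedness. The ring components \<open>mult\<close> and
  \<open>one\<close> of a module record are irrelevant.
\<close>

definition subquotient :: "('a, 'b) ring_scheme \<Rightarrow> ('c \<Rightarrow> 'a set) \<Rightarrow> 'a set \<Rightarrow> 'a set
    \<Rightarrow> ('c, 'a set) module" where
  "subquotient R L I J =
    \<lparr>carrier = (\<lambda>a. J +>\<^bsub>R\<^esub> a) ` I,
     monoid.mult = undefined,
     one = undefined,
     ring.zero = J,
     add = set_add R,
     module.smult = (\<lambda>x C. \<Union>y\<in>L x. \<Union>a\<in>C. J +>\<^bsub>R\<^esub> (y \<otimes>\<^bsub>R\<^esub> a))\<rparr>"

text \<open>
  The elements of \<open>R\<close> given by the same (noncommutative) polynomial in vectors of \<open>V\<close> as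
  \<open>x \<in> kE\<close>. Among the lifts of \<open>v \<in> V\<close> is its image \<open>\<sigma> (free_var v)\<close>.
\<close>

definition lifts :: "('e::ab_group_add, 'k::field) grp_alg set \<Rightarrow> (('e, 'k) free_alg \<Rightarrow> 'a)
    \<Rightarrow> ('e, 'k) grp_alg \<Rightarrow> 'a set" where
  "lifts V \<sigma> x = \<sigma> ` {t \<in> carrier (Free V). kE_map t = x}"

text \<open>The unique \<open>k\<close>-algebra automorphism of \<open>R\<close> that extends \<open>g \<in> GL V\<close>.\<close>

definition gl_ext :: "('a, 'b) ring_scheme \<Rightarrow> (('e, 'k) free_alg \<Rightarrow> 'a)
    \<Rightarrow> ('e::ab_group_add, 'k::field) grp_alg set
    \<Rightarrow> (('e, 'k) grp_alg \<Rightarrow> ('e, 'k) grp_alg) \<Rightarrow> 'a \<Rightarrow> 'a" where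
  "gl_ext R \<sigma> V g = (THE \<phi>. \<phi> \<in> extensional (carrier R) \<and> \<phi> \<in> ring_iso R R \<and>
     (\<forall>c. \<phi> (\<sigma> (free_const c)) = \<sigma> (free_const c)) \<and>
     (\<forall>v\<in>V. \<phi> (\<sigma> (free_var v)) = \<sigma> (free_var (g v))))"

definition coset_action :: "('a, 'b) ring_scheme \<Rightarrow> (('e, 'k) free_alg \<Rightarrow> 'a)
    \<Rightarrow> ('e::ab_group_add, 'k::field) grp_alg set \<Rightarrow> ('c, 'a set) module
    \<Rightarrow> (('e, 'k) grp_alg \<Rightarrow> ('e, 'k) grp_alg) \<Rightarrow> 'a set \<Rightarrow> 'a set" where
  "coset_action R \<sigma> V M g = (\<lambda>C \<in> carrier M. gl_ext R \<sigma> V g ` C)"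

definition kE_subquotient :: "nat \<Rightarrow> nat
    \<Rightarrow> (('e::ab_group_add, 'k::field) grp_alg, ('e, 'k) grp_alg set) module" where
  "kE_subquotient i j =
     subquotient kE (\<lambda>x. {x}) (ideal_power kE (Rad kE) i) (ideal_power kE (Rad kE) j)"

definition Ext_subquotient :: "('e::ab_group_add, 'k::field) grp_alg set \<Rightarrow> nat \<Rightarrow> nat
    \<Rightarrow> (('e, 'k) grp_alg, ('e, 'k) free_alg set set) module" where
  "Ext_subquotient V i j =
     subquotient (Ext V) (lifts V (Ext_map V))
       (ideal_power (Ext V) (Ext_aug V) i) (ideal_power (Ext V) (Ext_aug V) j)"

definition Sym_subquotient :: "('e::ab_group_add, 'k::field) grp_alg set \<Rightarrow> nat \<Rightarrow> nat
    \<Rightarrow> (('e, 'k) grp_alg, ('e, 'k) free_alg set set) module" where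
  "Sym_subquotient V i j =
     subquotient (Sym V) (lifts V (Sym_map V)) (Sym_ge V i) (Sym_ge V j)"

definition kG_subquotient :: "nat \<Rightarrow> ('e::ab_group_add, 'k::field) grp_alg set \<Rightarrow> nat \<Rightarrow> nat
    \<Rightarrow> (('e, 'k) grp_alg, ('e, 'k) free_alg set set set) module" where
  "kG_subquotient q V i j =
     subquotient (kG q V) (lifts V (kG_map q V))
       (ideal_power (kG q V) (Rad (kG q V)) i) (ideal_power (kG q V) (Rad (kG q V)) j)"


section \<open>Equivariance and constant types\<close>

definition gl_equivariant :: "('e::ab_group_add, 'k::field) grp_alg set
    \<Rightarrow> (('e, 'k) grp_alg, 'm) module
    \<Rightarrow> ((('e, 'k) grp_alg \<Rightarrow> ('e, 'k) grp_alg) \<Rightarrow> 'm \<Rightarrow> 'm) \<Rightarrow> bool" where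
  "gl_equivariant V M \<rho> \<longleftrightarrow>
     Module.module kE M \<and>
     group_action (GL V) (carrier M) \<rho> \<and>
     (\<forall>g\<in>carrier (GL V).
        (\<forall>m\<in>carrier M. \<forall>m'\<in>carrier M. \<rho> g (m \<oplus>\<^bsub>M\<^esub> m') = \<rho> g m \<oplus>\<^bsub>M\<^esub> \<rho> g m') \<and>
        (\<forall>c. \<forall>m\<in>carrier M. \<rho> g (kscale c 1 \<odot>\<^bsub>M\<^esub> m) = kscale c 1 \<odot>\<^bsub>M\<^esub> \<rho> g m) \<and>
        (\<forall>x. \<forall>m\<in>carrier M. \<rho> g (x \<odot>\<^bsub>M\<^esub> m) = gl_ext kE kE_map V g x \<odot>\<^bsub>M\<^esub> \<rho> g m))"

definition kspace :: "(('e::ab_group_add, 'k::field) grp_alg, 'm) module \<Rightarrow> ('k, 'm) module" where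
  "kspace M =
    \<lparr>carrier = carrier M,
     monoid.mult = monoid.mult M,
     one = one M,
     ring.zero = ring.zero M,
     add = add M,
     module.smult = (\<lambda>c m. kscale c 1 \<odot>\<^bsub>M\<^esub> m)\<rparr>"

definition k_fin_dim :: "(('e::ab_group_add, 'k::field) grp_alg, 'm) module \<Rightarrow> bool" where
  "k_fin_dim M \<longleftrightarrow> vectorspace.fin_dim (ring_of_type_algebra :: 'k ring) (kspace M)"

definition k_dim :: "(('e::ab_group_add, 'k::field) grp_alg, 'm) module \<Rightarrow> 'm set \<Rightarrow> nat" where
  "k_dim M W = vectorspace.dim (ring_of_type_algebra :: 'k ring) (kspace M\<lparr>carrier := W\<rparr>)"

definition Rad_pow :: "(('e::ab_group_add, 'k::field) grp_alg, 'm) module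
    \<Rightarrow> ('e, 'k) grp_alg set \<Rightarrow> nat \<Rightarrow> 'm set" where
  "Rad_pow M U l = LinearCombinations.module.span (ring_of_type_algebra :: 'k ring) (kspace M)
     {prod_list us \<odot>\<^bsub>M\<^esub> m | us m. length us = l \<and> set us \<subseteq> U \<and> m \<in> carrier M}"

definition Soc_pow :: "(('e::ab_group_add, 'k::field) grp_alg, 'm) module
    \<Rightarrow> ('e, 'k) grp_alg set \<Rightarrow> nat \<Rightarrow> 'm set" where
  "Soc_pow M U l = {m \<in> carrier M.
     \<forall>us. length us = l \<and> set us \<subseteq> U \<longrightarrow> prod_list us \<odot>\<^bsub>M\<^esub> m = \<zero>\<^bsub>M\<^esub>}"

definition constant_radical_type :: "nat \<Rightarrow> ('e::ab_group_add, 'k::field) grp_alg set \<Rightarrow> nat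
    \<Rightarrow> (('e, 'k) grp_alg, 'm) module \<Rightarrow> bool" where
  "constant_radical_type p V r M \<longleftrightarrow> k_fin_dim M \<and>
     (\<forall>l\<in>{1..(p - 1) * r}. \<exists>d. \<forall>U. r_plane V r U \<longrightarrow> k_dim M (Rad_pow M U l) = d)"

definition constant_socle_type :: "nat \<Rightarrow> ('e::ab_group_add, 'k::field) grp_alg set \<Rightarrow> nat
    \<Rightarrow> (('e, 'k) grp_alg, 'm) module \<Rightarrow> bool" where
  "constant_socle_type p V r M \<longleftrightarrow> k_fin_dim M \<and>
     (\<forall>l\<in>{1..(p - 1) * r}. \<exists>d. \<forall>U. r_plane V r U \<longrightarrow> k_dim M (Soc_pow M U l) = d)"

definition elementary_abelian :: "'e::{finite, ab_group_add} itself \<Rightarrow> nat \<Rightarrow> nat \<Rightarrow> bool" where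
  "elementary_abelian _ p n \<longleftrightarrow> (\<forall>x::'e. (\<Sum>i<p. x) = 0) \<and> card (UNIV :: 'e set) = p ^ n"

end

theory Submission
  imports Defs
begin

text \<open>
  All four families are subquotients \<open>\<sigma>(T\<^bsub>\<ge>i\<^esub>) / \<sigma>(T\<^bsub>\<ge>j\<^esub>)\<close>, where \<open>T\<^bsub>\<ge>i\<^esub>\<close> is spanned by the words of length
  at least \<open>i\<close> in the free algebra \<open>T\<close> on \<open>V\<close> and \<open>\<sigma>\<close> is a surjection from \<open>T\<close> whose kernel is
  stable under the substitutions \<open>v \<mapsto> g v\<close>, \<open>g \<in> GL(V)\<close>. Such a substitution therefore descends to
  \<open>\<sigma>(T)\<close> and preserves the filtration. The action of \<open>kE\<close> is well defined since the kernel of \<open>T \<rightarrow> kE\<close>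
  is generated by the linear relations, the commutators and the \<open>p\<close>-th powers of vectors, and these
  have large enough degree in \<open>\<sigma>(T)\<close>. That there are no further relations in \<open>kE\<close> is a dimension count:
  \<open>V\<close> generates \<open>kE\<close> because the augmentation ideal is nilpotent, \<open>dim V \<le> n\<close>, and so there are at most
  \<open>p^n = dim kE\<close> truncated monomials. Finally, \<open>GL(V)\<close> is transitive on \<open>r\<close>-planes, and \<open>g\<close> carries the
  radicals and socles for \<open>U\<close> to those for \<open>g U\<close>.
\<close>

section \<open>The free algebra and its degree filtration\<close>

text \<open>The obstacle is that \<open>kE\<close> acts only through lifts to words, so
  well-definedness needs the whole kernel of \<open>kE_map\<close>, not just some relations in it.
  Hence \<open>kernel_kE_map\<close> is stated for an arbitrary two-sided ideal \<open>P\<close>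
  that contains the three kinds of relations, and it concludes that \<open>P\<close> contains the
  kernel. Its uses differ only in \<open>P\<close>: the kernel of \<open>kE_map\<close> after a
  substitution gives the action of \<open>GL V\<close> on \<open>kE\<close>, the ideal
  \<open>Free_ge V 1\<close> identifies the radical, and the preimage of the degrees
  \<open>>= d\<close> gives the action on subquotients. The bounds on \<open>j - i\<close> record
  where the relations land. In \<open>kE\<close> they vanish, so there is no bound. In
  \<open>Sym V\<close> and \<open>kG q V\<close> the commutators vanish, and \<open>v ^ p\<close> of
  degree \<open>p\<close> remains. In \<open>Ext V\<close> a commutator is only known to have degree
  2, which explains the length 2. Letters are bare vectors, and their linear dependencies are
  ordinary relations between words. Maps can therefore be defined word by word, and linearity is
  checked only on \<open>linear_rels\<close>.\<close>

lemma zero_Free_mon: "0 = Free_mon []"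
  by (simp add: zero_free_mon_def)

lemma Free_mon_add [simp]: "Free_mon v + Free_mon w = Free_mon (v @ w)"
  by (simp add: plus_free_mon_def)

lemma Free_simps [simp]:
  "x \<otimes>\<^bsub>Free V\<^esub> y = x * y" "x \<oplus>\<^bsub>Free V\<^esub> y = x + y" "\<one>\<^bsub>Free V\<^esub> = 1" "\<zero>\<^bsub>Free V\<^esub> = 0"
  by (simp_all add: Free_def ring_of_type_algebra_def)

lemma carrier_Free:
  "t \<in> carrier (Free V) \<longleftrightarrow> (\<forall>w\<in>Poly_Mapping.keys t. set (letters w) \<subseteq> V)"
  by (simp add: Free_def)

definition Free_ge :: "('e, 'k) grp_alg set \<Rightarrow> nat \<Rightarrow> ('e, 'k::field) free_alg set" where
  "Free_ge V i = {t \<in> carrier (Free V). \<forall>w\<in>Poly_Mapping.keys t. i \<le> length (letters w)}"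

lemma Free_ge_0: "Free_ge V 0 = carrier (Free V)"
  by (simp add: Free_ge_def)

lemma Free_ge_carrier: "t \<in> Free_ge V i \<Longrightarrow> t \<in> carrier (Free V)"
  by (simp add: Free_ge_def)

lemma Free_ge_mono: "i \<le> j \<Longrightarrow> Free_ge V j \<subseteq> Free_ge V i"
  by (auto simp: Free_ge_def)

lemma Free_ge_1: "Free_ge V 1 = {t \<in> carrier (Free V). Poly_Mapping.lookup t 0 = 0}"
proof -
  have "(\<forall>w\<in>Poly_Mapping.keys t. 1 \<le> length (letters w)) \<longleftrightarrow> Poly_Mapping.lookup t 0 = 0"
    for t :: "('a, 'b) free_alg"
  proof -
    have *: "1 \<le> length (letters w) \<longleftrightarrow> w \<noteq> 0" for w :: "('a, 'b) grp_alg free_mon"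
      by (cases w) (auto simp: zero_Free_mon Suc_le_eq)
    show ?thesis
      unfolding * by (auto simp: in_keys_iff)
  qed
  then show ?thesis
    by (simp add: Free_ge_def)
qed

lemma word_in_Free_ge:
  "set w \<subseteq> V \<Longrightarrow> i \<le> length w \<Longrightarrow> Poly_Mapping.single (Free_mon w) c \<in> Free_ge V i"
  by (auto simp: Free_ge_def carrier_Free)

lemma word_in_Free: "set w \<subseteq> V \<Longrightarrow> Poly_Mapping.single (Free_mon w) c \<in> carrier (Free V)"
  by (auto simp: carrier_Free)

lemma zero_in_Free_ge [simp]: "0 \<in> Free_ge V i"
  by (simp add: Free_ge_def carrier_Free)

lemma add_in_Free_ge [intro]:
  "s \<in> Free_ge V i \<Longrightarrow> t \<in> Free_ge V i \<Longrightarrow> s + t \<in> Free_ge V i"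
  using Poly_Mapping.keys_add[of s t] by (fastforce simp: Free_ge_def carrier_Free)

lemma uminus_in_Free_ge [intro]: "t \<in> Free_ge V i \<Longrightarrow> - t \<in> Free_ge V i"
  by (simp add: Free_ge_def carrier_Free in_keys_iff)

lemma diff_in_Free_ge [intro]:
  "s \<in> Free_ge V i \<Longrightarrow> t \<in> Free_ge V i \<Longrightarrow> s - t \<in> Free_ge V i"
  using add_in_Free_ge[of s V i "- t"] by (simp add: uminus_in_Free_ge)

lemma sum_in_Free_ge: "(\<And>a. a \<in> A \<Longrightarrow> f a \<in> Free_ge V i) \<Longrightarrow> sum f A \<in> Free_ge V i"
  by (induction A rule: infinite_finite_induct) auto

lemma mult_in_Free_ge [intro]:
  assumes "s \<in> Free_ge V i" "t \<in> Free_ge V j"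
  shows "s * t \<in> Free_ge V (i + j)"
proof -
  have "set (letters w) \<subseteq> V \<and> i + j \<le> length (letters w)" if w: "w \<in> Poly_Mapping.keys (s * t)" for w
  proof -
    obtain a b where "w = a + b" "a \<in> Poly_Mapping.keys s" "b \<in> Poly_Mapping.keys t"
      using w Poly_Mapping.keys_mult[of s t] by blast
    then show ?thesis
      using assms by (auto simp: Free_ge_def carrier_Free plus_free_mon_def add_mono)
  qed
  then show ?thesis
    by (auto simp: Free_ge_def carrier_Free)
qed

lemmas zero_in_Free = zero_in_Free_ge[where i = 0, unfolded Free_ge_0]
  and add_in_Free = add_in_Free_ge[where i = 0, unfolded Free_ge_0]
  and uminus_in_Free = uminus_in_Free_ge[where i = 0, unfolded Free_ge_0]
  and diff_in_Free = diff_in_Free_ge[where i = 0, unfolded Free_ge_0]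
  and sum_in_Free = sum_in_Free_ge[where i = 0, unfolded Free_ge_0]
  and mult_in_Free = mult_in_Free_ge[where i = 0 and j = 0, unfolded Free_ge_0 add_0]

lemma one_in_Free: "1 \<in> carrier (Free V)"
  by (simp add: carrier_Free zero_Free_mon)

lemma mult_in_Free_ge':
  assumes "t \<in> Free_ge V i" "s \<in> carrier (Free V)"
  shows "s * t \<in> Free_ge V i" "t * s \<in> Free_ge V i"
  using mult_in_Free_ge[of s V 0 t i] mult_in_Free_ge[of t V i s 0] assms by (simp_all add: Free_ge_0)

lemma free_const_in_Free: "free_const c \<in> carrier (Free V)"
  by (simp add: carrier_Free free_const_def zero_Free_mon)

lemma free_var_in_Free: "v \<in> V \<Longrightarrow> free_var v \<in> carrier (Free V)"
  by (simp add: carrier_Free free_var_def)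

lemma ring_Free: "ring (Free V)"
proof (rule ringI)
  show "abelian_group (Free V)"
  proof (rule abelian_groupI)
    show "\<exists>y\<in>carrier (Free V). y \<oplus>\<^bsub>Free V\<^esub> x = \<zero>\<^bsub>Free V\<^esub>" if "x \<in> carrier (Free V)" for x
      using uminus_in_Free[OF that] by (intro bexI[of _ "- x"]) auto
  qed (auto simp: add_in_Free algebra_simps zero_in_Free)
  show "Group.monoid (Free V)"
    by (rule monoidI) (auto simp: mult_in_Free one_in_Free mult.assoc)
qed (auto simp: algebra_simps)

lemma uminus_Free [simp]:
  assumes "t \<in> carrier (Free V)"
  shows "\<ominus>\<^bsub>Free V\<^esub> t = - t"
proof -
  interpret ring "Free V"
    by (rule ring_Free)
  show ?thesis
    using assms uminus_in_Free[OF assms] by (intro minus_equality) auto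
qed

text \<open>Adds up the monomials of \<open>t\<close> one at a time; every partial sum has its words
  among those of \<open>t\<close>, so it stays in the filtration.\<close>

lemma Free_ge_induct [consumes 1, case_names mono add zero]:
  assumes t: "t \<in> Free_ge V i"
    and mono: "\<And>w c. set w \<subseteq> V \<Longrightarrow> i \<le> length w \<Longrightarrow> P (Poly_Mapping.single (Free_mon w) c)"
    and add: "\<And>s t. s \<in> Free_ge V i \<Longrightarrow> t \<in> Free_ge V i \<Longrightarrow> P s \<Longrightarrow> P t \<Longrightarrow> P (s + t)"
    and zero: "P 0"
  shows "P t"
proof -
  let ?f = "\<lambda>w. Poly_Mapping.single w (Poly_Mapping.lookup t w)"
  \<comment> \<open>Membership is carried through the induction because the rule \<open>add\<close>
    offers it for both summands.\<close>
  have "sum ?f A \<in> Free_ge V i \<and> P (sum ?f A)" if "A \<subseteq> Poly_Mapping.keys t" for A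
    using finite_subset[OF that finite_keys] that
  proof (induction A rule: finite_induct)
    case (insert w A)
    have w: "set (letters w) \<subseteq> V" "i \<le> length (letters w)"
      using t insert.prems by (auto simp: Free_ge_def carrier_Free)
    show ?case
      using insert word_in_Free_ge[OF w] mono[OF w] by (auto intro: add)
  qed (simp add: zero)
  moreover have "sum ?f (Poly_Mapping.keys t) = t"
    by (rule poly_mapping_eqI) (auto simp: lookup_sum lookup_single when_def in_keys_iff)
  ultimately show ?thesis
    by (metis order_refl)
qed

lemmas Free_induct [consumes 1, case_names mono add zero] =
  Free_ge_induct[where i = 0, unfolded Free_ge_0, simplified]

lemma ideal_Free_ge: "ideal (Free_ge V i) (Free V)"
proof (rule idealI)
  interpret ring "Free V"
    by (rule ring_Free)
  show "subgroup (Free_ge V i) (add_monoid (Free V))"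
    by (rule add.subgroupI)
      (auto simp: Free_ge_carrier uminus_in_Free_ge add_in_Free_ge a_inv_def[symmetric] intro: zero_in_Free_ge)
qed (auto simp: ring_Free mult_in_Free_ge')

lemma ideal_FreeD:
  assumes "ideal P (Free V)"
  shows "0 \<in> P" "\<And>s t. s \<in> P \<Longrightarrow> t \<in> P \<Longrightarrow> s + t \<in> P" "\<And>t. t \<in> P \<Longrightarrow> - t \<in> P"
    "\<And>s t. s \<in> P \<Longrightarrow> t \<in> P \<Longrightarrow> s - t \<in> P"
    "\<And>s t. t \<in> P \<Longrightarrow> s \<in> carrier (Free V) \<Longrightarrow> s * t \<in> P"
    "\<And>s t. t \<in> P \<Longrightarrow> s \<in> carrier (Free V) \<Longrightarrow> t * s \<in> P"
    "P \<subseteq> carrier (Free V)"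
proof -
  interpret ideal P "Free V"
    by fact
  show 0: "0 \<in> P" and P: "P \<subseteq> carrier (Free V)"
    using additive_subgroup.zero_closed[OF additive_subgroup_axioms] a_subset by simp_all
  show 1: "s + t \<in> P" if "s \<in> P" "t \<in> P" for s t
    using additive_subgroup.a_closed[OF additive_subgroup_axioms that] by simp
  show 2: "- t \<in> P" if "t \<in> P" for t
    using additive_subgroup.a_inv_closed[OF additive_subgroup_axioms that] that P by (simp add: subset_iff)
  show "s - t \<in> P" if "s \<in> P" "t \<in> P" for s t
    using 1[OF that(1) 2[OF that(2)]] by simp
  show "s * t \<in> P" "t * s \<in> P" if "t \<in> P" "s \<in> carrier (Free V)" for s t
    using I_l_closed[OF that] I_r_closed[OF that] by simp_all
qed


section \<open>Homomorphisms from the free algebra\<close>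

text \<open>Here \<open>g\<close> is any map of letters. Linearity of \<open>g\<close> becomes
  relevant only in \<open>free_map_linear_rels\<close>.\<close>

definition free_map :: "(('e, 'k) grp_alg \<Rightarrow> ('e, 'k) grp_alg) \<Rightarrow> ('e, 'k) free_alg \<Rightarrow> ('e, 'k::field) free_alg"
  where "free_map g t = (\<Sum>w\<in>Poly_Mapping.keys t.
    Poly_Mapping.single (Free_mon (map g (letters w))) (Poly_Mapping.lookup t w))"

lemma free_map_word [simp]:
  "free_map g (Poly_Mapping.single (Free_mon w) c) = Poly_Mapping.single (Free_mon (map g w)) c"
  by (cases "c = 0") (simp_all add: free_map_def)

lemma free_map_0 [simp]: "free_map g 0 = 0"
  by (simp add: free_map_def)

lemma free_map_add: "free_map g (s + t) = free_map g s + free_map g t"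
  unfolding free_map_def by (rule setsum_keys_plus_distrib) (simp_all add: single_add)

lemma free_map_diff: "free_map g (s - t) = free_map g s - free_map g t"
  using free_map_add[of g "s - t" t] by (simp add: algebra_simps)

lemma free_map_mult: "free_map g (s * t) = free_map g s * free_map g t"
proof -
  \<comment> \<open>With all vectors allowed as letters, the induction over words applies to every
    element of the type.\<close>
  have UN: "x \<in> carrier (Free UNIV)" for x :: "('a, 'b) free_alg"
    by (simp add: carrier_Free)
  have *: "free_map g (Poly_Mapping.single (Free_mon w) c * t) =
      free_map g (Poly_Mapping.single (Free_mon w) c) * free_map g t" for w c
    using UN[of t] by (induction t rule: Free_induct) (simp_all add: mult_single free_map_add distrib_left)
  show ?thesis
    using UN[of s] by (induction s rule: Free_induct) (simp_all add: * free_map_add distrib_right)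
qed

lemma free_map_const [simp]: "free_map g (free_const c) = free_const c"
  by (simp add: free_const_def zero_Free_mon)

lemma free_map_1 [simp]: "free_map g 1 = 1"
  using free_map_const[of g 1] by (simp add: free_const_def)

lemma free_map_var [simp]: "free_map g (free_var v) = free_var (g v)"
  by (simp add: free_var_def)

lemma free_map_in_Free_ge:
  assumes "g ` V \<subseteq> V" "t \<in> Free_ge V i"
  shows "free_map g t \<in> Free_ge V i"
  using assms(2)
proof (induction rule: Free_ge_induct)
  case (mono w c)
  then show ?case
    using assms(1) by (force intro: word_in_Free_ge)
qed (auto simp: free_map_add)

lemmas free_map_in_Free = free_map_in_Free_ge[where i = 0, unfolded Free_ge_0]

lemma free_map_comp:
  assumes "t \<in> carrier (Free V)" "\<And>v. v \<in> V \<Longrightarrow> g (h v) = f v"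
  shows "free_map g (free_map h t) = free_map f t"
  using assms(1)
proof (induction rule: Free_induct)
  case (mono w c)
  then have "map (g \<circ> h) w = map f w"
    using assms(2) by (intro map_cong) auto
  then show ?case
    by (simp only: free_map_word list.map_comp)
qed (auto simp: free_map_add)

lemma free_map_id:
  assumes "t \<in> carrier (Free V)" "\<And>v. v \<in> V \<Longrightarrow> g v = v"
  shows "free_map g t = t"
  using assms(1)
proof (induction rule: Free_induct)
  case (mono w c)
  then have "map g w = w"
    using assms(2) by (intro map_idI) auto
  then show ?case
    by simp
qed (auto simp: free_map_add)

section \<open>Scalars of the group algebra and evaluation of words in it\<close>

lemma vector_space_kscale: "vector_space (kscale :: 'k \<Rightarrow> ('e::ab_group_add, 'k::field) grp_alg \<Rightarrow> _)"
  by standard (simp_all add: kscale_def distrib_left distrib_right single_add mult_single flip: mult.assoc)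

interpretation kscale: vector_space "kscale :: 'k \<Rightarrow> ('e::ab_group_add, 'k::field) grp_alg \<Rightarrow> _"
  by (rule vector_space_kscale)

lemma kscale_mult: "kscale c x * y = kscale c (x * y)" "x * kscale c y = kscale c (x * y)"
  by (simp_all add: kscale_def ac_simps)

lemma kE_map_word [simp]: "kE_map (Poly_Mapping.single (Free_mon w) c) = kscale c (prod_list w)"
  by (cases "c = 0") (simp_all add: kE_map_def)

lemma kE_map_0 [simp]: "kE_map 0 = 0"
  by (simp add: kE_map_def)

lemma kE_map_add: "kE_map (s + t) = kE_map s + kE_map t"
  unfolding kE_map_def by (rule setsum_keys_plus_distrib) (simp_all add: kscale.scale_left_distrib)

lemma kE_map_diff: "kE_map (s - t) = kE_map s - kE_map t"
  using kE_map_add[of "s - t" t] by (simp add: algebra_simps)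

lemma kE_map_sum: "kE_map (sum f A) = (\<Sum>a\<in>A. kE_map (f a))"
  by (induction A rule: infinite_finite_induct) (simp_all add: kE_map_add)

lemma kE_map_mult: "kE_map (s * t) = kE_map s * kE_map t"
proof -
  have UN: "x \<in> carrier (Free UNIV)" for x :: "('a, 'b) free_alg"
    by (simp add: carrier_Free)
  have *: "kE_map (Poly_Mapping.single (Free_mon w) c * t) =
      kE_map (Poly_Mapping.single (Free_mon w) c) * kE_map t" for w c
    using UN[of t]
    by (induction t rule: Free_induct) (simp_all add: mult_single kE_map_add distrib_left kscale_mult)
  show ?thesis
    using UN[of s] by (induction s rule: Free_induct) (simp_all add: * kE_map_add distrib_right)
qed

lemma kE_map_const [simp]: "kE_map (free_const c) = kscale c 1"
  by (simp add: free_const_def zero_Free_mon)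

lemma kE_map_1 [simp]: "kE_map 1 = 1"
  using kE_map_const[of 1] by (simp add: free_const_def)

lemma kE_map_var [simp]: "kE_map (free_var v) = v"
  by (simp add: free_var_def)

lemma kE_simps [simp]:
  "carrier kE = UNIV" "x \<otimes>\<^bsub>kE\<^esub> y = x * y" "x \<oplus>\<^bsub>kE\<^esub> y = x + y" "\<one>\<^bsub>kE\<^esub> = 1" "\<zero>\<^bsub>kE\<^esub> = 0"
  by (simp_all add: kE_def ring_of_type_algebra_def)

lemma cring_kE: "cring (kE :: ('e::ab_group_add, 'k::field) grp_alg ring)"
  unfolding kE_def by (rule cring_from_type_algebra)

lemma word_Cons:
  "Poly_Mapping.single (Free_mon (v # w)) (c::'k::field) = free_var v * Poly_Mapping.single (Free_mon w) c"
  by (simp add: free_var_def mult_single)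

lemma word_append:
  "Poly_Mapping.single (Free_mon (v @ w)) (c::'k::field) =
    Poly_Mapping.single (Free_mon v) 1 * Poly_Mapping.single (Free_mon w) c"
  by (simp add: mult_single)

lemma word_coeff:
  "Poly_Mapping.single (Free_mon w) (c::'k::field) = free_const c * Poly_Mapping.single (Free_mon w) 1"
  by (simp add: free_const_def mult_single zero_Free_mon)

text \<open>By multilinearity every word in \<open>V\<close> is, modulo the linear relations, a combination of words
  of the same length in \<open>B\<close>.\<close>

lemma Free_ge_induct_spanning [consumes 3, case_names mono add cong subspace basis spanning zero]:
  assumes t: "t \<in> Free_ge V i" and P: "ideal P (Free V)" "linear_rels V \<subseteq> P"
    and mono: "\<And>w c. set w \<subseteq> B \<Longrightarrow> i \<le> length w \<Longrightarrow> Q (Poly_Mapping.single (Free_mon w) c)"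
    and add: "\<And>s t. s \<in> Free_ge V i \<Longrightarrow> t \<in> Free_ge V i \<Longrightarrow> Q s \<Longrightarrow> Q t \<Longrightarrow> Q (s + t)"
    and cong: "\<And>s t. s \<in> Free_ge V i \<Longrightarrow> t \<in> Free_ge V i \<Longrightarrow> Q s \<Longrightarrow> s - t \<in> P \<Longrightarrow> Q t"
    and V: "kscale.subspace V" and B: "B \<subseteq> V" "V \<subseteq> kscale.span B"
    and zero: "Q 0"
  shows "Q t"
proof -
  \<comment> \<open>The letters are treated from left to right: those of \<open>w1\<close> already
    lie in \<open>B\<close>, those of \<open>w2\<close> are still arbitrary vectors of
    \<open>V\<close>.\<close>
  have word: "Q (Poly_Mapping.single (Free_mon (w1 @ w2)) c)"
    if "set w1 \<subseteq> B" "set w2 \<subseteq> V" "i \<le> length (w1 @ w2)" for w1 w2 c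
    using that
  proof (induction w2 arbitrary: w1 c)
    case Nil
    then show ?case
      by (simp add: mono)
  next
    case (Cons v w2)
    let ?W = "\<lambda>u c. Poly_Mapping.single (Free_mon (w1 @ u # w2)) c"
    have W: "?W u c \<in> Free_ge V i" if "u \<in> V" for u c
      using that Cons.prems B by (intro word_in_Free_ge) auto
    have fac: "?W u c = Poly_Mapping.single (Free_mon w1) 1 * free_var u * Poly_Mapping.single (Free_mon w2) c"
      for u c
      by (simp add: free_var_def mult_single)
    have rel: "Poly_Mapping.single (Free_mon w1) 1 * r * Poly_Mapping.single (Free_mon w2) c \<in> P"
      if "r \<in> linear_rels V" for r c
      using that P(2) Cons.prems B by (intro ideal_FreeD[OF P(1)] word_in_Free) auto
    have "v \<in> kscale.span B"
      using Cons.prems B by auto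
    then have "v \<in> V \<and> (\<forall>c. Q (?W v c))"
    proof (induction rule: kscale.span_induct)
      case (step b)
      have "Q (Poly_Mapping.single (Free_mon ((w1 @ [b]) @ w2)) c)" for c
        using Cons.prems step by (intro Cons.IH) auto
      then show ?case
        using step B by auto
    next
      case base
      show ?case
      proof (rule kscale.subspaceI)
          have "Q (?W 0 c)" for c
        proof (rule cong[OF zero_in_Free_ge W zero])
          show "0 \<in> V"
            by (rule kscale.subspace_0[OF V])
          \<comment> \<open>The scaling relation for the scalar \<open>0\<close> makes every word
            with the letter \<open>0\<close> congruent to zero.\<close>
          then have "free_var (kscale 0 0) - free_const 0 * free_var 0 \<in> linear_rels V"
            unfolding linear_rels_def by blast
          from rel[OF this, of c] show "0 - ?W 0 c \<in> P"
            using ideal_FreeD(3)[OF P(1)] by (fastforce simp: fac free_const_def)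
        qed
        then show "0 \<in> {x. x \<in> V \<and> (\<forall>c. Q (?W x c))}"
          using kscale.subspace_0[OF V] by simp
      next
        fix x y assume "x \<in> {x. x \<in> V \<and> (\<forall>c. Q (?W x c))}" "y \<in> {x. x \<in> V \<and> (\<forall>c. Q (?W x c))}"
        then have xy: "x \<in> V" "y \<in> V" "\<And>c. Q (?W x c)" "\<And>c. Q (?W y c)"
          by auto
        have "Q (?W (x + y) c)" for c
        proof (rule cong[OF add_in_Free_ge[OF W W] W add[OF W W]])
          have "free_var (x + y) - (free_var x + free_var y) \<in> linear_rels V"
            using xy unfolding linear_rels_def by blast
          from ideal_FreeD(3)[OF P(1) rel[OF this, of c]]
          show "?W x c + ?W y c - ?W (x + y) c \<in> P"
            unfolding fac by (simp add: algebra_simps)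
        qed (use xy kscale.subspace_add[OF V] in auto)
        then show "x + y \<in> {x. x \<in> V \<and> (\<forall>c. Q (?W x c))}"
          using xy kscale.subspace_add[OF V] by simp
      next
        fix a x assume "x \<in> {x. x \<in> V \<and> (\<forall>c. Q (?W x c))}"
        then have x: "x \<in> V" "\<And>c. Q (?W x c)"
          by auto
        have "Q (?W (kscale a x) c)" for c
        proof (rule cong[OF W W])
          have "free_var (kscale a x) - free_const a * free_var x \<in> linear_rels V"
            using x unfolding linear_rels_def by blast
          from ideal_FreeD(3)[OF P(1) rel[OF this, of c]]
          show "?W x (a * c) - ?W (kscale a x) c \<in> P"
            unfolding fac by (simp add: algebra_simps free_const_def free_var_def mult_single zero_Free_mon)
        qed (use x kscale.subspace_scale[OF V] in auto)
        then show "kscale a x \<in> {x. x \<in> V \<and> (\<forall>c. Q (?W x c))}"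
          using x kscale.subspace_scale[OF V] by simp
      qed
    qed
    then show ?case
      by blast
  qed
  show ?thesis
    using t
  proof (induction rule: Free_ge_induct)
    case (mono w c)
    then show ?case
      using word[of "[]" w c] by simp
  qed (simp_all add: add zero)
qed

section \<open>The general linear group\<close>

lemma GL_D:
  assumes "g \<in> carrier (GL V)"
  shows "g \<in> Bij V" "g ` V = V" "inj_on g V"
    "\<And>v. v \<in> V \<Longrightarrow> g v \<in> V"
    "\<And>u v. u \<in> V \<Longrightarrow> v \<in> V \<Longrightarrow> g (u + v) = g u + g v"
    "\<And>c v. v \<in> V \<Longrightarrow> g (kscale c v) = kscale c (g v)"
  using assms by (auto simp: GL_def Bij_def bij_betw_def)

lemma GL_mult:
  assumes "g \<in> carrier (GL V)" "h \<in> carrier (GL V)"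
  shows "g \<otimes>\<^bsub>GL V\<^esub> h = compose V g h"
  using assms by (simp add: GL_def BijGroup_def)

lemma group_GL:
  assumes V: "kscale.subspace V"
  shows "group (GL V)"
proof -
  interpret B: group "BijGroup V"
    by (rule group_BijGroup)
  define H where "H = carrier (GL V)"
  have "subgroup H (BijGroup V)"
  proof (rule B.subgroupI)
    show "H \<subseteq> carrier (BijGroup V)"
      by (auto simp: H_def GL_def BijGroup_def)
    have "(\<lambda>v\<in>V. v) \<in> H"
      using id_Bij[of V] kscale.subspace_add[OF V] kscale.subspace_scale[OF V] by (auto simp: H_def GL_def)
    then show "H \<noteq> {}"
      by auto
  next
    fix g assume g: "g \<in> H"
    note gD = GL_D[OF g[unfolded H_def]]
    let ?h = "\<lambda>v\<in>V. inv_into V g v"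
    have inv: "inv\<^bsub>BijGroup V\<^esub> g = ?h"
      using inv_BijGroup[OF gD(1)] by simp
    have hV: "inv_into V g v \<in> V" "g (inv_into V g v) = v" if "v \<in> V" for v
      using that gD(2) by (auto intro: inv_into_into f_inv_into_f)
    have eq: "inv_into V g v = u" if "u \<in> V" "g u = v" for u v
      using that gD(3) by (auto simp: inv_into_f_eq)
    have "?h \<in> Bij V"
      by (rule restrict_inv_into_Bij[OF gD(1)])
    then show "inv\<^bsub>BijGroup V\<^esub> g \<in> H"
      unfolding inv using kscale.subspace_add[OF V] kscale.subspace_scale[OF V]
      by (auto simp: H_def GL_def gD hV intro!: eq)
  next
    fix g h assume gh: "g \<in> H" "h \<in> H"
    note gD = GL_D[OF gh(1)[unfolded H_def]] and hD = GL_D[OF gh(2)[unfolded H_def]]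
    have "compose V g h \<in> Bij V"
      using gD(1) hD(1) by (rule compose_Bij)
    then show "g \<otimes>\<^bsub>BijGroup V\<^esub> h \<in> H"
      using gD hD kscale.subspace_add[OF V] kscale.subspace_scale[OF V]
      by (simp add: H_def GL_def BijGroup_def compose_def)
  qed
  then have "group (BijGroup V\<lparr>carrier := H\<rparr>)"
    by (rule subgroup.subgroup_is_group) (rule group_BijGroup)
  moreover have "BijGroup V\<lparr>carrier := H\<rparr> = GL V"
    by (simp add: H_def GL_def)
  ultimately show ?thesis
    by simp
qed

lemma GL_inverse:
  assumes V: "kscale.subspace V" and g: "g \<in> carrier (GL V)"
  obtains h where "h \<in> carrier (GL V)" "\<And>v. v \<in> V \<Longrightarrow> g (h v) = v" "\<And>v. v \<in> V \<Longrightarrow> h (g v) = v"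
proof
  interpret group "GL V"
    by (rule group_GL[OF V])
  let ?h = "inv\<^bsub>GL V\<^esub> g"
  show h: "?h \<in> carrier (GL V)"
    using g by simp
  have one: "\<one>\<^bsub>GL V\<^esub> = (\<lambda>v\<in>V. v)"
    by (simp add: GL_def BijGroup_def)
  have "compose V g ?h = (\<lambda>v\<in>V. v)" "compose V ?h g = (\<lambda>v\<in>V. v)"
    using r_inv[OF g] l_inv[OF g] g h by (simp_all add: GL_mult one)
  then show "g (?h v) = v" "?h (g v) = v" if "v \<in> V" for v
    using that by (metis compose_eq restrict_apply')+
qed


section \<open>Quotients of the free algebra\<close>

text \<open>The assumption \<open>stable\<close> is what makes substitutions descend to
  \<open>R\<close>; it has to be proved separately for each of the four algebras.\<close>

locale free_quotient = ring R for R (structure) +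
  fixes V :: "('e::ab_group_add, 'k::field) grp_alg set" and \<sigma> :: "('e, 'k) free_alg \<Rightarrow> 'a"
  assumes subspace: "kscale.subspace V"
    and hom: "\<sigma> \<in> ring_hom (Free V) R"
    and surj: "carrier R \<subseteq> \<sigma> ` carrier (Free V)"
    and stable: "\<And>g t. g \<in> carrier (GL V) \<Longrightarrow> t \<in> carrier (Free V) \<Longrightarrow> \<sigma> t = \<zero> \<Longrightarrow> \<sigma> (free_map g t) = \<zero>"
begin

sublocale h: ring_hom_ring "Free V" R \<sigma>
  by (intro ring_hom_ringI2 ring_Free ring_axioms hom)

lemma sig_closed: "t \<in> carrier (Free V) \<Longrightarrow> \<sigma> t \<in> carrier R"
  by simp

lemma sig_add: "s \<in> carrier (Free V) \<Longrightarrow> t \<in> carrier (Free V) \<Longrightarrow> \<sigma> (s + t) = \<sigma> s \<oplus> \<sigma> t"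
  using h.hom_add by simp

lemma sig_mult: "s \<in> carrier (Free V) \<Longrightarrow> t \<in> carrier (Free V) \<Longrightarrow> \<sigma> (s * t) = \<sigma> s \<otimes> \<sigma> t"
  using h.hom_mult by simp

lemma sig_one: "\<sigma> 1 = \<one>"
  using h.hom_one by simp

lemma sig_zero: "\<sigma> 0 = \<zero>"
  using h.hom_zero by simp

lemma sig_uminus: "t \<in> carrier (Free V) \<Longrightarrow> \<sigma> (- t) = \<ominus> \<sigma> t"
  using h.hom_a_inv[of t] by simp

lemma sig_diff: "s \<in> carrier (Free V) \<Longrightarrow> t \<in> carrier (Free V) \<Longrightarrow> \<sigma> (s - t) = \<sigma> s \<ominus> \<sigma> t"
  using sig_add[of s "- t"] by (simp add: sig_uminus uminus_in_Free a_minus_def)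

lemma eq_iff_diff:
  assumes "s \<in> carrier (Free V)" "t \<in> carrier (Free V)"
  shows "\<sigma> s = \<sigma> t \<longleftrightarrow> \<sigma> (s - t) = \<zero>"
  using assms by (simp add: sig_diff)

lemma lift:
  assumes "x \<in> carrier R"
  obtains t where "t \<in> carrier (Free V)" "x = \<sigma> t"
  using assms surj that by blast

lemma ideal_kernel: "ideal {t \<in> carrier (Free V). \<sigma> t = \<zero>} (Free V)"
  using h.kernel_is_ideal unfolding a_kernel_def' .

abbreviation ge :: "nat \<Rightarrow> 'a set" where
  "ge i \<equiv> \<sigma> ` Free_ge V i"

lemma ge_0: "ge 0 = carrier R"
  using surj sig_closed by (auto simp: Free_ge_0)

lemma ideal_ge: "ideal (ge i) R"
proof (rule idealI)
  show "subgroup (ge i) (add_monoid R)"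
  proof (rule add.subgroupI)
    show "\<ominus> a \<in> ge i" if a: "a \<in> ge i" for a
    proof -
      obtain t where "t \<in> Free_ge V i" "a = \<sigma> t"
        using a by auto
      then show ?thesis
        by (intro image_eqI[of _ _ "- t"]) (auto simp: sig_uminus Free_ge_carrier)
    qed
    show "a \<oplus> b \<in> ge i" if ab: "a \<in> ge i" "b \<in> ge i" for a b
    proof -
      obtain s t where "t \<in> Free_ge V i" "a = \<sigma> s" "s \<in> Free_ge V i" "b = \<sigma> t"
        using ab by auto
      then show ?thesis
        by (intro image_eqI[of _ _ "s + t"]) (auto simp: sig_add Free_ge_carrier)
    qed
    show "ge i \<noteq> {}"
      using zero_in_Free_ge[of V i] by blast
  qed (auto simp: Free_ge_carrier sig_closed)
next
  fix a x assume "a \<in> ge i" "x \<in> carrier R"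
  then obtain s t where st: "t \<in> Free_ge V i" "a = \<sigma> t" "s \<in> carrier (Free V)" "x = \<sigma> s"
    using lift[of x] by blast
  show "x \<otimes> a \<in> ge i"
    using st by (intro image_eqI[of _ _ "s * t"]) (auto simp: sig_mult Free_ge_carrier mult_in_Free_ge')
  show "a \<otimes> x \<in> ge i"
    using st by (intro image_eqI[of _ _ "t * s"]) (auto simp: sig_mult Free_ge_carrier mult_in_Free_ge')
qed (rule ring_axioms)

text \<open>A word of length at least \<open>Suc i\<close> factors into one of length at least
  \<open>i\<close> and a single letter. The last letter is split off because
  \<open>ideal_power\<close> puts the new factor on the right.\<close>

lemma ideal_power_ge: "ideal_power R (ge 1) i = ge i"
proof (induction i)
  case (Suc i)
  have *: "ideal_prod R (ge i) (ge 1) = ge (Suc i)"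
  proof
    show "ideal_prod R (ge i) (ge 1) \<subseteq> ge (Suc i)"
    proof
      fix x assume "x \<in> ideal_prod R (ge i) (ge 1)"
      then show "x \<in> ge (Suc i)"
      proof (induction rule: ideal_prod.induct)
        case (prod a b)
        then obtain s t where "s \<in> Free_ge V i" "a = \<sigma> s" "t \<in> Free_ge V 1" "b = \<sigma> t"
          by auto
        then show ?case
          using mult_in_Free_ge[of s V i t 1]
          by (intro image_eqI[of _ _ "s * t"]) (auto simp: sig_mult Free_ge_carrier)
      next
        case (sum a b)
        from sum.IH show ?case
          by (rule additive_subgroup.a_closed[OF ideal.axioms(1)[OF ideal_ge]])
      qed
    qed
    show "ge (Suc i) \<subseteq> ideal_prod R (ge i) (ge 1)"
    proof
      fix x assume "x \<in> ge (Suc i)"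
      then obtain t where t: "t \<in> Free_ge V (Suc i)" "x = \<sigma> t"
        by auto
      have word: "\<sigma> (Poly_Mapping.single (Free_mon w) c) \<in> ideal_prod R (ge i) (ge 1)"
        if w: "set w \<subseteq> V" "Suc i \<le> length w" for w c
      proof -
        obtain w' v where w': "w = w' @ [v]"
          using w by (cases w rule: rev_cases) auto
        have mem: "Poly_Mapping.single (Free_mon w') c \<in> Free_ge V i" "free_var v \<in> Free_ge V 1"
          using w by (auto simp: w' free_var_def intro: word_in_Free_ge)
        have "Poly_Mapping.single (Free_mon w) c = Poly_Mapping.single (Free_mon w') c * free_var v"
          by (simp add: w' free_var_def mult_single)
        then have "\<sigma> (Poly_Mapping.single (Free_mon w) c) =
            \<sigma> (Poly_Mapping.single (Free_mon w') c) \<otimes> \<sigma> (free_var v)"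
          using mem by (simp add: sig_mult Free_ge_carrier)
        then show ?thesis
          using mem by (auto intro: ideal_prod.prod)
      qed
      have "\<sigma> t \<in> ideal_prod R (ge i) (ge 1)"
        using t(1)
      proof (induction rule: Free_ge_induct)
        case (add s t)
        then show ?case
          by (auto simp: sig_add Free_ge_carrier intro: ideal_prod.sum)
      next
        case zero
        show ?case
          using additive_subgroup.zero_closed[OF ideal.axioms(1)[OF ideal_prod_is_ideal[OF ideal_ge ideal_ge]]]
          by (simp add: sig_zero)
      qed (rule word)
      then show "x \<in> ideal_prod R (ge i) (ge 1)"
        using t by simp
    qed
  qed
  show ?case
    by (simp only: ideal_power.simps Suc.IH *)
qed (simp only: ideal_power.simps ge_0)

text \<open>Existence: substitute in any preimage, where \<open>stable\<close> removes the
  dependence on the choice. Uniqueness: scalars and letters generate \<open>R\<close>. Since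
  \<open>gl_ext\<close> is a definite description, both are needed before it can be computed on
  words.\<close>

lemma gl_ext_unique:
  assumes g: "g \<in> carrier (GL V)"
  shows "\<exists>!\<phi>. \<phi> \<in> extensional (carrier R) \<and> \<phi> \<in> ring_iso R R \<and>
     (\<forall>c. \<phi> (\<sigma> (free_const c)) = \<sigma> (free_const c)) \<and>
     (\<forall>v\<in>V. \<phi> (\<sigma> (free_var v)) = \<sigma> (free_var (g v)))" (is "\<exists>!\<phi>. ?P \<phi>")
    and "t \<in> carrier (Free V) \<Longrightarrow> gl_ext R \<sigma> V g (\<sigma> t) = \<sigma> (free_map g t)"
proof -
  define \<phi> where "\<phi> = (\<lambda>x\<in>carrier R. \<sigma> (free_map g (SOME t. t \<in> carrier (Free V) \<and> \<sigma> t = x)))"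
  obtain g' where g': "g' \<in> carrier (GL V)" "\<And>v. v \<in> V \<Longrightarrow> g (g' v) = v" "\<And>v. v \<in> V \<Longrightarrow> g' (g v) = v"
    using GL_inverse[OF subspace g] by blast
  have map: "free_map f t \<in> carrier (Free V)" if "f \<in> carrier (GL V)" "t \<in> carrier (Free V)" for f t
    using that GL_D(2)[of f V] by (intro free_map_in_Free) auto
  have \<phi>: "\<phi> (\<sigma> t) = \<sigma> (free_map g t)" if t: "t \<in> carrier (Free V)" for t
  proof -
    define s where "s = (SOME s. s \<in> carrier (Free V) \<and> \<sigma> s = \<sigma> t)"
    have s: "s \<in> carrier (Free V)" "\<sigma> s = \<sigma> t"
      using someI[of "\<lambda>s. s \<in> carrier (Free V) \<and> \<sigma> s = \<sigma> t" t] t by (auto simp: s_def)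
    have "\<sigma> (free_map g (s - t)) = \<zero>"
      using s t by (intro stable[OF g]) (auto simp: diff_in_Free eq_iff_diff)
    then have "\<sigma> (free_map g s) = \<sigma> (free_map g t)"
      using s t by (simp add: eq_iff_diff map g free_map_diff)
    then show ?thesis
      using t by (simp add: \<phi>_def s_def)
  qed
  have "\<phi> \<in> ring_hom R R"
  proof (rule ring_hom_memI)
    fix x y assume "x \<in> carrier R" "y \<in> carrier R"
    then obtain s t where st: "s \<in> carrier (Free V)" "x = \<sigma> s" "t \<in> carrier (Free V)" "y = \<sigma> t"
      by (metis lift)
    show "\<phi> x \<in> carrier R"
      using st by (simp add: \<phi> map g)
    show "\<phi> (x \<otimes> y) = \<phi> x \<otimes> \<phi> y"
      using st \<phi>[OF mult_in_Free[OF st(1,3)]] by (simp add: \<phi> map g free_map_mult sig_mult)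
    show "\<phi> (x \<oplus> y) = \<phi> x \<oplus> \<phi> y"
      using st \<phi>[OF add_in_Free[OF st(1,3)]] by (simp add: \<phi> map g free_map_add sig_add)
  qed (use \<phi>[OF one_in_Free] in \<open>simp add: sig_one\<close>)
  moreover have "bij_betw \<phi> (carrier R) (carrier R)"
  \<comment> \<open>The inverse is the same construction for the inverse \<open>g'\<close> of
    \<open>g\<close>.\<close>
  proof (rule bij_betw_byWitness[where f' = "\<lambda>x. \<sigma> (free_map g' (SOME t. t \<in> carrier (Free V) \<and> \<sigma> t = x))"])
    have *: "\<sigma> (free_map g' (SOME s. s \<in> carrier (Free V) \<and> \<sigma> s = \<sigma> t)) = \<sigma> (free_map g' t)"
      if t: "t \<in> carrier (Free V)" for t
    proof -
      define s where "s = (SOME s. s \<in> carrier (Free V) \<and> \<sigma> s = \<sigma> t)"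
      have s: "s \<in> carrier (Free V)" "\<sigma> s = \<sigma> t"
        using someI[of "\<lambda>s. s \<in> carrier (Free V) \<and> \<sigma> s = \<sigma> t" t] t by (auto simp: s_def)
      have "\<sigma> (free_map g' (s - t)) = \<zero>"
        using s t by (intro stable[OF g'(1)]) (auto simp: diff_in_Free eq_iff_diff)
      then show ?thesis
        using s t by (simp add: eq_iff_diff map g' free_map_diff s_def[symmetric])
    qed
    have id: "free_map g' (free_map g t) = t" "free_map g (free_map g' t) = t" if "t \<in> carrier (Free V)" for t
      using that g' by (simp_all add: free_map_comp[where f = id] free_map_id)
    let ?\<psi> = "\<lambda>x. \<sigma> (free_map g' (SOME t. t \<in> carrier (Free V) \<and> \<sigma> t = x))"
    show "\<forall>x\<in>carrier R. ?\<psi> (\<phi> x) = x" "\<phi> ` carrier R \<subseteq> carrier R"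
      "\<forall>x\<in>carrier R. \<phi> (?\<psi> x) = x" "?\<psi> ` carrier R \<subseteq> carrier R"
      using ge_0 by (auto simp: Free_ge_0 * \<phi> map g g'(1) id sig_closed simp flip: ge_0)
  qed
  moreover have "\<phi> \<in> extensional (carrier R)"
    by (simp add: \<phi>_def)
  ultimately have P\<phi>: "?P \<phi>"
    using \<phi>[OF free_const_in_Free] \<phi>[OF free_var_in_Free] by (simp add: ring_iso_def)
  have uniq: "\<psi> = \<phi>" if \<psi>: "?P \<psi>" for \<psi>
  proof (rule extensionalityI[where A = "carrier R"])
    fix x assume "x \<in> carrier R"
    then obtain t where t: "t \<in> carrier (Free V)" "x = \<sigma> t"
      by (metis lift)
    have \<psi>_hom: "\<psi> \<in> ring_hom R R"
      using \<psi> by (simp add: ring_iso_def)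
    have map_V: "set (map g w) \<subseteq> V" if "set w \<subseteq> V" for w
      using that GL_D(4)[OF g] by (induction w) auto
    have word: "\<psi> (\<sigma> (Poly_Mapping.single (Free_mon w) 1)) = \<sigma> (Poly_Mapping.single (Free_mon (map g w)) 1)"
      if "set w \<subseteq> V" for w
      using that
    proof (induction w)
      case Nil
      then show ?case
        using \<psi> by (simp add: free_const_def zero_Free_mon)
    next
      case (Cons v w)
      then have "Poly_Mapping.single (Free_mon w) 1 \<in> carrier (Free V)"
        "Poly_Mapping.single (Free_mon (map g w)) 1 \<in> carrier (Free V)" "v \<in> V"
        using map_V[of w] by (auto intro!: word_in_Free)
      then show ?case
        using Cons \<psi> GL_D(4)[OF g] \<psi>_hom
        by (simp add: word_Cons[where c = 1] sig_mult free_var_in_Free sig_closed ring_hom_mult del: mult_single)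
    qed
    have "\<psi> (\<sigma> t) = \<sigma> (free_map g t)"
      using t(1)
    proof (induction rule: Free_induct)
      case (mono w c)
      then have "Poly_Mapping.single (Free_mon w) 1 \<in> carrier (Free V)"
        "Poly_Mapping.single (Free_mon (map g w)) 1 \<in> carrier (Free V)"
        using map_V[of w] by (auto intro!: word_in_Free)
      with mono show ?case
        using \<psi> \<psi>_hom word[of w]
        by (simp add: word_coeff[of _ c] sig_mult free_const_in_Free sig_closed ring_hom_mult free_map_mult)
    next
      case (add s t)
      then show ?case
        using \<psi>_hom by (simp add: sig_add free_map_add map g ring_hom_add sig_closed)
    next
      case zero
      then show ?case
        using \<psi> \<phi>[of 0] ring_hom_zero[OF \<psi>_hom ring_axioms ring_axioms] by (simp add: sig_zero)
    qed
    then show "\<psi> x = \<phi> x"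
      using t by (simp add: \<phi>)
  qed (use \<psi> P\<phi> in auto)
  show ex1: "\<exists>!\<phi>. ?P \<phi>"
    using P\<phi> uniq by blast
  have "gl_ext R \<sigma> V g = \<phi>"
    unfolding gl_ext_def by (rule uniq[OF theI'[OF ex1]])
  then show "t \<in> carrier (Free V) \<Longrightarrow> gl_ext R \<sigma> V g (\<sigma> t) = \<sigma> (free_map g t)"
    by (simp add: \<phi>)
qed

end

lemma vectorspace_kspace:
  fixes M :: "(('e::ab_group_add, 'k::field) grp_alg, 'm) module"
  assumes "Module.module kE M"
  shows "vectorspace (ring_of_type_algebra :: 'k ring) (kspace M)"
proof -
  interpret Module.module kE M
    by fact
  have K: "carrier (ring_of_type_algebra :: 'k ring) = UNIV"
    "\<And>x y :: 'k. x \<oplus>\<^bsub>ring_of_type_algebra\<^esub> y = x + y" "\<And>x y :: 'k. x \<otimes>\<^bsub>ring_of_type_algebra\<^esub> y = x * y"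
    "\<one>\<^bsub>(ring_of_type_algebra :: 'k ring)\<^esub> = 1"
    by (simp_all add: ring_of_type_algebra_def)
  show ?thesis
  proof (rule vs_criteria)
    show "field (ring_of_type_algebra :: 'k ring)"
      by (rule field_from_type_algebra)
    show "\<forall>v\<in>carrier (kspace M). \<exists>neg_v\<in>carrier (kspace M). v \<oplus>\<^bsub>kspace M\<^esub> neg_v = \<zero>\<^bsub>kspace M\<^esub>"
      using M.r_neg M.a_inv_closed by (auto simp: kspace_def)
    show "\<forall>a b v. a \<in> carrier (ring_of_type_algebra :: 'k ring) \<and> b \<in> carrier (ring_of_type_algebra :: 'k ring) \<and>
        v \<in> carrier (kspace M) \<longrightarrow>
        (a \<otimes>\<^bsub>ring_of_type_algebra\<^esub> b) \<odot>\<^bsub>kspace M\<^esub> v = a \<odot>\<^bsub>kspace M\<^esub> (b \<odot>\<^bsub>kspace M\<^esub> v)"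
    proof -
      have "kscale (a * b) (1 :: ('e, 'k) grp_alg) = kscale a 1 * kscale b 1" for a b
        by (simp add: kscale_mult)
      then show ?thesis
        using smult_assoc1[of "kscale a 1" "kscale b 1" for a b] by (simp add: kspace_def K del: kscale.scale_scale)
    qed
    show "\<forall>a b v. a \<in> carrier (ring_of_type_algebra :: 'k ring) \<and> b \<in> carrier (ring_of_type_algebra :: 'k ring) \<and>
        v \<in> carrier (kspace M) \<longrightarrow>
        (a \<oplus>\<^bsub>ring_of_type_algebra\<^esub> b) \<odot>\<^bsub>kspace M\<^esub> v =
          (a \<odot>\<^bsub>kspace M\<^esub> v) \<oplus>\<^bsub>kspace M\<^esub> (b \<odot>\<^bsub>kspace M\<^esub> v)"
      using smult_l_distr[of "kscale a 1" "kscale b 1" for a b]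
      by (simp add: kspace_def K kscale.scale_left_distrib)
    show "\<forall>v\<in>carrier (kspace M). \<one>\<^bsub>(ring_of_type_algebra :: 'k ring)\<^esub> \<odot>\<^bsub>kspace M\<^esub> v = v"
      using smult_one by (simp add: kspace_def K)
    show "\<forall>v w. v \<in> carrier (kspace M) \<and> w \<in> carrier (kspace M) \<longrightarrow> v \<oplus>\<^bsub>kspace M\<^esub> w = w \<oplus>\<^bsub>kspace M\<^esub> v"
      using M.a_comm by (simp add: kspace_def)
    show "\<forall>v w x. v \<in> carrier (kspace M) \<and> w \<in> carrier (kspace M) \<and> x \<in> carrier (kspace M) \<longrightarrow>
        v \<oplus>\<^bsub>kspace M\<^esub> w \<oplus>\<^bsub>kspace M\<^esub> x = v \<oplus>\<^bsub>kspace M\<^esub> (w \<oplus>\<^bsub>kspace M\<^esub> x)"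
      using M.a_assoc by (simp add: kspace_def)
    show "\<forall>a v w. a \<in> carrier (ring_of_type_algebra :: 'k ring) \<and> v \<in> carrier (kspace M) \<and>
        w \<in> carrier (kspace M) \<longrightarrow> a \<odot>\<^bsub>kspace M\<^esub> (v \<oplus>\<^bsub>kspace M\<^esub> w) =
          (a \<odot>\<^bsub>kspace M\<^esub> v) \<oplus>\<^bsub>kspace M\<^esub> (a \<odot>\<^bsub>kspace M\<^esub> w)"
      using smult_r_distr by (simp add: kspace_def)
  qed (use M.a_closed smult_closed in \<open>simp_all add: kspace_def\<close>)
qed

section \<open>Equivariance of the graded subquotients\<close>

text \<open>The assumption \<open>kill\<close> says that relations of \<open>kE\<close> raise the
  degree by at least \<open>j - i\<close>, hence multiply degree \<open>>= i\<close> into degree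
  \<open>>= j\<close>. This is what the action on the subquotient requires.\<close>

locale free_subquotient = free_quotient R V \<sigma> + kE: free_quotient kE V kE_map
  for R (structure) and V :: "('e::ab_group_add, 'k::field) grp_alg set" and \<sigma> +
  fixes i j :: nat
    and M :: "(('e, 'k) grp_alg, 'a set) module"
  assumes ij: "i \<le> j"
    and linear: "linear_rels V \<subseteq> {t \<in> carrier (Free V). \<sigma> t = \<zero>}"
    and kill: "\<And>t. t \<in> carrier (Free V) \<Longrightarrow> kE_map t = 0 \<Longrightarrow> \<sigma> t \<in> ge (j - i)"
    and M_def: "M = subquotient R (lifts V \<sigma>) (ge i) (ge j)"
begin

text \<open>Names a coset by a representative in the free algebra, so that every operation of
  \<open>M\<close> becomes one on words.\<close>

definition mu :: "('e, 'k) free_alg \<Rightarrow> 'a set" where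
  "mu t = ge j +> \<sigma> t"

lemma mem_mu: "t \<in> carrier (Free V) \<Longrightarrow> x \<in> mu t \<longleftrightarrow> (\<exists>u\<in>Free_ge V j. x = \<sigma> (u + t))"
  by (auto simp: mu_def a_r_coset_def' sig_add[OF Free_ge_carrier])

lemma mu_eq_iff:
  assumes "s \<in> carrier (Free V)" "t \<in> carrier (Free V)"
  shows "mu s = mu t \<longleftrightarrow> \<sigma> (s - t) \<in> ge j"
  unfolding mu_def sig_diff[OF assms]
  by (rule quotient_eq_iff_same_a_r_cos[OF ideal_ge sig_closed sig_closed, symmetric]) fact+

lemma mu_add:
  assumes "s \<in> carrier (Free V)" "t \<in> carrier (Free V)"
  shows "mu s <+>\<^bsub>R\<^esub> mu t = mu (s + t)"
  unfolding mu_def sig_add[OF assms]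
  by (rule ideal.a_rcos_sum[OF ideal_ge sig_closed sig_closed]) fact+

lemma mu_0: "mu 0 = ge j"
proof -
  have "\<zero> \<in> ge j"
    by (rule additive_subgroup.zero_closed[OF ideal.axioms(1)[OF ideal_ge]])
  then show ?thesis
    unfolding mu_def sig_zero by (rule a_rcos_zero[OF ideal_ge])
qed

lemma mu_eq_0: "t \<in> Free_ge V j \<Longrightarrow> mu t = mu 0"
  by (subst mu_eq_iff) (auto simp: Free_ge_carrier zero_in_Free)

lemma M_carrier: "carrier M = mu ` Free_ge V i"
  by (simp add: M_def subquotient_def mu_def image_image)

lemma M_add: "A \<oplus>\<^bsub>M\<^esub> B = A <+>\<^bsub>R\<^esub> B"
  by (simp add: M_def subquotient_def)

lemma M_zero: "\<zero>\<^bsub>M\<^esub> = mu 0"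
  by (simp add: M_def subquotient_def mu_0)

text \<open>Two lifts of \<open>x\<close> differ by an element of the kernel of
  \<open>kE_map\<close>, which \<open>kill\<close> sends to degree \<open>>= j - i\<close>; two
  representatives of the coset differ in degree \<open>>= j\<close>. Either way the product changes
  only in degree \<open>>= j\<close>, so the union in \<open>subquotient\<close> is a single
  coset.\<close>

lemma M_smult:
  assumes y: "y \<in> carrier (Free V)" "kE_map y = x" and t: "t \<in> Free_ge V i"
  shows "x \<odot>\<^bsub>M\<^esub> mu t = mu (y * t)"
proof -
  have *: "ge j +> (z \<otimes> a) = mu (y * t)" if z: "z \<in> lifts V \<sigma> x" and a: "a \<in> mu t" for z a
  proof -
    obtain s where s: "s \<in> carrier (Free V)" "kE_map s = x" "z = \<sigma> s"
      using z by (auto simp: lifts_def)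
    obtain u where u: "u \<in> Free_ge V j" "a = \<sigma> (u + t)"
      using a t by (auto simp: mem_mu Free_ge_carrier)
    have "\<sigma> (s - y) \<in> ge (j - i)"
      using s y by (intro kill) (simp_all add: diff_in_Free kE_map_diff)
    then obtain r where r: "r \<in> Free_ge V (j - i)" "\<sigma> (s - y) = \<sigma> r"
      by auto
    have "r * t \<in> Free_ge V j"
      using mult_in_Free_ge[OF r(1) t] ij by simp
    have ut: "u + t \<in> carrier (Free V)"
      using u t by (simp add: add_in_Free Free_ge_carrier)
    note cl = Free_ge_carrier[OF u(1)] Free_ge_carrier[OF t] Free_ge_carrier[OF r(1)] s(1) y(1)
    have "\<sigma> (s * (u + t) - y * t) = \<sigma> (s * u + (s - y) * t)"
      by (simp add: algebra_simps)
    also have "\<dots> = \<sigma> (s * u + r * t)"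
      using r(2) cl by (simp add: sig_add sig_mult mult_in_Free diff_in_Free)
    also have "\<dots> \<in> ge j"
      using \<open>r * t \<in> Free_ge V j\<close> mult_in_Free_ge'(1)[OF u(1) s(1)] by (intro imageI add_in_Free_ge)
    finally have "mu (s * (u + t)) = mu (y * t)"
      using cl ut by (simp add: mu_eq_iff mult_in_Free)
    then show ?thesis
      using s u ut by (simp add: mu_def sig_mult)
  qed
  \<comment> \<open>Both index sets must be nonempty, since otherwise the union of equal cosets
    would be empty.\<close>
  have "\<exists>u\<in>Free_ge V j. \<sigma> t = \<sigma> (u + t)"
    by (rule bexI[of _ 0]) simp_all
  then have ne: "\<sigma> y \<in> lifts V \<sigma> x" "\<sigma> t \<in> mu t"
    unfolding lifts_def mem_mu[OF Free_ge_carrier[OF t]] using y by blast+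
  have "x \<odot>\<^bsub>M\<^esub> mu t = (\<Union>z\<in>lifts V \<sigma> x. \<Union>a\<in>mu t. ge j +> (z \<otimes> a))"
    by (simp add: M_def subquotient_def)
  also have "\<dots> = (\<Union>z\<in>lifts V \<sigma> x. \<Union>a\<in>mu t. mu (y * t))"
    using * by simp
  also have "\<dots> = mu (y * t)"
    using ne by blast
  finally show ?thesis .
qed

lemma kE_lift: obtains y where "y \<in> carrier (Free V)" "kE_map y = x"
proof -
  have "x \<in> kE_map ` carrier (Free V)"
    using kE.surj by (simp add: subset_iff)
  then show ?thesis
    using that by blast
qed

lemma abelian_group_M: "abelian_group M"
proof (rule abelian_groupI)
  note M = M_carrier M_add M_zero
  show "\<zero>\<^bsub>M\<^esub> \<in> carrier M"
    unfolding M by (rule imageI) simp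
  fix A assume A: "A \<in> carrier M"
  then obtain s where s: "s \<in> Free_ge V i" "A = mu s"
    unfolding M by blast
  show "\<zero>\<^bsub>M\<^esub> \<oplus>\<^bsub>M\<^esub> A = A"
    unfolding M s using s by (simp add: mu_add Free_ge_carrier zero_in_Free)
  show "\<exists>B\<in>carrier M. B \<oplus>\<^bsub>M\<^esub> A = \<zero>\<^bsub>M\<^esub>"
    unfolding M s using s
    by (intro bexI[of _ "mu (- s)"]) (simp_all add: mu_add Free_ge_carrier uminus_in_Free uminus_in_Free_ge)
  fix B assume "B \<in> carrier M"
  then obtain t where t: "t \<in> Free_ge V i" "B = mu t"
    unfolding M by blast
  show "A \<oplus>\<^bsub>M\<^esub> B \<in> carrier M"
    unfolding M s t using s t by (simp add: mu_add Free_ge_carrier add_in_Free_ge)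
  show "A \<oplus>\<^bsub>M\<^esub> B = B \<oplus>\<^bsub>M\<^esub> A"
    unfolding M s t using s t by (simp add: mu_add Free_ge_carrier add.commute)
  fix C assume "C \<in> carrier M"
  then obtain u where u: "u \<in> Free_ge V i" "C = mu u"
    unfolding M by blast
  show "A \<oplus>\<^bsub>M\<^esub> B \<oplus>\<^bsub>M\<^esub> C = A \<oplus>\<^bsub>M\<^esub> (B \<oplus>\<^bsub>M\<^esub> C)"
    unfolding M s t u using s t u by (simp add: mu_add Free_ge_carrier add_in_Free add.assoc)
qed

lemma module_M: "Module.module kE M"
proof (rule moduleI[OF cring_kE abelian_group_M])
  fix x A assume "A \<in> carrier M"
  then obtain t where t: "t \<in> Free_ge V i" "A = mu t"
    unfolding M_carrier by blast
  obtain y where y: "y \<in> carrier (Free V)" "kE_map y = x"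
    by (rule kE_lift)
  note tc = Free_ge_carrier[OF t(1)]
  show "x \<odot>\<^bsub>M\<^esub> A \<in> carrier M"
    unfolding t M_smult[OF y t(1)] M_carrier using mult_in_Free_ge'(1)[OF t(1) y(1)] by simp
  show "\<one>\<^bsub>kE\<^esub> \<odot>\<^bsub>M\<^esub> A = A"
    using M_smult[OF one_in_Free _ t(1), of 1] t by simp
  fix x' :: "('e, 'k) grp_alg"
  obtain y' where y': "y' \<in> carrier (Free V)" "kE_map y' = x'"
    by (rule kE_lift)
  have "kE_map (y + y') = x + x'" "kE_map (y * y') = x * x'"
    using y y' by (simp_all add: kE_map_add kE_map_mult)
  note yy = M_smult[OF add_in_Free[OF y(1) y'(1)] this(1) t(1)] M_smult[OF mult_in_Free[OF y(1) y'(1)] this(2) t(1)]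
  show "(x \<oplus>\<^bsub>kE\<^esub> x') \<odot>\<^bsub>M\<^esub> A = x \<odot>\<^bsub>M\<^esub> A \<oplus>\<^bsub>M\<^esub> x' \<odot>\<^bsub>M\<^esub> A"
    unfolding t kE_simps yy M_smult[OF y t(1)] M_smult[OF y' t(1)] M_add
    using y y' tc by (simp add: mu_add mult_in_Free distrib_right)
  show "(x \<otimes>\<^bsub>kE\<^esub> x') \<odot>\<^bsub>M\<^esub> A = x \<odot>\<^bsub>M\<^esub> (x' \<odot>\<^bsub>M\<^esub> A)"
    unfolding t kE_simps yy M_smult[OF y' t(1)] M_smult[OF y mult_in_Free_ge'(1)[OF t(1) y'(1)]]
    by (simp add: mult.assoc)
  fix B assume "B \<in> carrier M"
  then obtain s where s: "s \<in> Free_ge V i" "B = mu s"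
    unfolding M_carrier by blast
  show "x \<odot>\<^bsub>M\<^esub> (A \<oplus>\<^bsub>M\<^esub> B) = x \<odot>\<^bsub>M\<^esub> A \<oplus>\<^bsub>M\<^esub> x \<odot>\<^bsub>M\<^esub> B"
    unfolding t s M_add mu_add[OF tc Free_ge_carrier[OF s(1)]] M_smult[OF y t(1)] M_smult[OF y s(1)]
      M_smult[OF y add_in_Free_ge[OF t(1) s(1)]]
    using tc Free_ge_carrier[OF s(1)] y by (simp add: mu_add mult_in_Free distrib_left)
qed

text \<open>Equality rather than inclusion, by means of the inverse of \<open>g\<close>: the image
  of a coset of \<open>ge j\<close> has to be a full coset.\<close>

lemma GL_image_Free_ge:
  assumes g: "g \<in> carrier (GL V)"
  shows "free_map g ` Free_ge V l = Free_ge V l"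
proof -
  obtain h where h: "h \<in> carrier (GL V)" "\<And>v. v \<in> V \<Longrightarrow> g (h v) = v"
    using GL_inverse[OF subspace g] by blast
  have in_ge: "free_map f t \<in> Free_ge V l" if "f \<in> carrier (GL V)" "t \<in> Free_ge V l" for f t
    using that GL_D(2)[of f V] by (intro free_map_in_Free_ge) auto
  have "t \<in> free_map g ` Free_ge V l" if t: "t \<in> Free_ge V l" for t
  proof (rule image_eqI)
    have "free_map g (free_map h t) = free_map id t"
      using Free_ge_carrier[OF t] h(2) by (intro free_map_comp) auto
    then show "t = free_map g (free_map h t)"
      using Free_ge_carrier[OF t] by (simp add: free_map_id)
    show "free_map h t \<in> Free_ge V l"
      by (rule in_ge[OF h(1) t])
  qed
  then show ?thesis
    using in_ge[OF g] by blast
qed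

lemma action_mu:
  assumes g: "g \<in> carrier (GL V)" and t: "t \<in> Free_ge V i"
  shows "coset_action R \<sigma> V M g (mu t) = mu (free_map g t)"
proof -
  have gt: "free_map g t \<in> Free_ge V i"
    using GL_image_Free_ge[OF g] t by blast
  have "gl_ext R \<sigma> V g ` mu t = mu (free_map g t)"
  proof -
    have "mu t = (\<lambda>u. \<sigma> (u + t)) ` Free_ge V j"
      using mem_mu[OF Free_ge_carrier[OF t]] by blast
    then have "gl_ext R \<sigma> V g ` mu t = (\<lambda>u. gl_ext R \<sigma> V g (\<sigma> (u + t))) ` Free_ge V j"
      by (simp add: image_image)
    also have "\<dots> = (\<lambda>u. \<sigma> (free_map g u + free_map g t)) ` Free_ge V j"
      using gl_ext_unique(2)[OF g] Free_ge_carrier[OF t]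
      by (intro image_cong refl) (simp add: add_in_Free Free_ge_carrier free_map_add)
    also have "\<dots> = (\<lambda>u. \<sigma> (u + free_map g t)) ` (free_map g ` Free_ge V j)"
      by (simp add: image_image)
    also have "\<dots> = mu (free_map g t)"
      unfolding GL_image_Free_ge[OF g] using mem_mu[OF Free_ge_carrier[OF gt]] by blast
    finally show ?thesis .
  qed
  then show ?thesis
    using t by (simp add: coset_action_def M_carrier)
qed

lemma action_Bij:
  assumes g: "g \<in> carrier (GL V)"
  shows "coset_action R \<sigma> V M g \<in> Bij (carrier M)"
proof -
  let ?\<rho> = "coset_action R \<sigma> V M"
  obtain h where h: "h \<in> carrier (GL V)" "\<And>v. v \<in> V \<Longrightarrow> g (h v) = v" "\<And>v. v \<in> V \<Longrightarrow> h (g v) = v"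
    using GL_inverse[OF subspace g] by blast
  have in_ge: "free_map f t \<in> Free_ge V i" if "f \<in> carrier (GL V)" "t \<in> Free_ge V i" for f t
    using GL_image_Free_ge that by blast
  have id: "free_map g (free_map h t) = t" "free_map h (free_map g t) = t" if "t \<in> Free_ge V i" for t
    using Free_ge_carrier[OF that] h by (simp_all add: free_map_comp[where f = id] free_map_id)
  have "bij_betw (?\<rho> g) (carrier M) (carrier M)"
  proof (rule bij_betw_byWitness[where f' = "?\<rho> h"])
    show "\<forall>A\<in>carrier M. ?\<rho> h (?\<rho> g A) = A" "\<forall>A\<in>carrier M. ?\<rho> g (?\<rho> h A) = A"
      unfolding M_carrier by (simp_all add: action_mu g h(1) in_ge id)
    show "?\<rho> g ` carrier M \<subseteq> carrier M" "?\<rho> h ` carrier M \<subseteq> carrier M"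
      unfolding M_carrier image_image using in_ge g h(1) by (auto simp: action_mu)
  qed
  then show ?thesis
    by (simp add: Bij_def coset_action_def)
qed

theorem equivariant: "gl_equivariant V M (coset_action R \<sigma> V M)"
proof -
  let ?\<rho> = "coset_action R \<sigma> V M"
  have "group_action (GL V) (carrier M) ?\<rho>"
  proof (intro group_action.intro group_hom.intro group_hom_axioms.intro group_GL[OF subspace] group_BijGroup homI)
    fix g assume "g \<in> carrier (GL V)"
    then show "?\<rho> g \<in> carrier (BijGroup (carrier M))"
      by (simp add: BijGroup_def action_Bij)
  next
    fix g h assume gh: "g \<in> carrier (GL V)" "h \<in> carrier (GL V)"
    interpret GL: group "GL V"
      by (rule group_GL[OF subspace])
    have "?\<rho> (g \<otimes>\<^bsub>GL V\<^esub> h) = compose (carrier M) (?\<rho> g) (?\<rho> h)"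
    proof (rule extensionalityI[where A = "carrier M"])
      fix A assume A: "A \<in> carrier M"
      then obtain t where t: "t \<in> Free_ge V i" "A = mu t"
        unfolding M_carrier by blast
      have "free_map h t \<in> Free_ge V i"
        using GL_image_Free_ge[OF gh(2)] t by blast
      moreover have "free_map g (free_map h t) = free_map (g \<otimes>\<^bsub>GL V\<^esub> h) t"
        using Free_ge_carrier[OF t(1)] by (rule free_map_comp) (simp add: GL_mult[OF gh] compose_def)
      ultimately show "?\<rho> (g \<otimes>\<^bsub>GL V\<^esub> h) A = compose (carrier M) (?\<rho> g) (?\<rho> h) A"
        using A t gh by (simp add: compose_def action_mu)
    qed (simp_all add: coset_action_def)
    then show "?\<rho> (g \<otimes>\<^bsub>GL V\<^esub> h) = ?\<rho> g \<otimes>\<^bsub>BijGroup (carrier M)\<^esub> ?\<rho> h"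
      using action_Bij[OF gh(1)] action_Bij[OF gh(2)] by (simp add: BijGroup_def)
  qed
  moreover have "?\<rho> g (A \<oplus>\<^bsub>M\<^esub> B) = ?\<rho> g A \<oplus>\<^bsub>M\<^esub> ?\<rho> g B"
    if g: "g \<in> carrier (GL V)" and AB: "A \<in> carrier M" "B \<in> carrier M" for g A B
  proof -
    obtain s t where st: "s \<in> Free_ge V i" "A = mu s" "t \<in> Free_ge V i" "B = mu t"
      using AB unfolding M_carrier by blast
    have "free_map g s \<in> Free_ge V i" "free_map g t \<in> Free_ge V i"
      using GL_image_Free_ge[OF g] st by blast+
    then show ?thesis
      using st g by (simp add: M_add mu_add Free_ge_carrier action_mu add_in_Free_ge free_map_add)
  qed
  moreover have ext: "?\<rho> g (x \<odot>\<^bsub>M\<^esub> A) = gl_ext kE kE_map V g x \<odot>\<^bsub>M\<^esub> ?\<rho> g A"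
    if g: "g \<in> carrier (GL V)" and A: "A \<in> carrier M" for g x A
  proof -
    obtain t where t: "t \<in> Free_ge V i" "A = mu t"
      using A unfolding M_carrier by blast
    obtain y where y: "y \<in> carrier (Free V)" "kE_map y = x"
      by (rule kE_lift)
    have gy: "free_map g y \<in> carrier (Free V)" and gt: "free_map g t \<in> Free_ge V i"
      using GL_image_Free_ge[OF g, of 0] GL_image_Free_ge[OF g, of i] t y by (auto simp: Free_ge_0)
    have "gl_ext kE kE_map V g x = kE_map (free_map g y)"
      using kE.gl_ext_unique(2)[OF g y(1)] y(2) by simp
    then show ?thesis
      using t y M_smult[OF y t(1)] M_smult[OF gy _ gt] g
      by (simp add: action_mu mult_in_Free_ge' free_map_mult)
  qed
  \<comment> \<open>Linearity over the field is the case of a scalar \<open>x\<close> in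
    \<open>ext\<close>, since \<open>gl_ext\<close> fixes scalars.\<close>
  moreover have "?\<rho> g (kscale c 1 \<odot>\<^bsub>M\<^esub> A) = kscale c 1 \<odot>\<^bsub>M\<^esub> ?\<rho> g A"
    if "g \<in> carrier (GL V)" "A \<in> carrier M" for g c A
    using ext[OF that, of "kscale c 1"] kE.gl_ext_unique(2)[OF that(1) free_const_in_Free, of c] by simp
  ultimately show ?thesis
    using module_M by (simp add: gl_equivariant_def)
qed

theorem fin_dim:
  assumes B: "finite B" "B \<subseteq> V" "V \<subseteq> kscale.span B"
  shows "k_fin_dim M"
proof -
  interpret K: vectorspace "ring_of_type_algebra :: 'k ring" "kspace M"
    by (rule vectorspace_kspace[OF module_M])
  have K: "carrier (kspace M) = mu ` Free_ge V i" "\<zero>\<^bsub>kspace M\<^esub> = mu 0"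
    "\<And>A C. A \<oplus>\<^bsub>kspace M\<^esub> C = A <+>\<^bsub>R\<^esub> C" "\<And>c A. c \<odot>\<^bsub>kspace M\<^esub> A = kscale c 1 \<odot>\<^bsub>M\<^esub> A"
    by (simp_all add: kspace_def M_carrier M_zero M_add)
  \<comment> \<open>Words of length at least \<open>j\<close> vanish in \<open>M\<close>, and only
    finitely many shorter words have letters in the finite set \<open>B\<close>.\<close>
  define gens where "gens = (\<lambda>w. mu (Poly_Mapping.single (Free_mon w) 1)) ` {w. set w \<subseteq> B \<and> i \<le> length w \<and> length w < j}"
  have "finite {w. set w \<subseteq> B \<and> i \<le> length w \<and> length w < j}"
    by (rule finite_subset[OF _ finite_lists_length_le[OF B(1), of j]]) auto
  then have "finite gens"
    by (simp add: gens_def)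
  have gens: "gens \<subseteq> carrier (kspace M)"
    unfolding gens_def K using B(2) by (auto intro!: imageI word_in_Free_ge)
  have sub: "submodule (ring_of_type_algebra :: 'k ring) (K.span gens) (kspace M)"
    by (rule K.span_is_submodule[OF gens])
  have "mu t \<in> K.span gens" if "t \<in> Free_ge V i" for t
    using that ideal_kernel linear
  proof (induction rule: Free_ge_induct_spanning[where B = B])
    case (mono w c)
    then have w: "set w \<subseteq> V"
      using B(2) by auto
    show ?case
    proof (cases "length w < j")
      case True
      then have "mu (Poly_Mapping.single (Free_mon w) 1) \<in> K.span gens"
        using mono K.in_own_span[OF gens] by (auto simp: gens_def)
      then have "c \<odot>\<^bsub>kspace M\<^esub> mu (Poly_Mapping.single (Free_mon w) 1) \<in> K.span gens"
        by (rule submodule.smult_closed[OF sub, rotated]) (simp add: ring_of_type_algebra_def)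
      moreover have "c \<odot>\<^bsub>kspace M\<^esub> mu (Poly_Mapping.single (Free_mon w) 1) = mu (Poly_Mapping.single (Free_mon w) c)"
        unfolding K using w mono
        by (subst M_smult[of "free_const c"]) (simp_all add: free_const_in_Free word_in_Free_ge word_coeff[of w c])
      ultimately show ?thesis
        by simp
    next
      case False
      then have "mu (Poly_Mapping.single (Free_mon w) c) = mu 0"
        using w by (intro mu_eq_0 word_in_Free_ge) auto
      then show ?thesis
        using submodule.zero_closed[OF sub] by (simp add: K)
    qed
  next
    case (add s t)
    then show ?case
      using submodule.m_closed[OF sub, of "mu s" "mu t"] by (simp add: K mu_add Free_ge_carrier)
  next
    case (cong s t)
    have "\<sigma> (s - t) \<in> ge j"
      using cong ideal.axioms(1)[OF ideal_ge, THEN additive_subgroup.zero_closed] by auto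
    then have "mu s = mu t"
      using cong by (subst mu_eq_iff) (auto simp: Free_ge_carrier)
    with cong show ?case
      by simp
  next
    case zero
    show ?case
      using submodule.zero_closed[OF sub] by (simp add: K)
  qed (use B subspace in auto)
  then have "carrier (kspace M) \<subseteq> K.span gens"
    unfolding K by blast
  moreover have "K.span gens \<subseteq> carrier (kspace M)"
    by (rule K.span_is_subset2[OF gens])
  ultimately have "K.fin_dim"
    unfolding K.fin_dim_def using \<open>finite gens\<close> gens by (intro exI[of _ gens]) auto
  then show ?thesis
    by (simp add: k_fin_dim_def)
qed

end

section \<open>Equivariant modules have constant radical and socle types\<close>

interpretation kscale_pair: vector_space_pair
  "kscale :: 'k \<Rightarrow> ('e::ab_group_add, 'k::field) grp_alg \<Rightarrow> _"
  "kscale :: 'k \<Rightarrow> ('e, 'k) grp_alg \<Rightarrow> _"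
  by unfold_locales

text \<open>Bases of \<open>U\<close> and \<open>U'\<close> extend to bases \<open>C\<close> and
  \<open>C'\<close> of \<open>V\<close>. The complements \<open>C - B\<close> and
  \<open>C' - B'\<close> have equally many elements, so two separate bijections glue to one from
  \<open>C\<close> to \<open>C'\<close> that takes \<open>B\<close> to \<open>B'\<close>.\<close>

lemma GL_transitive:
  fixes V :: "('e::ab_group_add, 'k::field) grp_alg set"
  assumes V: "kscale.subspace V" and T: "finite T" "V \<subseteq> kscale.span T"
    and U: "r_plane V r U" and U': "r_plane V r U'"
  obtains g where "g \<in> carrier (GL V)" "g ` U = U'"
proof -
  have fin: "finite S" if "S \<subseteq> V" "kscale.independent S" for S
    using kscale.independent_span_bound[OF T(1) that(2)] that(1) T(2) by auto
  have bases: "\<exists>B C. B \<subseteq> C \<and> C \<subseteq> V \<and> kscale.independent C \<and> kscale.span C = V \<and> kscale.span B = Y \<and> card B = r"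
    if Y: "r_plane V r Y" for Y
  proof -
    have Y': "kscale.subspace Y" "Y \<subseteq> V" "kscale.dim Y = r"
      using Y by (auto simp: r_plane_def)
    obtain B where B: "B \<subseteq> Y" "kscale.independent B" "Y \<subseteq> kscale.span B" "card B = r"
      using kscale.basis_exists[of Y] Y' by metis
    obtain C where C: "B \<subseteq> C" "C \<subseteq> V" "kscale.independent C" "V \<subseteq> kscale.span C"
      using kscale.maximal_independent_subset_extend[of B V] B Y' by blast
    show ?thesis
      using B C Y' kscale.span_minimal[OF B(1) Y'(1)] kscale.span_minimal[OF C(2) V] by blast
  qed
  obtain B C where B: "B \<subseteq> C" "C \<subseteq> V" "kscale.independent C" "kscale.span C = V" "kscale.span B = U" "card B = r"
    using bases[OF U] by blast
  obtain B' C' where B': "B' \<subseteq> C'" "C' \<subseteq> V" "kscale.independent C'" "kscale.span C' = V" "kscale.span B' = U'" "card B' = r"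
    using bases[OF U'] by blast
  have finC: "finite C" "finite C'"
    using fin B B' by auto
  then have finB: "finite B" "finite B'"
    using B(1) B'(1) finite_subset by auto
  have "card C = kscale.dim V" "card C' = kscale.dim V"
    using kscale.basis_card_eq_dim[OF B(2) _ B(3)] kscale.basis_card_eq_dim[OF B'(2) _ B'(3)] B(4) B'(4)
    by simp_all
  then have "card (C - B) = card (C' - B')"
    using B B' finB by (simp add: card_Diff_subset)
  then obtain f2 where f2: "bij_betw f2 (C - B) (C' - B')"
    using finC by (metis finite_Diff finite_same_card_bij)
  obtain f1 where f1: "bij_betw f1 B B'"
    using finB B(6) B'(6) by (metis finite_same_card_bij)
  define f where "f b = (if b \<in> B then f1 b else f2 b)" for b
  have fB: "f ` B = B'"
    using f1 by (auto simp: f_def bij_betw_def)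
  have "bij_betw f B B'"
    using f1 by (rule iffD1[OF bij_betw_cong, rotated]) (simp add: f_def)
  moreover have "bij_betw f (C - B) (C' - B')"
    using f2 by (rule iffD1[OF bij_betw_cong, rotated]) (simp add: f_def)
  ultimately have "bij_betw f (B \<union> (C - B)) (B' \<union> (C' - B'))"
    by (rule bij_betw_combine) auto
  then have f: "bij_betw f C C'"
    using B(1) B'(1) by (simp add: Un_absorb1)
  define G where "G = kscale_pair.construct C f"
  have lin: "Vector_Spaces.linear kscale kscale G"
    unfolding G_def by (rule kscale_pair.linear_construct[OF B(3)])
  have Gf: "G b = f b" if "b \<in> C" for b
    unfolding G_def by (rule kscale_pair.construct_basis[OF B(3) that])
  have GC: "G ` C = C'" "G ` B = B'"
    using Gf f fB B(1) by (auto simp: bij_betw_def image_iff subset_iff)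
  have inj: "inj_on G C"
    using f Gf by (metis bij_betw_def inj_on_cong)
  have "inj_on G (kscale.span C)"
    by (rule kscale_pair.linear_inj_on_span_independent_image[OF lin _ inj]) (simp add: GC B')
  then have inj: "inj_on G V"
    by (simp add: B)
  have img: "G ` V = V" "G ` U = U'"
    using kscale_pair.linear_span_image[OF lin, of C] kscale_pair.linear_span_image[OF lin, of B]
    by (simp_all add: GC B B')
  have UV: "U \<subseteq> V"
    using U by (simp add: r_plane_def)
  \<comment> \<open>Elements of \<open>Bij V\<close> are extensional, hence the restriction of the
    globally defined linear map.\<close>
  have "restrict G V \<in> Bij V"
    using inj img by (simp add: Bij_def bij_betw_def)
  then have "restrict G V \<in> carrier (GL V)"
    using kscale_pair.linear_add[OF lin] kscale_pair.linear_scale[OF lin]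
      kscale.subspace_add[OF V] kscale.subspace_scale[OF V]
    by (simp add: GL_def)
  moreover have "restrict G V ` U = U'"
    using UV img by force
  ultimately show ?thesis
    by (rule that)
qed

locale equivariant_module = kE: free_quotient kE V kE_map
  for V :: "('e::ab_group_add, 'k::field) grp_alg set" +
  fixes M :: "(('e, 'k) grp_alg, 'm) module" and \<rho>
  assumes equivariant: "gl_equivariant V M \<rho>"
begin

abbreviation K :: "'k ring" where "K \<equiv> ring_of_type_algebra"

sublocale Mod: Module.module kE M
  using equivariant by (simp add: gl_equivariant_def)

sublocale act: group_action "GL V" "carrier M" \<rho>
  using equivariant by (simp add: gl_equivariant_def)

sublocale vs: vectorspace K "kspace M"
  by (rule vectorspace_kspace) (rule Mod.module_axioms)

lemma kspace_simps [simp]: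
  "carrier (kspace M) = carrier M" "\<zero>\<^bsub>kspace M\<^esub> = \<zero>\<^bsub>M\<^esub>" "m \<oplus>\<^bsub>kspace M\<^esub> m' = m \<oplus>\<^bsub>M\<^esub> m'"
  "c \<odot>\<^bsub>kspace M\<^esub> m = kscale c 1 \<odot>\<^bsub>M\<^esub> m"
  by (simp_all add: kspace_def)

lemma act_closed: "g \<in> carrier (GL V) \<Longrightarrow> m \<in> carrier M \<Longrightarrow> \<rho> g m \<in> carrier M"
  using act.element_image by blast

lemma act_add: "g \<in> carrier (GL V) \<Longrightarrow> m \<in> carrier M \<Longrightarrow> m' \<in> carrier M \<Longrightarrow> \<rho> g (m \<oplus>\<^bsub>M\<^esub> m') = \<rho> g m \<oplus>\<^bsub>M\<^esub> \<rho> g m'"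
  using equivariant by (simp add: gl_equivariant_def)

lemma act_scale: "g \<in> carrier (GL V) \<Longrightarrow> m \<in> carrier M \<Longrightarrow> \<rho> g (kscale c 1 \<odot>\<^bsub>M\<^esub> m) = kscale c 1 \<odot>\<^bsub>M\<^esub> \<rho> g m"
  using equivariant unfolding gl_equivariant_def by blast

text \<open>The algebra automorphism induced by \<open>g\<close> acts on a product of vectors of
  \<open>V\<close> factor by factor; this is how equivariance sees the radicals and socles for
  \<open>U\<close>.\<close>

lemma act_prod:
  assumes g: "g \<in> carrier (GL V)" and m: "m \<in> carrier M" and us: "set us \<subseteq> V"
  shows "\<rho> g (prod_list us \<odot>\<^bsub>M\<^esub> m) = prod_list (map g us) \<odot>\<^bsub>M\<^esub> \<rho> g m"
proof -
  have "gl_ext kE kE_map V g (prod_list us) = prod_list (map g us)"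
    using kE.gl_ext_unique(2)[OF g word_in_Free[OF us], of 1] by simp
  then show ?thesis
    using equivariant g m by (simp add: gl_equivariant_def)
qed

lemma act_zero: "g \<in> carrier (GL V) \<Longrightarrow> \<rho> g \<zero>\<^bsub>M\<^esub> = \<zero>\<^bsub>M\<^esub>"
  using act_scale[of g "\<zero>\<^bsub>M\<^esub>" 0] Mod.smult_l_null[of "\<rho> g \<zero>\<^bsub>M\<^esub>"] Mod.smult_l_null[of "\<zero>\<^bsub>M\<^esub>"]
  by (simp add: act_closed)

lemma act_inverse:
  assumes "g \<in> carrier (GL V)" "m \<in> carrier M"
  shows "\<rho> (inv\<^bsub>GL V\<^esub> g) (\<rho> g m) = m" "\<rho> g (\<rho> (inv\<^bsub>GL V\<^esub> g) m) = m"
proof -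
  interpret GL: group "GL V"
    by (rule group_GL[OF kE.subspace])
  show "\<rho> (inv\<^bsub>GL V\<^esub> g) (\<rho> g m) = m"
    using act.orbit_sym_aux[OF assms refl] .
  show "\<rho> g (\<rho> (inv\<^bsub>GL V\<^esub> g) m) = m"
    using act.orbit_sym_aux[OF GL.inv_closed[OF assms(1)] assms(2) refl] assms(1) by simp
qed

lemma GL_inv_image:
  assumes g: "g \<in> carrier (GL V)" and U: "U \<subseteq> V"
  shows "(inv\<^bsub>GL V\<^esub> g) ` (g ` U) = U"
proof -
  interpret GL: group "GL V"
    by (rule group_GL[OF kE.subspace])
  have "(inv\<^bsub>GL V\<^esub> g \<otimes>\<^bsub>GL V\<^esub> g) v = v" if "v \<in> V" for v
    using GL.l_inv[OF g] that by (simp add: GL_def BijGroup_def)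
  then have "(inv\<^bsub>GL V\<^esub> g) (g v) = v" if "v \<in> V" for v
    using that by (simp add: GL_mult[OF GL.inv_closed[OF g] g] compose_def)
  then show ?thesis
    using U by (force simp: image_image)
qed

text \<open>The elements that \<open>\<rho> g\<close> sends into the right-hand span form a
  submodule containing \<open>A\<close>.\<close>

lemma act_span:
  assumes g: "g \<in> carrier (GL V)" and A: "A \<subseteq> carrier M"
  shows "\<rho> g ` vs.span A \<subseteq> vs.span (\<rho> g ` A)"
proof -
  have gA: "\<rho> g ` A \<subseteq> carrier M"
    using A act_closed[OF g] by blast
  then have sub: "submodule K (vs.span (\<rho> g ` A)) (kspace M)"
    by (intro vs.span_is_submodule) simp
  have "submodule K {m \<in> carrier M. \<rho> g m \<in> vs.span (\<rho> g ` A)} (kspace M)"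
  proof (rule submodule.intro)
    show "Module.module K (kspace M)"
      by (rule vs.module_axioms)
  qed (use submodule.m_closed[OF sub] submodule.zero_closed[OF sub] submodule.smult_closed[OF sub] in
      \<open>auto simp: g act_add act_scale act_zero\<close>)
  moreover have "A \<subseteq> {m \<in> carrier M. \<rho> g m \<in> vs.span (\<rho> g ` A)}"
    using A vs.in_own_span[of "\<rho> g ` A"] gA by auto
  ultimately have "vs.span A \<subseteq> {m \<in> carrier M. \<rho> g m \<in> vs.span (\<rho> g ` A)}"
    by (intro vs.span_is_subset)
  then show ?thesis
    by blast
qed

text \<open>Spans inside the subspace \<open>W\<close> agree with spans in \<open>M\<close>. This
  removes the carrier \<open>W\<close> from the notion of dimension, so that different subspaces can
  be compared through their spanning sets.\<close>

lemma k_dim_eq: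
  assumes sub: "submodule K W (kspace M)"
  shows "k_dim M W = (LEAST n. \<exists>A. finite A \<and> card A = n \<and> A \<subseteq> W \<and> vs.span A = W)"
proof -
  have "subspace K W (kspace M)"
    using sub vs.vectorspace_axioms by (simp add: subspace_def)
  then interpret W: vectorspace K "kspace M\<lparr>carrier := W\<rparr>"
    by (rule vs.subspace_is_vs)
  have "(finite A \<and> card A = n \<and> A \<subseteq> W \<and> W.span A = W) \<longleftrightarrow>
      (finite A \<and> card A = n \<and> A \<subseteq> W \<and> vs.span A = W)" for A n
    using vs.span_li_not_depend(1)[OF _ sub] by auto
  then show ?thesis
    by (simp add: k_dim_def W.dim_def)
qed

text \<open>The injective map \<open>\<rho> g\<close> takes finite spanning sets to spanning sets of
  the same size, and the inverse of \<open>g\<close> takes them back. An inclusion in the second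
  assumption suffices because it is also applied to the inverse.\<close>

lemma k_dim_transport:
  assumes sub: "\<And>U. U \<subseteq> V \<Longrightarrow> submodule K (W U) (kspace M)"
    and W: "\<And>g U. g \<in> carrier (GL V) \<Longrightarrow> U \<subseteq> V \<Longrightarrow> \<rho> g ` W U \<subseteq> W (g ` U)"
    and g: "g \<in> carrier (GL V)" and U: "U \<subseteq> V"
  shows "k_dim M (W (g ` U)) = k_dim M (W U)"
proof -
  interpret GL: group "GL V"
    by (rule group_GL[OF kE.subspace])
  let ?P = "\<lambda>U n. \<exists>A. finite A \<and> card A = n \<and> A \<subseteq> W U \<and> vs.span A = W U"
  have P: "?P (g ` U) n" if g: "g \<in> carrier (GL V)" and U: "U \<subseteq> V" and P: "?P U n" for g U n
  proof -
    obtain A where A: "finite A" "card A = n" "A \<subseteq> W U" "vs.span A = W U"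
      using P by blast
    have gU: "g ` U \<subseteq> V"
      using U GL_D(4)[OF g] by blast
    have WM: "W U \<subseteq> carrier M" "W (g ` U) \<subseteq> carrier M"
      using submodule.subset[OF sub[OF U]] submodule.subset[OF sub[OF gU]] by simp_all
    have AM: "A \<subseteq> carrier M"
      using A WM by blast
    have gA: "\<rho> g ` A \<subseteq> W (g ` U)"
      using W[OF g U] A by blast
    have "card (\<rho> g ` A) = n"
      using card_image[OF inj_on_subset[OF act.inj_prop[OF g] AM]] A by simp
    moreover have "vs.span (\<rho> g ` A) \<subseteq> W (g ` U)"
      by (rule vs.span_is_subset[OF gA sub[OF gU]])
    moreover have "W (g ` U) \<subseteq> vs.span (\<rho> g ` A)"
    proof
      fix m assume m: "m \<in> W (g ` U)"
      let ?h = "inv\<^bsub>GL V\<^esub> g"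
      have "\<rho> ?h m \<in> W U"
        using W[of ?h, OF GL.inv_closed[OF g] gU] m GL_inv_image[OF g U] by auto
      then have "\<rho> g (\<rho> ?h m) \<in> vs.span (\<rho> g ` A)"
        using act_span[OF g AM] A by blast
      then show "m \<in> vs.span (\<rho> g ` A)"
        using act_inverse(2)[OF g] m WM by auto
    qed
    ultimately show ?thesis
      using A(1) gA by blast
  qed
  have gU: "g ` U \<subseteq> V"
    using U GL_D(4)[OF g] by blast
  have "?P (g ` U) n \<longleftrightarrow> ?P U n" for n
    using P[OF g U, of n] P[OF GL.inv_closed[OF g] gU, of n] unfolding GL_inv_image[OF g U] by blast
  then show ?thesis
    unfolding k_dim_eq[OF sub[OF U]] k_dim_eq[OF sub[OF gU]] by simp
qed

lemma Rad_pow_submodule: "submodule K (Rad_pow M U l) (kspace M)"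
  unfolding Rad_pow_def by (rule vs.span_is_submodule) auto

lemma Soc_pow_submodule: "submodule K (Soc_pow M U l) (kspace M)"
proof (rule submodule.intro)
  show "Module.module K (kspace M)"
    by (rule vs.module_axioms)
  have "x \<odot>\<^bsub>M\<^esub> (kscale c 1 \<odot>\<^bsub>M\<^esub> m) = kscale c 1 \<odot>\<^bsub>M\<^esub> (x \<odot>\<^bsub>M\<^esub> m)" if "m \<in> carrier M" for x c m
    using Mod.smult_assoc1[of x "kscale c 1" m] Mod.smult_assoc1[of "kscale c 1" x m] that
    by (simp add: mult.commute)
  then show "c \<odot>\<^bsub>kspace M\<^esub> m \<in> Soc_pow M U l" if "c \<in> carrier K" "m \<in> Soc_pow M U l"
    for c :: 'k and m
    using that(2) by (auto simp: Soc_pow_def Mod.smult_r_null)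
qed (auto simp: Soc_pow_def Mod.smult_r_distr Mod.smult_r_null)

lemma act_Rad_pow:
  assumes g: "g \<in> carrier (GL V)" and U: "U \<subseteq> V"
  shows "\<rho> g ` Rad_pow M U l \<subseteq> Rad_pow M (g ` U) l"
proof -
  let ?S = "\<lambda>U. {prod_list us \<odot>\<^bsub>M\<^esub> m | us m. length us = l \<and> set us \<subseteq> U \<and> m \<in> carrier M}"
  have "\<rho> g ` ?S U \<subseteq> ?S (g ` U)"
  proof
    fix m' assume "m' \<in> \<rho> g ` ?S U"
    then obtain us m where *: "length us = l" "set us \<subseteq> U" "m \<in> carrier M" "m' = \<rho> g (prod_list us \<odot>\<^bsub>M\<^esub> m)"
      by blast
    then have "m' = prod_list (map g us) \<odot>\<^bsub>M\<^esub> \<rho> g m"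
      using U act_prod[OF g, of m us] by simp
    moreover have "set (map g us) \<subseteq> g ` U" "length (map g us) = l"
      using * by auto
    ultimately show "m' \<in> ?S (g ` U)"
      using act_closed[OF g] * by blast
  qed
  then have "vs.span (\<rho> g ` ?S U) \<subseteq> vs.span (?S (g ` U))"
    by (rule vs.span_is_monotone)
  moreover have "\<rho> g ` vs.span (?S U) \<subseteq> vs.span (\<rho> g ` ?S U)"
    by (rule act_span[OF g]) auto
  ultimately show ?thesis
    unfolding Rad_pow_def by blast
qed

lemma act_Soc_pow:
  assumes g: "g \<in> carrier (GL V)" and U: "U \<subseteq> V"
  shows "\<rho> g ` Soc_pow M U l \<subseteq> Soc_pow M (g ` U) l"
proof
  fix m' assume "m' \<in> \<rho> g ` Soc_pow M U l"
  then obtain m where m: "m \<in> Soc_pow M U l" "m' = \<rho> g m"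
    by blast
  have mM: "m \<in> carrier M"
    using m by (simp add: Soc_pow_def)
  have "prod_list us' \<odot>\<^bsub>M\<^esub> m' = \<zero>\<^bsub>M\<^esub>" if us': "length us' = l" "set us' \<subseteq> g ` U" for us'
  proof -
    have "us' \<in> map g ` lists U"
      using us'(2) unfolding lists_image[symmetric] by (auto simp: lists_eq_set)
    then obtain us where us: "set us \<subseteq> U" "us' = map g us"
      by (auto simp: lists_eq_set)
    then have "prod_list us \<odot>\<^bsub>M\<^esub> m = \<zero>\<^bsub>M\<^esub>"
      using m us' by (simp add: Soc_pow_def)
    then show ?thesis
      using act_prod[OF g mM, of us] us U m act_zero[OF g] by auto
  qed
  then show "m' \<in> Soc_pow M (g ` U) l"
    using m mM act_closed[OF g] by (simp add: Soc_pow_def)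
qed

theorem constant_types:
  assumes fd: "k_fin_dim M" and T: "finite T" "V \<subseteq> kscale.span T"
  shows "constant_radical_type p V r M \<and> constant_socle_type p V r M"
proof -
  have const: "\<exists>d. \<forall>U. r_plane V r U \<longrightarrow> k_dim M (W U) = d"
    if W: "\<And>U. U \<subseteq> V \<Longrightarrow> submodule K (W U) (kspace M)"
      "\<And>g U. g \<in> carrier (GL V) \<Longrightarrow> U \<subseteq> V \<Longrightarrow> \<rho> g ` W U \<subseteq> W (g ` U)" for W
  proof -
    have "k_dim M (W U) = k_dim M (W U')" if U: "r_plane V r U" "r_plane V r U'" for U U'
    proof -
      obtain g where "g \<in> carrier (GL V)" "g ` U = U'"
        using GL_transitive[OF kE.subspace T U] by blast
      then show ?thesis
        using k_dim_transport[OF W, of g U] U by (simp add: r_plane_def)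
    qed
    then show ?thesis
      by metis
  qed
  have "\<exists>d. \<forall>U. r_plane V r U \<longrightarrow> k_dim M (Rad_pow M U l) = d"
    "\<exists>d. \<forall>U. r_plane V r U \<longrightarrow> k_dim M (Soc_pow M U l) = d" for l
    by (rule const, rule Rad_pow_submodule, erule (1) act_Rad_pow,
        rule const, rule Soc_pow_submodule, erule (1) act_Soc_pow)
  then show ?thesis
    unfolding constant_radical_type_def constant_socle_type_def using fd by blast
qed

end

section \<open>The Jacobson radical of a local ring with nil augmentation ideal\<close>

lemma (in primeideal) nat_pow_memD:
  assumes "x \<in> carrier R" "x [^] (n::nat) \<in> I"
  shows "x \<in> I"
  using assms(2)
proof (induction n)
  case 0
  then show ?case
    using one_imp_carrier I_notcarr by simp
next
  case (Suc n)
  then show ?case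
    using I_prime[of "x [^] n" x] assms(1) by auto
qed

text \<open>By \<open>unit\<close>, elements outside \<open>A\<close> are invertible modulo
  \<open>A\<close>, so \<open>A\<close> is maximal; by \<open>prime\<close>, it lies in every
  maximal ideal. Hence \<open>A\<close> is the intersection of all of them.\<close>

lemma (in cring) Rad_eqI:
  assumes A: "ideal A R" and one: "\<one> \<notin> A"
    and unit: "\<And>x. x \<in> carrier R \<Longrightarrow> x \<notin> A \<Longrightarrow> \<exists>y\<in>carrier R. \<exists>a\<in>A. y \<otimes> x \<oplus> a = \<one>"
    and prime: "\<And>I. primeideal I R \<Longrightarrow> A \<subseteq> I"
  shows "Rad R = A"
proof
  have "maximalideal A R"
  proof (rule maximalidealI[OF A])
    show "carrier R \<noteq> A"
      using one by auto
    fix J assume J: "ideal J R" "A \<subseteq> J" "J \<subseteq> carrier R"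
    show "J = A \<or> J = carrier R"
    proof (cases "J \<subseteq> A")
      case False
      then obtain x where x: "x \<in> J" "x \<in> carrier R" "x \<notin> A"
        using J by blast
      then obtain y a where y: "y \<in> carrier R" "a \<in> A" "y \<otimes> x \<oplus> a = \<one>"
        using unit by blast
      then have "y \<otimes> x \<oplus> a \<in> J"
        using ideal.I_l_closed[OF J(1) x(1) y(1)] J(2)
        by (intro additive_subgroup.a_closed[OF ideal.axioms(1)[OF J(1)]]) auto
      then show ?thesis
        using ideal.one_imp_carrier[OF J(1)] y by simp
    qed (use J in auto)
  qed
  then show "Rad R \<subseteq> A"
    by (auto simp: Rad_def)
  show "A \<subseteq> Rad R"
    using prime maximalideal_prime by (auto simp: Rad_def)
qed


section \<open>The group algebra of an elementary abelian group\<close>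

lemma CHAR_grp_alg [simp]: "CHAR(('e::ab_group_add, 'k::field) grp_alg) = CHAR('k)"
proof (rule CHAR_eqI)
  have *: "(of_nat n :: ('e, 'k) grp_alg) = Poly_Mapping.single 0 (of_nat n)" for n
    by simp
  show "of_nat CHAR('k) = (0 :: ('e, 'k) grp_alg)"
    unfolding * by simp
  show "CHAR('k) dvd n" if "of_nat n = (0 :: ('e, 'k) grp_alg)" for n
    using that unfolding * of_nat_eq_0_iff_char_dvd[symmetric] by (metis lookup_single_eq lookup_zero)
qed

lemma kE_nat_pow: "x [^]\<^bsub>kE\<^esub> (n::nat) = x ^ n"
  by (induction n) (simp_all add: mult.commute)

lemma kE_minus: "x \<ominus>\<^bsub>kE\<^esub> y = x - y"
proof -
  interpret cring "kE :: ('a, 'b) grp_alg ring"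
    by (rule cring_kE)
  have "\<ominus>\<^bsub>kE\<^esub> y = - y"
    by (rule minus_equality) simp_all
  then show ?thesis
    by (simp add: a_minus_def)
qed

section \<open>Generators of a finite p-torsion group\<close>

definition nsmul :: "nat \<Rightarrow> 'e::comm_monoid_add \<Rightarrow> 'e" where
  "nsmul m x = (\<Sum>i<m. x)"

lemma nsmul_simps [simp]: "nsmul 0 x = 0" "nsmul (Suc m) x = x + nsmul m x"
  by (simp_all add: nsmul_def add.commute)

lemma nsmul_add: "nsmul (m + m') x = nsmul m x + nsmul m' x"
  by (induction m) (simp_all add: add.assoc)

lemma nsmul_mult: "nsmul (m * m') x = nsmul m (nsmul m' x)"
  by (induction m) (simp_all add: nsmul_add)

lemma single_power: "Poly_Mapping.single (e::'e::comm_monoid_add) (c::'k::field) ^ m = Poly_Mapping.single (nsmul m e) (c ^ m)"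
  by (induction m) (simp_all add: mult_single)

lemma prod_list_power_count_dvd: "(x::'a::comm_semiring_1) ^ count_list xs x dvd prod_list xs"
  by (induction xs) (auto intro: dvd_mult mult_dvd_mono)

text \<open>The submonoid generated by the list. In a p-torsion group it is a subgroup, since
  \<open>- x\<close> is the multiple of \<open>x\<close> by \<open>p - 1\<close>.\<close>

primrec gens :: "'e::comm_monoid_add list \<Rightarrow> 'e set" where
  "gens [] = {0}"
| "gens (e # es) = {nsmul m e + h | m h. h \<in> gens es}"

lemma zero_in_gens: "0 \<in> gens es"
  by (induction es) (auto intro: exI[of _ 0])

lemma add_in_gens: "x \<in> gens es \<Longrightarrow> y \<in> gens es \<Longrightarrow> x + y \<in> gens es"
proof (induction es arbitrary: x y)
  case (Cons e es)
  then obtain m h m' h' where "x = nsmul m e + h" "y = nsmul m' e + h'" "h \<in> gens es" "h' \<in> gens es"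
    by auto
  moreover from this have "x + y = nsmul (m + m') e + (h + h')"
    by (simp add: nsmul_add ac_simps)
  ultimately show ?case
    using Cons.IH by auto
qed simp

lemma nsmul_in_gens: "x \<in> gens es \<Longrightarrow> nsmul m x \<in> gens es"
  by (induction m) (simp_all add: zero_in_gens add_in_gens)

lemma gens_induct [consumes 1, case_names zero add]:
  assumes "x \<in> gens es" and zero: "P 0" and add: "\<And>e x. e \<in> set es \<Longrightarrow> P x \<Longrightarrow> P (e + x)"
  shows "P x"
  using assms(1) add
proof (induction es arbitrary: x)
  case (Cons e es)
  then obtain m h where x: "x = nsmul m e + h" "h \<in> gens es"
    by auto
  have "P h"
    using Cons.IH[OF x(2)] Cons.prems(2) by simp
  then have "P (nsmul m e + h)"
    by (induction m) (simp_all add: Cons.prems(2) add.assoc)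
  then show ?case
    by (simp add: x)
qed (simp add: zero)

text \<open>The translates of \<open>gens es\<close> by the multiples of \<open>e\<close> with
  factors \<open>0, ..., p - 1\<close> are disjoint: otherwise \<open>gens es\<close> contains a
  multiple of \<open>e\<close> by some \<open>d\<close> prime to \<open>p\<close>, and then
  \<open>e\<close> itself.\<close>

lemma card_gens_Cons:
  fixes e :: "'e::{finite, ab_group_add}"
  assumes p: "prime p" "\<And>x::'e. nsmul p x = 0" and e: "e \<notin> gens es"
  shows "p * card (gens es) \<le> card (gens (e # es))"
proof -
  let ?f = "\<lambda>(m, h). nsmul m e + h"
  have uminus: "- x \<in> gens es" if x: "x \<in> gens es" for x
  proof -
    have "x + nsmul (p - 1) x = 0"
      using p(2)[of x] prime_gt_0_nat[OF p(1)] nsmul_simps(2)[of "p - 1" x] by simp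
    then have "- x = nsmul (p - 1) x"
      by (simp add: neg_eq_iff_add_eq_0)
    then show ?thesis
      using nsmul_in_gens[OF x] by simp
  qed
  have eq: "m = m'" if "m \<le> m'" "m' < p" "h \<in> gens es" "h' \<in> gens es" "nsmul m e + h = nsmul m' e + h'" for m m' h h'
  proof (rule ccontr)
    assume "m \<noteq> m'"
    define d where "d = m' - m"
    have d: "0 < d" "d < p" "m' = m + d"
      using that \<open>m \<noteq> m'\<close> by (auto simp: d_def)
    have "nsmul d e = h + - h'"
      using that(5) by (simp add: d(3) nsmul_add algebra_simps)
    then have mem: "nsmul d e \<in> gens es"
      using that uminus add_in_gens by metis
    have "\<not> p dvd d"
      using d nat_dvd_not_less by blast
    then have "coprime d p"
      using p(1) prime_imp_coprime coprime_commute by blast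
    \<comment> \<open>Here \<open>x\<close> is an inverse of \<open>d\<close> modulo
      \<open>p\<close>, so multiplying by \<open>x\<close> recovers \<open>e\<close>.\<close>
    then obtain x y where "d * x = p * y + 1"
      using bezout_nat[of d p] d(1) by auto
    then have "x * d = y * p + 1"
      by (simp add: mult.commute)
    then have "nsmul x (nsmul d e) = nsmul (y * p + 1) e"
      by (metis nsmul_mult)
    also have "\<dots> = e"
      using p(2) by (simp only: nsmul_add nsmul_mult) (simp add: nsmul_def)
    finally show False
      using nsmul_in_gens[OF mem, of x] e by simp
  qed
  have "inj_on ?f ({..<p} \<times> gens es)"
  proof (rule inj_onI)
    fix a b assume *: "a \<in> {..<p} \<times> gens es" "b \<in> {..<p} \<times> gens es" "?f a = ?f b"
    obtain m h m' h' where ab: "a = (m, h)" "b = (m', h')"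
      by (cases a, cases b)
    have "m = m'"
      using eq[of m m' h h'] eq[of m' m h' h] * by (cases "m \<le> m'") (auto simp: ab)
    then show "a = b"
      using * by (simp add: ab)
  qed
  moreover have "?f ` ({..<p} \<times> gens es) \<subseteq> gens (e # es)"
    by auto
  ultimately have "card ({..<p} \<times> gens es) \<le> card (gens (e # es))"
    by (intro card_inj_on_le) auto
  then show ?thesis
    by simp
qed

text \<open>Greedy choice: as long as the group is not exhausted, a new element multiplies the size
  by at least \<open>p\<close>. After \<open>n\<close> elements the size has reached
  \<open>p ^ n\<close>.\<close>

lemma ex_gens_UNIV:
  fixes p n :: nat
  assumes p: "prime p" "\<And>x::'e::{finite, ab_group_add}. nsmul p x = 0"
    and card: "card (UNIV :: 'e::{finite, ab_group_add} set) = p ^ n"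
  obtains es :: "'e::{finite, ab_group_add} list" where "length es \<le> n" "gens es = UNIV"
proof -
  have "(\<exists>es::'e list. length es \<le> m \<and> gens es = UNIV) \<or> (\<exists>es::'e list. length es = m \<and> p ^ m \<le> card (gens es))" for m
  proof (induction m)
    case (Suc m)
    show ?case
    proof (cases "\<exists>es::'e list. length es \<le> m \<and> gens es = UNIV")
      case True
      then show ?thesis
        using le_SucI by blast
    next
      case False
      then obtain es :: "'e list" where es: "length es = m" "p ^ m \<le> card (gens es)" "gens es \<noteq> UNIV"
        using Suc.IH by auto
      then obtain e where "e \<notin> gens es"
        by auto
      then have "p ^ Suc m \<le> card (gens (e # es))"
        using card_gens_Cons[OF p, of e es] es(2) by (simp only: power_Suc) (meson le_trans mult_le_mono2)
      then show ?thesis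
        using es(1) by (metis length_Cons)
    qed
  qed (auto intro: exI[of _ "[]"])
  from this[of n] show ?thesis
  proof
    assume "\<exists>es::'e list. length es = n \<and> p ^ n \<le> card (gens es)"
    then obtain es :: "'e list" where "length es = n" "card (UNIV :: 'e set) \<le> card (gens es)"
      using card by auto
    then have "gens es = UNIV"
      by (intro card_seteq) auto
    with \<open>length es = n\<close> show ?thesis
      by (intro that[of es]) simp_all
  qed (use that in blast)
qed

section \<open>The augmentation of the group algebra and its p-power map\<close>

definition aug :: "('e::finite \<Rightarrow>\<^sub>0 'k::field) \<Rightarrow> 'k" where
  "aug x = (\<Sum>e\<in>UNIV. Poly_Mapping.lookup x e)"

lemma grp_alg_eq_sum: "x = (\<Sum>e\<in>UNIV. Poly_Mapping.single e (Poly_Mapping.lookup x e))"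
  for x :: "'e::finite \<Rightarrow>\<^sub>0 'k::field"
  by (rule poly_mapping_eqI) (simp add: lookup_sum lookup_single when_def)

locale group_algebra_complement =
  fixes V :: "('e::{finite, ab_group_add}, 'k::field) grp_alg set" and p n :: nat
  assumes CHAR: "CHAR('k) = p" and p_pos: "p > 0"
    and elementary_abelian: "elementary_abelian TYPE('e) p n"
    and complement: "rad_complement V"
begin

lemma prime_p: "prime p"
  using prime_CHAR_semidom[where ?'a = 'k] CHAR p_pos by simp

lemma p_torsion: "nsmul p (x::'e) = 0"
  using elementary_abelian by (simp add: elementary_abelian_def nsmul_def)

lemma power_p: "x ^ p = Poly_Mapping.single 0 (aug x ^ p)" for x :: "('e, 'k) grp_alg"
proof -
  have "x ^ p = (\<Sum>e\<in>UNIV. Poly_Mapping.single e (Poly_Mapping.lookup x e)) ^ p"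
    by (simp flip: grp_alg_eq_sum)
  also have "\<dots> = (\<Sum>e\<in>UNIV. Poly_Mapping.single e (Poly_Mapping.lookup x e) ^ p)"
    using prime_p CHAR by (intro freshmans_dream_sum) simp_all
  \<comment> \<open>The p-th power of a group element is the identity, so all terms of the sum are
    scalars.\<close>
  also have "\<dots> = Poly_Mapping.single 0 (\<Sum>e\<in>UNIV. Poly_Mapping.lookup x e ^ p)"
    by (rule poly_mapping_eqI) (simp add: single_power p_torsion lookup_sum lookup_single when_def)
  also have "(\<Sum>e\<in>UNIV. Poly_Mapping.lookup x e ^ p) = aug x ^ p"
    unfolding aug_def using prime_p CHAR by (intro freshmans_dream_sum[symmetric]) simp_all
  finally show ?thesis .
qed

lemma power_p_eq_0_iff: "x ^ p = 0 \<longleftrightarrow> aug x = 0" for x :: "('e, 'k) grp_alg"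
proof -
  have "Poly_Mapping.single (0::'e) c = 0 \<longleftrightarrow> c = 0" for c :: 'k
    by (metis lookup_single_eq lookup_zero single_zero)
  then show ?thesis
    using p_pos by (simp add: power_p)
qed

lemma ideal_nilpotent: "ideal {x :: ('e, 'k) grp_alg. x ^ p = 0} kE"
proof -
  interpret cring "kE :: ('e, 'k) grp_alg ring"
    by (rule cring_kE)
  show ?thesis
  proof (rule idealI)
    show "ring (kE :: ('e, 'k) grp_alg ring)"
      by (rule ring_axioms)
    show "subgroup {x :: ('e, 'k) grp_alg. x ^ p = 0} (add_monoid kE)"
    proof (rule add.subgroupI)
      fix x y :: "('e, 'k) grp_alg"
      assume x: "x \<in> {x. x ^ p = 0}"
      have "(- x) ^ p = (- 1) ^ p * x ^ p"
        using power_mult_distrib[of "- 1" x p] by simp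
      then show "\<ominus>\<^bsub>kE\<^esub> x \<in> {x. x ^ p = 0}"
        using kE_minus[of 0 x] x by (simp add: a_minus_def)
      have "(x + y) ^ p = x ^ p + y ^ p"
        by (rule freshmans_dream) (simp_all add: CHAR prime_p)
      then show "x \<oplus>\<^bsub>kE\<^esub> y \<in> {x. x ^ p = 0}" if "y \<in> {x. x ^ p = 0}"
        using x that by simp
    next
      show "{x :: ('e, 'k) grp_alg. x ^ p = 0} \<noteq> {}"
        using zero_power[OF p_pos] by blast
    qed simp
  qed (simp_all add: power_mult_distrib)
qed

text \<open>By \<open>power_p\<close> the power \<open>x ^ p\<close> is a scalar. If it is nonzero,
  \<open>x\<close> is a unit; if it is zero, \<open>x\<close> is nilpotent and lies in every prime
  ideal.\<close>

lemma Rad_kE: "Rad kE = {x :: ('e, 'k) grp_alg. x ^ p = 0}"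
proof (rule cring.Rad_eqI[OF cring_kE ideal_nilpotent])
  show "{x :: ('e, 'k) grp_alg. x ^ p = 0} \<subseteq> I" if I: "primeideal I kE" for I
  proof -
    interpret primeideal I kE
      by (rule I)
    have "0 \<in> I"
      using additive_subgroup.zero_closed[OF additive_subgroup_axioms] by simp
    then show ?thesis
      using nat_pow_memD[of _ p] by (auto simp: kE_nat_pow)
  qed
next
  fix x :: "('e, 'k) grp_alg"
  assume "x \<notin> {x. x ^ p = 0}"
  then have "aug x \<noteq> 0"
    by (simp add: power_p_eq_0_iff)
  then have "Poly_Mapping.single 0 (inverse (aug x ^ p)) * x ^ p = 1"
    unfolding power_p by (simp add: mult_single)
  then have "(Poly_Mapping.single 0 (inverse (aug x ^ p)) * x ^ (p - 1)) * x = 1"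
    using power_minus_mult[OF p_pos, of x] by (simp add: mult.assoc)
  then show "\<exists>y\<in>carrier kE. \<exists>a\<in>{x. x ^ p = 0}. y \<otimes>\<^bsub>kE\<^esub> x \<oplus>\<^bsub>kE\<^esub> a = \<one>\<^bsub>kE\<^esub>"
    using zero_power[OF p_pos]
    by (intro bexI[of _ "Poly_Mapping.single 0 (inverse (aug x ^ p)) * x ^ (p - 1)"] bexI[of _ 0]) simp_all
qed simp

lemma mem_Rad_kE: "x \<in> Rad kE \<longleftrightarrow> aug x = 0" for x :: "('e, 'k) grp_alg"
  by (simp add: Rad_kE power_p_eq_0_iff)

lemma ideal_Rad_kE: "ideal (Rad (kE :: ('e, 'k) grp_alg ring)) kE"
  unfolding Rad_kE by (rule ideal_nilpotent)

abbreviation A :: "('e, 'k) grp_alg set" where "A \<equiv> Rad kE"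

definition Q :: "('e, 'k) grp_alg set" where "Q = ideal_power kE A 2"

lemma A_closed: "0 \<in> A" "x \<in> A \<Longrightarrow> y \<in> A \<Longrightarrow> x + y \<in> A" "x \<in> A \<Longrightarrow> y * x \<in> A" "x \<in> A \<Longrightarrow> x * y \<in> A"
  using ideal.I_l_closed[OF ideal_Rad_kE, of x y] ideal.I_r_closed[OF ideal_Rad_kE, of x y]
    additive_subgroup.zero_closed[OF ideal.axioms(1)[OF ideal_Rad_kE]]
    additive_subgroup.a_closed[OF ideal.axioms(1)[OF ideal_Rad_kE], of x y]
  by simp_all

lemma ideal_Q: "ideal Q kE"
proof -
  interpret cring "kE :: ('e, 'k) grp_alg ring"
    by (rule cring_kE)
  show ?thesis
    unfolding Q_def numeral_2_eq_2 ideal_power.simps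
    by (intro ideal_prod_is_ideal oneideal ideal_Rad_kE)
qed

lemma Q_closed: "0 \<in> Q" "x \<in> Q \<Longrightarrow> y \<in> Q \<Longrightarrow> x + y \<in> Q" "x \<in> Q \<Longrightarrow> y * x \<in> Q" "x \<in> Q \<Longrightarrow> x * y \<in> Q"
  using ideal.I_l_closed[OF ideal_Q, of x y] ideal.I_r_closed[OF ideal_Q, of x y]
    additive_subgroup.zero_closed[OF ideal.axioms(1)[OF ideal_Q]]
    additive_subgroup.a_closed[OF ideal.axioms(1)[OF ideal_Q], of x y]
  by simp_all

lemma Q_closed': "x \<in> Q \<Longrightarrow> - x \<in> Q" "x \<in> Q \<Longrightarrow> y \<in> Q \<Longrightarrow> x - y \<in> Q" "x \<in> Q \<Longrightarrow> kscale c x \<in> Q"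
proof -
  show *: "- x \<in> Q" if "x \<in> Q" for x
    using Q_closed(3)[OF that, of "- 1"] by simp
  show "x - y \<in> Q" if "x \<in> Q" "y \<in> Q"
    using Q_closed(2)[OF that(1) *[OF that(2)]] by simp
  show "kscale c x \<in> Q" if "x \<in> Q"
    unfolding kscale_def by (rule Q_closed(3)[OF that])
qed

lemma mult_in_Q: "x \<in> A \<Longrightarrow> y \<in> A \<Longrightarrow> x * y \<in> Q"
  using ideal_prod.prod[of 1 "carrier kE" x A kE] ideal_prod.prod[of x "ideal_prod kE (carrier kE) A" y A kE]
  by (simp add: Q_def numeral_2_eq_2)

lemma Q_induct [consumes 1, case_names prod sum]:
  assumes "q \<in> Q" and prod: "\<And>x y. x \<in> A \<Longrightarrow> y \<in> A \<Longrightarrow> P (x * y)"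
    and sum: "\<And>x y. P x \<Longrightarrow> P y \<Longrightarrow> P (x + y)"
  shows "P q"
proof -
  have A: "x \<in> A" if "x \<in> ideal_prod kE (carrier kE) A" for x
    using that by induction (simp_all add: A_closed)
  have "q \<in> ideal_prod kE (ideal_prod kE (carrier kE) A) A"
    using assms(1) by (simp add: Q_def numeral_2_eq_2)
  then show ?thesis
    by induction (simp_all add: A prod sum)
qed

lemma subspace: "kscale.subspace V" and V_A: "V \<subseteq> A"
  using complement by (simp_all add: rad_complement_def)

lemma V_complement:
  shows "x \<in> A \<Longrightarrow> \<exists>v\<in>V. x - v \<in> Q" and "u \<in> V \<Longrightarrow> v \<in> V \<Longrightarrow> u - v \<in> Q \<Longrightarrow> u = v"
proof -
  interpret cring "kE :: ('e, 'k) grp_alg ring"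
    by (rule cring_kE)
  have eq: "Q +>\<^bsub>kE\<^esub> x = Q +>\<^bsub>kE\<^esub> y \<longleftrightarrow> x - y \<in> Q" for x y
    using quotient_eq_iff_same_a_r_cos[OF ideal_Q, of x y] by (simp add: kE_minus)
  have bij: "bij_betw (\<lambda>v. Q +>\<^bsub>kE\<^esub> v) V ((\<lambda>x. Q +>\<^bsub>kE\<^esub> x) ` A)"
    using complement by (simp add: rad_complement_def Q_def Let_def)
  show "\<exists>v\<in>V. x - v \<in> Q" if "x \<in> A"
  proof -
    have "Q +>\<^bsub>kE\<^esub> x \<in> (\<lambda>v. Q +>\<^bsub>kE\<^esub> v) ` V"
      using that bij_betw_imp_surj_on[OF bij] by blast
    then show ?thesis
      using eq by blast
  qed
  show "u = v" if "u \<in> V" "v \<in> V" "u - v \<in> Q"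
    using that eq[of u v] bij_betw_imp_inj_on[OF bij] by (auto dest: inj_onD)
qed

text \<open>These elements span the augmentation ideal, and modulo its square they turn the group
  law into addition.\<close>

definition aug_elem :: "'e \<Rightarrow> ('e, 'k) grp_alg" where
  "aug_elem e = Poly_Mapping.single e 1 - 1"

lemma aug_elem_in_A: "aug_elem e \<in> A"
proof -
  have "aug (aug_elem e) = 0"
    by (simp add: aug_def aug_elem_def lookup_minus lookup_one lookup_single when_def sum_subtractf)
  then show ?thesis
    by (simp add: mem_Rad_kE)
qed

text \<open>The coefficients of \<open>x\<close> sum to zero, so subtracting that sum times the
  identity changes nothing.\<close>

lemma A_eq_sum:
  assumes "x \<in> A"
  shows "x = (\<Sum>e\<in>UNIV. kscale (Poly_Mapping.lookup x e) (aug_elem e))"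
proof -
  have "(\<Sum>e\<in>UNIV. kscale (Poly_Mapping.lookup x e) (aug_elem e)) =
      (\<Sum>e\<in>UNIV. Poly_Mapping.single e (Poly_Mapping.lookup x e)) -
      (\<Sum>e\<in>UNIV. Poly_Mapping.single 0 (Poly_Mapping.lookup x e))"
    by (simp add: aug_elem_def kscale_def right_diff_distrib mult_single sum_subtractf)
  also have "(\<Sum>e\<in>UNIV. Poly_Mapping.single 0 (Poly_Mapping.lookup x e)) = Poly_Mapping.single (0::'e) (aug x)"
    by (rule poly_mapping_eqI) (simp add: lookup_sum lookup_single when_def aug_def)
  finally show ?thesis
    using assms by (simp add: mem_Rad_kE flip: grp_alg_eq_sum)
qed

lemma A_span: "A \<subseteq> kscale.span (range aug_elem)"
proof
  fix x assume "x \<in> A"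
  then show "x \<in> kscale.span (range aug_elem)"
    by (subst A_eq_sum, assumption) (intro kscale.span_sum kscale.span_scale kscale.span_base rangeI)
qed

text \<open>Among \<open>card ?D * p\<close> factors from the spanning set \<open>?D\<close> one
  occurs at least \<open>p\<close> times, and its p-th power is zero. Multilinearity extends this to
  factors from \<open>A\<close>.\<close>

lemma A_nilpotent: "\<exists>N. \<forall>xs. set xs \<subseteq> A \<and> N \<le> length xs \<longrightarrow> prod_list xs = 0"
proof -
  let ?D = "range aug_elem"
  let ?N = "card ?D * p"
  have D: "prod_list ys = 0" if ys: "set ys \<subseteq> ?D" "?N \<le> length ys" for ys
  proof -
    have "\<exists>d\<in>?D. p \<le> count_list ys d"
    proof (rule ccontr)
      assume "\<not> (\<exists>d\<in>?D. p \<le> count_list ys d)"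
      then have "(\<Sum>d\<in>?D. count_list ys d) < (\<Sum>d\<in>?D. p)"
        by (intro sum_strict_mono) (auto simp: not_le)
      then show False
        using sum_count_set[OF ys(1)] ys(2) by simp
    qed
    then obtain d where d: "d \<in> ?D" "p \<le> count_list ys d"
      by blast
    then have "d ^ p = 0"
      using aug_elem_in_A by (auto simp: Rad_kE)
    then have "d ^ count_list ys d = 0"
      using d(2) by (metis le_Suc_ex mult_zero_left power_add)
    then show ?thesis
      using prod_list_power_count_dvd[of d ys] by simp
  qed
  \<comment> \<open>The factors in \<open>ys\<close> are already spanning elements; those in
    \<open>xs\<close> are replaced one after another by span induction.\<close>
  have "prod_list ys * prod_list xs = 0" if "set ys \<subseteq> ?D" "set xs \<subseteq> A" "?N \<le> length ys + length xs" for ys xs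
    using that
  proof (induction xs arbitrary: ys)
    case Nil
    then show ?case
      by (simp add: D)
  next
    case (Cons x xs)
    have "x \<in> kscale.span ?D"
      using Cons.prems A_span by auto
    then have "prod_list ys * x * prod_list xs = 0"
    proof (induction rule: kscale.span_induct)
      case base
      show ?case
        by (rule kscale.subspaceI) (simp_all add: distrib_left distrib_right kscale_mult)
    next
      case (step d)
      then have "prod_list (ys @ [d]) * prod_list xs = 0"
        using Cons.prems by (intro Cons.IH) auto
      then show ?case
        by simp
    qed
    then show ?case
      by (simp add: mult.assoc)
  qed
  from this[of "[]"] show ?thesis
    by (intro exI[of _ ?N]) auto
qed

text \<open>Replacing a factor \<open>x\<close> of a product by a vector \<open>v\<close> with
  \<open>x - v\<close> in \<open>Q\<close> costs products with one more factor from
  \<open>A\<close>. Products with \<open>N\<close> factors vanish, so induction downwards on the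
  number of factors ends.\<close>

lemma kE_map_surj: "kE_map ` carrier (Free V) = UNIV"
proof -
  let ?W = "kE_map ` carrier (Free V)"
  have W_add: "x + y \<in> ?W" if "x \<in> ?W" "y \<in> ?W" for x y
    using that by (auto simp flip: kE_map_add intro!: imageI add_in_Free)
  have W_word: "kscale c (prod_list us) \<in> ?W" if "set us \<subseteq> V" for us c
    using word_in_Free[OF that, of c] by (metis imageI kE_map_word)
  have W_0: "0 \<in> ?W"
    using W_word[of "[]" 0] by simp
  obtain N where N: "\<And>xs. set xs \<subseteq> A \<Longrightarrow> N \<le> length xs \<Longrightarrow> prod_list xs = 0"
    using A_nilpotent by blast
  have prod: "prod_list xs \<in> ?W" if "set xs \<subseteq> A" for xs
    using that
  proof (induction "N - length xs" arbitrary: xs rule: less_induct)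
    case less
    show ?case
    proof (cases "N \<le> length xs")
      case True
      then show ?thesis
        using N[OF less.prems] W_0 by simp
    next
      case False
      \<comment> \<open>The factors \<open>us\<close> have already been moved into \<open>V\<close>.
        The total length stays fixed, so that correction terms fall under the outer induction
        hypothesis.\<close>
      have "prod_list us * prod_list ys \<in> ?W" if "set us \<subseteq> V" "set ys \<subseteq> A" "length us + length ys = length xs" for us ys
        using that
      proof (induction ys arbitrary: us)
        case Nil
        then show ?case
          using W_word[of us 1] by simp
      next
        case (Cons x ys)
        obtain v where v: "v \<in> V" "x - v \<in> Q"
          using V_complement(1)[of x] Cons.prems by auto
        have "prod_list (us @ [v]) * prod_list ys \<in> ?W"
          using Cons.prems v by (intro Cons.IH) auto
        moreover have "prod_list us * q * prod_list ys \<in> ?W" if "q \<in> Q" for q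
          using that
        proof (induction rule: Q_induct)
          case (prod a b)
          have "prod_list (us @ a # b # ys) \<in> ?W"
            using Cons.prems prod V_A False by (intro less.hyps) auto
          then show ?case
            by (simp add: mult.assoc)
        next
          case (sum a b)
          then show ?case
            using W_add by (simp add: distrib_left distrib_right)
        qed
        ultimately have "prod_list us * v * prod_list ys + prod_list us * (x - v) * prod_list ys \<in> ?W"
          using W_add v by simp
        then show ?case
          by (simp add: algebra_simps)
      qed
      from this[of "[]" xs] show ?thesis
        using less.prems by simp
    qed
  qed
  \<comment> \<open>An arbitrary element is a scalar plus an element of \<open>A\<close>, the latter
    being a product with one factor.\<close>
  have "x \<in> ?W" for x
  proof -
    let ?c = "kscale (aug x) 1 :: ('e, 'k) grp_alg"
    have "aug (x - ?c) = 0"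
      by (simp add: aug_def kscale_def lookup_minus lookup_single when_def sum_subtractf)
    then have "x - ?c \<in> ?W"
      using prod[of "[x - ?c]"] by (simp add: mem_Rad_kE)
    moreover have "?c \<in> ?W"
      using W_word[of "[]" "aug x"] by simp
    ultimately have "x - ?c + ?c \<in> ?W"
      by (rule W_add)
    then show ?thesis
      by simp
  qed
  then show ?thesis
    by blast
qed

text \<open>Modulo \<open>Q\<close> the map \<open>aug_elem\<close> is additive, so the classes of
  at most \<open>n\<close> generators of the group span \<open>A\<close> modulo \<open>Q\<close>.
  Their representatives in \<open>V\<close> span \<open>V\<close> because \<open>V\<close> meets
  each class at most once.\<close>

lemma spanning_set: obtains S where "finite S" "card S \<le> n" "S \<subseteq> V" "V \<subseteq> kscale.span S"
proof -
  obtain es :: "'e list" where es: "length es \<le> n" "gens es = UNIV"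
    using ex_gens_UNIV[OF prime_p p_torsion] elementary_abelian by (auto simp: elementary_abelian_def)
  obtain v where v: "\<And>e. v e \<in> V" "\<And>e. aug_elem e - v e \<in> Q"
    using V_complement(1)[OF aug_elem_in_A] by metis
  let ?S = "v ` set es"
  have SV: "kscale.span ?S \<subseteq> V"
    using v subspace by (intro kscale.span_minimal) auto
  have "\<exists>s\<in>kscale.span ?S. aug_elem e - s \<in> Q" for e
  proof -
    have "e \<in> gens es"
      using es by simp
    then show ?thesis
    proof (induction rule: gens_induct)
      case zero
      then show ?case
        using kscale.span_zero by (intro bexI[of _ 0]) (simp_all add: aug_elem_def Q_closed)
    next
      case (add e x)
      then obtain s where s: "s \<in> kscale.span ?S" "aug_elem x - s \<in> Q"
        by blast
      \<comment> \<open>With group elements written as \<open>a\<close> and \<open>b\<close> this is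
        \<open>ab - 1 = (a - 1) + (b - 1) + (a - 1)(b - 1)\<close>; the last term lies in
        \<open>Q\<close>.\<close>
      have "aug_elem (e + x) = aug_elem e + aug_elem x + aug_elem e * aug_elem x"
        by (simp add: aug_elem_def algebra_simps mult_single)
      then have "aug_elem (e + x) - (v e + s) = (aug_elem e - v e) + (aug_elem x - s) + aug_elem e * aug_elem x"
        by simp
      also have "\<dots> \<in> Q"
        by (intro Q_closed v s mult_in_Q aug_elem_in_A)
      finally have "aug_elem (e + x) - (v e + s) \<in> Q" .
      moreover have "v e + s \<in> kscale.span ?S"
        using add by (intro kscale.span_add[OF kscale.span_base s(1)]) simp
      ultimately show ?case
        by blast
    qed
  qed
  then obtain s where s: "\<And>e. s e \<in> kscale.span ?S" "\<And>e. aug_elem e - s e \<in> Q"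
    by metis
  have "V \<subseteq> kscale.span ?S"
  proof
    fix x assume x: "x \<in> V"
    let ?y = "\<Sum>e\<in>UNIV. kscale (Poly_Mapping.lookup x e) (s e)"
    have y: "?y \<in> kscale.span ?S"
      by (intro kscale.span_sum kscale.span_scale s)
    have "x - ?y = (\<Sum>e\<in>UNIV. kscale (Poly_Mapping.lookup x e) (aug_elem e - s e))"
      using A_eq_sum[of x] x V_A by (subst A_eq_sum[of x]) (auto simp: kscale.scale_right_diff_distrib sum_subtractf)
    also have "\<dots> \<in> Q"
    proof -
      have "sum f X' \<in> Q" if "\<And>e. f e \<in> Q" for f :: "'e \<Rightarrow> ('e, 'k) grp_alg" and X'
        using that by (induction X' rule: infinite_finite_induct) (auto simp: Q_closed)
      then show ?thesis
        by this (rule Q_closed'(3)[OF s(2)])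
    qed
    finally have "x = ?y"
      using V_complement(2)[OF x] SV y by blast
    then show "x \<in> kscale.span ?S"
      using y by simp
  qed
  moreover have "card ?S \<le> n"
    using card_image_le[of "set es" v] card_length[of es] es by simp
  ultimately show ?thesis
    using v by (intro that[of ?S]) auto
qed

end

section \<open>Words modulo commutators and the presentation of the group algebra\<close>

context
  fixes P :: "('e::ab_group_add, 'k::field) free_alg set" and V :: "('e, 'k) grp_alg set"
  assumes P: "ideal P (Free V)"
    and comm: "\<And>u v. u \<in> V \<Longrightarrow> v \<in> V \<Longrightarrow> free_var u * free_var v - free_var v * free_var u \<in> P"
begin

lemma word_rotate1_cong:
  assumes "set (x # a) \<subseteq> V"
  shows "Poly_Mapping.single (Free_mon (x # a)) 1 - Poly_Mapping.single (Free_mon (a @ [x])) 1 \<in> P"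
  using assms
proof (induction a)
  case Nil
  then show ?case
    using ideal_FreeD(1)[OF P] by simp
next
  case (Cons y a)
  let ?w = "\<lambda>a. Poly_Mapping.single (Free_mon a) 1 :: ('e, 'k) free_alg"
  \<comment> \<open>One commutator moves \<open>x\<close> past \<open>y\<close>; the induction
    hypothesis, multiplied by \<open>y\<close> on the left, moves it past the rest.\<close>
  have "(free_var x * free_var y - free_var y * free_var x) * ?w a + free_var y * (?w (x # a) - ?w (a @ [x])) \<in> P"
    using Cons
    by (intro ideal_FreeD(2)[OF P ideal_FreeD(6)[OF P] ideal_FreeD(5)[OF P]] comm word_in_Free free_var_in_Free)
      auto
  also have "(free_var x * free_var y - free_var y * free_var x) * ?w a + free_var y * (?w (x # a) - ?w (a @ [x]))
      = ?w (x # y # a) - ?w ((y # a) @ [x])"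
    by (simp add: free_var_def mult_single left_diff_distrib right_diff_distrib)
  finally show ?case .
qed

text \<open>The first letter of \<open>w\<close> is located in \<open>w'\<close> and rotated to the
  front there; the remaining words then have the same letters.\<close>

lemma word_mset_cong:
  assumes "set w \<subseteq> V" "mset w = mset w'"
  shows "Poly_Mapping.single (Free_mon w) c - Poly_Mapping.single (Free_mon w') c \<in> P"
proof -
  let ?w = "\<lambda>a. Poly_Mapping.single (Free_mon a) 1 :: ('e, 'k) free_alg"
  have *: "?w w - ?w w' \<in> P"
    using assms
  proof (induction w arbitrary: w')
    case Nil
    then show ?case
      using ideal_FreeD(1)[OF P] by simp
  next
    case (Cons x w)
    then have "x \<in> set w'"
      using mset_eq_setD[OF Cons.prems(2)] by auto
    then obtain a b where ab: "w' = a @ x # b"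
      by (meson split_list)
    then have mset: "mset w = mset (a @ b)"
      using Cons.prems by simp
    have set: "set a \<subseteq> V" "set b \<subseteq> V" "x \<in> V" "set w \<subseteq> V"
      using Cons.prems mset_eq_setD[OF Cons.prems(2)] ab by auto
    have "free_var x * (?w w - ?w (a @ b)) + (?w (x # a) - ?w (a @ [x])) * ?w b \<in> P"
      using set Cons.IH[OF set(4) mset]
      by (intro ideal_FreeD(2)[OF P ideal_FreeD(5)[OF P] ideal_FreeD(6)[OF P]] word_rotate1_cong word_in_Free
          free_var_in_Free) auto
    also have "free_var x * (?w w - ?w (a @ b)) + (?w (x # a) - ?w (a @ [x])) * ?w b = ?w (x # w) - ?w w'"
      by (simp add: ab free_var_def mult_single left_diff_distrib right_diff_distrib)
    finally show ?case .
  qed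
  have "free_const c * (?w w - ?w w') \<in> P"
    by (rule ideal_FreeD(5)[OF P * free_const_in_Free])
  then show ?thesis
    by (simp add: right_diff_distrib free_const_def mult_single zero_Free_mon)
qed

end

lemma free_var_power: "free_var v ^ m = Poly_Mapping.single (Free_mon (replicate m v)) 1"
proof (induction m)
  case 0
  then show ?case
    by (simp add: zero_Free_mon[symmetric])
next
  case (Suc m)
  then show ?case
    by (simp add: free_var_def mult_single)
qed

text \<open>Modulo commutators a word depends only on the multiset of its letters; \<open>std_word m\<close> is a
  chosen representative.\<close>

definition std_word :: "'a multiset \<Rightarrow> 'a list" where
  "std_word m = (SOME w. mset w = m)"

lemma mset_std_word [simp]: "mset (std_word m) = m"
  unfolding std_word_def by (rule someI_ex) (rule ex_mset)

lemma set_std_word [simp]: "set (std_word m) = set_mset m"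
  by (metis mset_std_word set_mset_mset)

definition truncated :: "'a set \<Rightarrow> nat \<Rightarrow> 'a multiset set" where
  "truncated S p = {m. set_mset m \<subseteq> S \<and> (\<forall>b. count m b < p)}"

text \<open>A multiset over \<open>S\<close> is determined by its multiplicities on
  \<open>S\<close>, each one of \<open>p\<close> values.\<close>

lemma card_truncated:
  assumes "finite S"
  shows "finite (truncated S p)" "card (truncated S p) \<le> p ^ card S"
proof -
  let ?f = "\<lambda>m. restrict (count m) S"
  have inj: "inj_on ?f (truncated S p)"
  proof (rule inj_onI)
    fix m m' assume *: "m \<in> truncated S p" "m' \<in> truncated S p" "?f m = ?f m'"
    have "count m b = count m' b" for b
    proof (cases "b \<in> S")
      case True
      then show ?thesis
        using fun_cong[OF *(3), of b] by simp
    next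
      case False
      then have "b \<notin># m" "b \<notin># m'"
        using * by (auto simp: truncated_def)
      then show ?thesis
        by (simp add: not_in_iff)
    qed
    then show "m = m'"
      by (rule multiset_eqI)
  qed
  have sub: "?f ` truncated S p \<subseteq> PiE S (\<lambda>_. {..<p})"
    by (auto simp: truncated_def)
  have fin: "finite (PiE S (\<lambda>_. {..<p}))"
    using assms by (intro finite_PiE) auto
  show "finite (truncated S p)"
    by (rule inj_on_finite[OF inj sub fin])
  show "card (truncated S p) \<le> p ^ card S"
    using card_inj_on_le[OF inj sub fin] assms by (simp add: card_PiE)
qed

text \<open>Multilinearity reduces to words in \<open>S\<close>, commutators sort their letters, and
  a word with a letter occurring \<open>p\<close> times is zero modulo \<open>P\<close>.\<close>

lemma truncated_span_mod:
  fixes P :: "('e::ab_group_add, 'k::field) free_alg set"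
  assumes P: "ideal P (Free V)" and linear: "linear_rels V \<subseteq> P"
    and comm: "\<And>u v. u \<in> V \<Longrightarrow> v \<in> V \<Longrightarrow> free_var u * free_var v - free_var v * free_var u \<in> P"
    and pow: "\<And>v. v \<in> V \<Longrightarrow> free_var v ^ p \<in> P"
    and V: "kscale.subspace V" and S: "finite S" "S \<subseteq> V" "V \<subseteq> kscale.span S"
    and t: "t \<in> carrier (Free V)"
  shows "\<exists>c. t - (\<Sum>m\<in>truncated S p. Poly_Mapping.single (Free_mon (std_word m)) (c m)) \<in> P"
proof -
  let ?w = "\<lambda>m c. Poly_Mapping.single (Free_mon (std_word m)) c :: ('e, 'k) free_alg"
  let ?sum = "\<lambda>c. \<Sum>m\<in>truncated S p. ?w m (c m)"
  note fin = card_truncated(1)[OF S(1), of p]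
  have ex: "\<exists>c. t - ?sum c \<in> P" if "t - ?sum c \<in> P" for t c
    using that by (rule exI[where P = "\<lambda>c. t - ?sum c \<in> P"])
  have "t \<in> Free_ge V 0"
    using t by (simp add: Free_ge_0)
  then show ?thesis
    using P linear
  proof (induction rule: Free_ge_induct_spanning[where B = S])
    case (mono w c)
    then have w: "set w \<subseteq> V"
      using S by auto
    show ?case
    proof (cases "mset w \<in> truncated S p")
      case True
      have "?sum (\<lambda>m. if m = mset w then c else 0) = (\<Sum>m\<in>truncated S p. if m = mset w then ?w (mset w) c else 0)"
        by (intro sum.cong) auto
      also have "\<dots> = ?w (mset w) c"
        using True fin by simp
      finally have eq: "?sum (\<lambda>m. if m = mset w then c else 0) = ?w (mset w) c" .
      have "Poly_Mapping.single (Free_mon w) c - ?sum (\<lambda>m. if m = mset w then c else 0) \<in> P"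
        unfolding eq by (rule word_mset_cong[OF P comm w]) simp_all
      then show ?thesis
        by (rule ex)
    next
      case False
      then obtain b where "p \<le> count (mset w) b"
        using mono by (auto simp: truncated_def not_less)
      then obtain ys where ys: "mset w = mset (replicate p b @ ys)"
        by (metis count_le_replicate_mset_subset_eq ex_mset mset_append mset_replicate subset_mset.le_iff_add)
      have set: "set (replicate p b @ ys) \<subseteq> V"
        using mset_eq_setD[OF ys] w by simp
      have "Poly_Mapping.single (Free_mon (replicate p b)) 1 \<in> P"
      \<comment> \<open>For \<open>p = 0\<close> the letter \<open>b\<close> need not lie in
        \<open>V\<close>, but then \<open>pow\<close> at the vector \<open>0\<close> puts
        \<open>1\<close> into \<open>P\<close>.\<close>
      proof (cases "p = 0")
        case True
        then show ?thesis
          using pow[of 0] kscale.subspace_0[OF V] by (simp add: zero_Free_mon[symmetric])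
      next
        case False
        then have "b \<in> V"
          using set by auto
        then show ?thesis
          using pow by (simp add: free_var_power)
      qed
      then have "Poly_Mapping.single (Free_mon (replicate p b @ ys)) c \<in> P"
        unfolding word_append using set by (intro ideal_FreeD(6)[OF P] word_in_Free) auto
      from ideal_FreeD(2)[OF P word_mset_cong[OF P comm w ys, of c] this]
      have "Poly_Mapping.single (Free_mon w) c \<in> P"
        by simp
      then show ?thesis
        by (intro ex[of _ "\<lambda>_. 0"]) simp
    qed
  next
    case (add s t)
    then obtain c d where "s - ?sum c \<in> P" "t - ?sum d \<in> P"
      by blast
    then have "(s - ?sum c) + (t - ?sum d) \<in> P"
      by (rule ideal_FreeD(2)[OF P])
    then have "s + t - ?sum (\<lambda>m. c m + d m) \<in> P"
      by (simp add: single_add sum.distrib algebra_simps)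
    then show ?case
      by (rule ex)
  next
    case (cong s t)
    then obtain c where "s - ?sum c \<in> P"
      by blast
    from ideal_FreeD(4)[OF P this \<open>s - t \<in> P\<close>] have "(s - ?sum c) - (s - t) \<in> P" .
    then have "t - ?sum c \<in> P"
      by simp
    then show ?case
      by (rule ex)
  next
    case zero
    show ?case
      using ideal_FreeD(1)[OF P] by (intro ex[of _ "\<lambda>_. 0"]) simp
  qed (use V S in auto)
qed

lemma kE_map_linear_rels: "r \<in> linear_rels V \<Longrightarrow> kE_map r = 0"
  by (auto simp: linear_rels_def kE_map_diff kE_map_add kE_map_mult kscale_mult)

lemma free_map_linear_rels:
  assumes g: "g \<in> carrier (GL V)" and r: "r \<in> linear_rels V"
  shows "free_map g r \<in> linear_rels V"
proof -
  consider u v where "u \<in> V" "v \<in> V" "r = free_var (u + v) - (free_var u + free_var v)"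
    | c v where "v \<in> V" "r = free_var (kscale c v) - free_const c * free_var v"
    using r unfolding linear_rels_def by blast
  then show ?thesis
  proof cases
    case 1
    then have "free_map g r = free_var (g u + g v) - (free_var (g u) + free_var (g v))"
      using GL_D(5)[OF g] by (simp add: free_map_diff free_map_add)
    then show ?thesis
      using GL_D(4)[OF g] 1 unfolding linear_rels_def by blast
  next
    case 2
    then have "free_map g r = free_var (kscale c (g v)) - free_const c * free_var (g v)"
      using GL_D(6)[OF g] by (simp add: free_map_diff free_map_mult)
    then show ?thesis
      using GL_D(4)[OF g] 2 unfolding linear_rels_def by blast
  qed
qed

lemma linear_rels_Free:
  assumes V: "kscale.subspace V"
  shows "linear_rels V \<subseteq> carrier (Free V)"
  using kscale.subspace_add[OF V] kscale.subspace_scale[OF V]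
  by (auto simp: linear_rels_def intro!: diff_in_Free add_in_Free mult_in_Free free_var_in_Free free_const_in_Free)

lemma kE_map_hom: "kE_map \<in> ring_hom (Free V) kE"
  by (rule ring_hom_memI) (simp_all add: kE_map_add kE_map_mult)

lemma ideal_vimage_Free:
  assumes "ring R" "f \<in> ring_hom (Free V) R" "ideal I R"
  shows "ideal {t \<in> carrier (Free V). f t \<in> I} (Free V)"
  using ring_hom_ring.ideal_vimage[OF ring_hom_ringI2[OF ring_Free assms(1,2)] assms(3)] .

lemma ideal_kernel_kE: "ideal {t \<in> carrier (Free V). kE_map t = 0} (Free V)"
proof -
  interpret cring "kE :: ('a, 'b) grp_alg ring"
    by (rule cring_kE)
  show ?thesis
    using ideal_vimage_Free[OF ring_axioms kE_map_hom zeroideal, of V] by simp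
qed

context group_algebra_complement
begin

text \<open>There are at most \<open>p ^ n\<close> truncated monomials and they span \<open>kE\<close>, whose dimension is
  \<open>p ^ n\<close>; hence they are linearly independent, and there are no further relations.\<close>

theorem kernel_kE_map:
  assumes P: "ideal P (Free V)" and linear: "linear_rels V \<subseteq> P"
    and comm: "\<And>u v. u \<in> V \<Longrightarrow> v \<in> V \<Longrightarrow> free_var u * free_var v - free_var v * free_var u \<in> P"
    and pow: "\<And>v. v \<in> V \<Longrightarrow> free_var v ^ p \<in> P"
    and t: "t \<in> carrier (Free V)" "kE_map t = 0"
  shows "t \<in> P"
proof -
  obtain S where S: "finite S" "card S \<le> n" "S \<subseteq> V" "V \<subseteq> kscale.span S"
    by (rule spanning_set)
  let ?w = "\<lambda>m c. Poly_Mapping.single (Free_mon (std_word m)) c :: ('e, 'k) free_alg"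
  let ?T = "truncated S p"
  define F where "F m = prod_list (std_word m)" for m :: "('e, 'k) grp_alg multiset"
  \<comment> \<open>With the intersection, one reduction to truncated monomials holds modulo
    \<open>P\<close> and in \<open>kE\<close> with the same coefficients. Once these vanish because
    of \<open>kE\<close>, the element lies in \<open>P\<close>.\<close>
  define K where "K = P \<inter> {t \<in> carrier (Free V). kE_map t = 0}"
  have K: "ideal K (Free V)"
    unfolding K_def by (rule ring.i_intersect[OF ring_Free P ideal_kernel_kE])
  have kE_pow: "kE_map (free_var v ^ p) = v ^ p" for v
    by (simp add: free_var_power prod_list_replicate)
  have ex: "\<exists>c. t - (\<Sum>m\<in>?T. ?w m (c m)) \<in> K" if "t \<in> carrier (Free V)" for t
  proof (rule truncated_span_mod[OF K _ _ _ subspace S(1,3,4) that])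
    show "linear_rels V \<subseteq> K"
      using linear linear_rels_Free[OF subspace] kE_map_linear_rels by (auto simp: K_def)
    show "free_var u * free_var v - free_var v * free_var u \<in> K" if "u \<in> V" "v \<in> V" for u v
      using comm[OF that] ideal_FreeD(7)[OF P] by (auto simp: K_def kE_map_diff kE_map_mult mult.commute)
    show "free_var v ^ p \<in> K" if "v \<in> V" for v
      using pow[OF that] ideal_FreeD(7)[OF P] V_A that by (auto simp: K_def kE_pow Rad_kE)
  qed
  have kE_sum: "kE_map (\<Sum>m\<in>?T. ?w m (c m)) = (\<Sum>m\<in>?T. kscale (c m) (F m))" for c
    by (simp add: kE_map_sum F_def)
  have finT: "finite ?T" "card ?T \<le> p ^ n"
    using card_truncated[OF S(1), of p] power_increasing[OF S(2), of p] p_pos by simp_all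
  have span: "x \<in> kscale.span (F ` ?T)" for x
  proof -
    obtain t where t: "t \<in> carrier (Free V)" "kE_map t = x"
      using kE_map_surj by (metis UNIV_I image_iff)
    obtain c where "t - (\<Sum>m\<in>?T. ?w m (c m)) \<in> K"
      using ex[OF t(1)] by blast
    then have "x = (\<Sum>m\<in>?T. kscale (c m) (F m))"
      using t by (simp add: K_def kE_map_diff kE_sum)
    then show ?thesis
      by (auto intro: kscale.span_sum kscale.span_scale kscale.span_base)
  qed
  obtain B where B: "B \<subseteq> F ` ?T" "kscale.independent B" "F ` ?T \<subseteq> kscale.span B"
    by (rule kscale.maximal_independent_subset)
  have spanB: "x \<in> kscale.span B" for x
    using span[of x] kscale.span_minimal[OF B(3) kscale.subspace_span] by blast
  let ?E = "range (\<lambda>e::'e. Poly_Mapping.single e (1::'k))"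
  have indepE: "kscale.independent ?E"
  proof (rule kscale.independent_if_scalars_zero)
    fix f x assume f: "(\<Sum>x\<in>?E. kscale (f x) x) = 0" and x: "x \<in> ?E"
    then obtain e where e: "x = Poly_Mapping.single e 1"
      by blast
    have "(\<Sum>x\<in>?E. kscale (f x) x) = (\<Sum>e\<in>UNIV. Poly_Mapping.single e (f (Poly_Mapping.single e 1)))"
      by (subst sum.reindex) (auto simp: inj_on_def kscale_def mult_single dest: arg_cong[where f = Poly_Mapping.keys])
    from arg_cong[OF this[unfolded f], of "\<lambda>y. Poly_Mapping.lookup y e"] show "f x = 0"
      by (simp add: lookup_sum lookup_single when_def e)
  qed simp
  have "inj (\<lambda>e::'e. Poly_Mapping.single e (1::'k))"
    by (auto simp: inj_on_def dest: arg_cong[where f = Poly_Mapping.keys])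
  then have cardE: "card ?E = p ^ n"
    using elementary_abelian by (simp add: card_image elementary_abelian_def)
  have finB: "finite B"
    using B(1) finT finite_subset by blast
  have "p ^ n \<le> card B"
    using kscale.independent_span_bound[OF finB indepE] spanB cardE by auto
  moreover have "card B \<le> card (F ` ?T)" "card (F ` ?T) \<le> card ?T"
    using B(1) finT by (auto intro: card_mono card_image_le)
  ultimately have card: "card B = card (F ` ?T)" "card (F ` ?T) = card ?T"
    using finT by simp_all
  have "B = F ` ?T"
    using B(1) card(1) finT by (intro card_subset_eq) auto
  then have indep: "kscale.independent (F ` ?T)"
    using B(2) by simp
  have inj: "inj_on F ?T"
    using card(2) finT by (intro eq_card_imp_inj_on)
  obtain c where c: "t - (\<Sum>m\<in>?T. ?w m (c m)) \<in> K"
    using ex[OF t(1)] by blast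
  then have "(\<Sum>m\<in>?T. kscale (c m) (F m)) = 0"
    using t by (simp add: K_def kE_map_diff kE_sum)
  then have "(\<Sum>x\<in>F ` ?T. kscale (c (inv_into ?T F x)) x) = 0"
    by (subst sum.reindex[OF inj]) (simp add: inj)
  then have "c (inv_into ?T F (F m)) = 0" if "m \<in> ?T" for m
    using kscale.independentD[OF indep _ subset_refl, where u = "\<lambda>x. c (inv_into ?T F x)"] finT that by simp
  then have "c m = 0" if "m \<in> ?T" for m
    using that inj by simp
  then have "(\<Sum>m\<in>?T. ?w m (c m)) = 0"
    by (intro sum.neutral) simp
  then show ?thesis
    using c by (simp add: K_def)
qed

text \<open>For stability, the kernel of \<open>kE_map\<close> after substitution by
  \<open>g\<close> contains all relations, because \<open>g v\<close> again lies in \<open>V\<close>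
  and so has p-th power zero. By \<open>kernel_kE_map\<close> it contains the kernel of
  \<open>kE_map\<close>.\<close>

sublocale kE: free_quotient kE V kE_map
proof (intro free_quotient.intro free_quotient_axioms.intro)
  show ring_kE: "ring (kE :: ('e, 'k) grp_alg ring)"
    using cring_kE cring.axioms(1) by blast
  show "kE_map (free_map g t) = \<zero>\<^bsub>kE\<^esub>"
    if g: "g \<in> carrier (GL V)" and t: "t \<in> carrier (Free V)" and t0': "kE_map t = \<zero>\<^bsub>kE\<^esub>" for g t
  proof -
    have t0: "kE_map t = 0"
      using t0' by simp
    have "(\<lambda>t. kE_map (free_map g t)) \<in> ring_hom (Free V) kE"
      by (rule ring_hom_memI) (simp_all add: kE_map_add kE_map_mult free_map_add free_map_mult)
    from ideal_vimage_Free[OF ring_kE this ring.zeroideal[OF ring_kE]]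
    have ideal: "ideal {t \<in> carrier (Free V). kE_map (free_map g t) = 0} (Free V)" (is "ideal ?P _")
      by simp
    have "t \<in> ?P"
    proof (rule kernel_kE_map[OF ideal _ _ _ t t0])
      have "free_map g r \<in> linear_rels V" if "r \<in> linear_rels V" for r
        by (rule free_map_linear_rels[OF g that])
      then show "linear_rels V \<subseteq> ?P"
        using linear_rels_Free[OF subspace] kE_map_linear_rels by blast
      show "free_var u * free_var v - free_var v * free_var u \<in> ?P" if "u \<in> V" "v \<in> V" for u v
        using that by (simp add: diff_in_Free mult_in_Free free_var_in_Free free_map_diff free_map_mult
            kE_map_diff kE_map_mult mult.commute)
      show "free_var v ^ p \<in> ?P" if v: "v \<in> V" for v
      proof -
        have "set (replicate p v) \<subseteq> V"
          using v by (simp add: set_replicate_conv_if)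
        then have "free_var v ^ p \<in> carrier (Free V)"
          by (simp add: free_var_power word_in_Free)
        moreover have "kE_map (free_map g (free_var v ^ p)) = g v ^ p"
          by (simp add: free_var_power prod_list_replicate)
        moreover have "g v ^ p = 0"
          using GL_D(4)[OF g v] V_A by (auto simp: Rad_kE)
        ultimately show ?thesis
          by simp
      qed
    qed
    then show ?thesis
      by simp
  qed
qed (use kE_map_surj kE_map_hom subspace in auto)

end

section \<open>Symmetric, exterior and truncated symmetric algebras\<close>

lemma (in free_quotient) sig_pow: "t \<in> carrier (Free V) \<Longrightarrow> t ^ m \<in> carrier (Free V) \<and> \<sigma> (t ^ m) = \<sigma> t [^] m"
proof (induction m)
  case 0
  show ?case
    by (simp add: one_in_Free sig_one)
next
  case (Suc m)
  then show ?case
    unfolding power_Suc2 by (simp only: mult_in_Free sig_mult nat_pow_Suc)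
qed

text \<open>The assumption \<open>kernel\<close> keeps constant terms visible in \<open>R\<close>,
  so \<open>ge 1\<close> is proper. A nonzero constant term gives a unit modulo \<open>ge 1\<close>,
  and a prime ideal contains the nilpotent letters, hence \<open>ge 1\<close>.\<close>

lemma (in free_quotient) Rad_eq_ge:
  assumes cring: "cring R"
    and kernel: "\<And>t. t \<in> carrier (Free V) \<Longrightarrow> \<sigma> t = \<zero> \<Longrightarrow> t \<in> Free_ge V 1"
    and nil: "\<And>v. v \<in> V \<Longrightarrow> \<exists>m. \<sigma> (free_var v ^ m) = \<zero>"
  shows "Rad R = ge 1"
proof (rule cring.Rad_eqI[OF cring ideal_ge])
  have one: "1 \<notin> Free_ge V 1"
    unfolding Free_ge_1 by simp
  show "\<one> \<notin> ge 1"
  proof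
    assume "\<one> \<in> ge 1"
    then obtain t where t: "t \<in> Free_ge V 1" "\<sigma> 1 = \<sigma> t"
      by (metis imageE sig_one)
    have "\<sigma> (1 - t) = \<zero>"
      using t(2) eq_iff_diff[OF one_in_Free Free_ge_carrier[OF t(1)]] by simp
    then have "1 - t \<in> Free_ge V 1"
      by (intro kernel diff_in_Free one_in_Free Free_ge_carrier[OF t(1)])
    from add_in_Free_ge[OF this t(1)] show False
      using one by simp
  qed
  show "\<exists>y\<in>carrier R. \<exists>a\<in>ge 1. y \<otimes> x \<oplus> a = \<one>" if x: "x \<in> carrier R" "x \<notin> ge 1" for x
  proof -
    obtain t where t: "t \<in> carrier (Free V)" "x = \<sigma> t"
      using lift[OF x(1)] .
    define c where "c = Poly_Mapping.lookup t 0"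
    have "t \<notin> Free_ge V 1"
      using x(2) t(2) by blast
    then have c: "c \<noteq> 0"
      using t(1) unfolding Free_ge_1 by (simp add: c_def)
    define t' where "t' = t - free_const c"
    have "t' \<in> carrier (Free V)"
      unfolding t'_def by (rule diff_in_Free[OF t(1) free_const_in_Free])
    moreover have "Poly_Mapping.lookup t' 0 = 0"
      by (simp add: t'_def lookup_minus free_const_def c_def)
    ultimately have t': "t' \<in> Free_ge V 1"
      unfolding Free_ge_1 by simp
    define y where "y = (free_const (inverse c) :: ('e, 'k) free_alg)"
    have y: "y \<in> carrier (Free V)"
      by (simp add: y_def free_const_in_Free)
    have "- (y * t') \<in> Free_ge V 1"
      by (intro uminus_in_Free_ge mult_in_Free_ge'(1)[OF t' y])
    \<comment> \<open>Since \<open>t - t'\<close> is the constant \<open>c\<close> and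
      \<open>y\<close> is its inverse.\<close>
    moreover have "y * t + - (y * t') = 1"
      using c by (simp add: t'_def y_def right_diff_distrib free_const_def mult_single)
    then have "\<sigma> y \<otimes> x \<oplus> \<sigma> (- (y * t')) = \<one>"
      unfolding t(2) sig_mult[OF y t(1), symmetric]
      using sig_add[OF mult_in_Free[OF y t(1)] Free_ge_carrier[OF calculation]] sig_one by simp
    ultimately show ?thesis
      using sig_closed[OF y] by blast
  qed
  show "ge 1 \<subseteq> I" if I: "primeideal I R" for I
  proof -
    interpret I: primeideal I R
      by (rule I)
    have zero: "\<zero> \<in> I"
      by (rule additive_subgroup.zero_closed[OF I.additive_subgroup_axioms])
    have var: "\<sigma> (free_var v) \<in> I" if v: "v \<in> V" for v
    proof -
      note vF = free_var_in_Free[OF v]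
      obtain m where "\<sigma> (free_var v ^ m) = \<zero>"
        using nil[OF v] by blast
      then have "\<sigma> (free_var v) [^] m \<in> I"
        using zero sig_pow[OF vF] by simp
      then show ?thesis
        by (rule I.nat_pow_memD[OF sig_closed[OF vF]])
    qed
    have "\<sigma> t \<in> I" if "t \<in> Free_ge V 1" for t
      using that
    proof (induction rule: Free_ge_induct)
      case (mono w c)
      then obtain v w' where w: "w = v # w'" "v \<in> V" "set w' \<subseteq> V"
        by (cases w) auto
      show ?case
        unfolding w(1) word_Cons sig_mult[OF free_var_in_Free[OF w(2)] word_in_Free[OF w(3)]]
        by (rule I.I_r_closed[OF var[OF w(2)] sig_closed[OF word_in_Free[OF w(3)]]])
    next
      case (add s t)
      show ?case
        unfolding sig_add[OF Free_ge_carrier[OF add(1)] Free_ge_carrier[OF add(2)]]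
        by (rule additive_subgroup.a_closed[OF I.additive_subgroup_axioms]) (fact add)+
    next
      case zero
      show ?case
        unfolding sig_zero by fact
    qed
    then show ?thesis
      by blast
  qed
qed

lemma free_map_hom:
  assumes "g \<in> carrier (GL V)"
  shows "free_map g \<in> ring_hom (Free V) (Free V)"
  using GL_D(2)[OF assms]
  by (intro ring_hom_memI) (simp_all add: free_map_in_Free free_map_mult free_map_add)

lemma free_quotient_Quot:
  assumes V: "kscale.subspace V" and I: "ideal I (Free V)"
    and stable: "\<And>g t. g \<in> carrier (GL V) \<Longrightarrow> t \<in> I \<Longrightarrow> free_map g t \<in> I"
  shows "free_quotient (Free V Quot I) V (\<lambda>t. I +>\<^bsub>Free V\<^esub> t)"
    and "t \<in> carrier (Free V) \<Longrightarrow> I +>\<^bsub>Free V\<^esub> t = \<zero>\<^bsub>Free V Quot I\<^esub> \<longleftrightarrow> t \<in> I"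
proof -
  have zero: "I +>\<^bsub>Free V\<^esub> t = \<zero>\<^bsub>Free V Quot I\<^esub> \<longleftrightarrow> t \<in> I" if t: "t \<in> carrier (Free V)" for t
    using ring.quotient_eq_iff_same_a_r_cos[OF ring_Free I t zero_in_Free] t
      ring.a_rcos_zero[OF ring_Free I ideal_FreeD(1)[OF I]]
    by (simp add: FactRing_def a_minus_def zero_in_Free)
  then show "t \<in> carrier (Free V) \<Longrightarrow> I +>\<^bsub>Free V\<^esub> t = \<zero>\<^bsub>Free V Quot I\<^esub> \<longleftrightarrow> t \<in> I" .
  show "free_quotient (Free V Quot I) V (\<lambda>t. I +>\<^bsub>Free V\<^esub> t)"
  proof (intro free_quotient.intro free_quotient_axioms.intro V)
    show "ring (Free V Quot I)"
      by (rule ideal.quotient_is_ring[OF I])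
    show "(\<lambda>t. I +>\<^bsub>Free V\<^esub> t) \<in> ring_hom (Free V) (Free V Quot I)"
      by (rule ideal.rcos_ring_hom[OF I])
    show "carrier (Free V Quot I) \<subseteq> (\<lambda>t. I +>\<^bsub>Free V\<^esub> t) ` carrier (Free V)"
      by (auto simp: FactRing_def A_RCOSETS_def')
    show "I +>\<^bsub>Free V\<^esub> free_map g t = \<zero>\<^bsub>Free V Quot I\<^esub>"
      if "g \<in> carrier (GL V)" "t \<in> carrier (Free V)" "I +>\<^bsub>Free V\<^esub> t = \<zero>\<^bsub>Free V Quot I\<^esub>" for g t
    proof -
      have "free_map g t \<in> carrier (Free V)"
        using free_map_hom[OF that(1)] that(2) by (rule ring_hom_closed)
      then show ?thesis
        using that zero stable by blast
    qed
  qed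
qed

text \<open>The last claim follows from minimality: the preimage of the ideal under the substitution
  is an ideal that contains the generators.\<close>

lemma rel_ideal:
  assumes V: "kscale.subspace V" and S: "S \<subseteq> carrier (Free V)"
  shows "ideal (rel_ideal V S) (Free V)" "linear_rels V \<subseteq> rel_ideal V S" "S \<subseteq> rel_ideal V S"
    and "\<And>I. ideal I (Free V) \<Longrightarrow> linear_rels V \<subseteq> I \<Longrightarrow> S \<subseteq> I \<Longrightarrow> rel_ideal V S \<subseteq> I"
    and "\<And>g t. (\<And>s. s \<in> S \<Longrightarrow> free_map g s \<in> S) \<Longrightarrow> g \<in> carrier (GL V) \<Longrightarrow> t \<in> rel_ideal V S \<Longrightarrow>
      free_map g t \<in> rel_ideal V S"
proof -
  have sub: "linear_rels V \<union> S \<subseteq> carrier (Free V)"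
    using linear_rels_Free[OF V] S by blast
  show ideal: "ideal (rel_ideal V S) (Free V)"
    unfolding rel_ideal_def by (rule ring.genideal_ideal[OF ring_Free sub])
  show lin: "linear_rels V \<subseteq> rel_ideal V S" and S': "S \<subseteq> rel_ideal V S"
    using ring.genideal_self[OF ring_Free sub] unfolding rel_ideal_def by blast+
  show min: "rel_ideal V S \<subseteq> I" if "ideal I (Free V)" "linear_rels V \<subseteq> I" "S \<subseteq> I" for I
    unfolding rel_ideal_def using that by (intro ring.genideal_minimal[OF ring_Free]) auto
  show "free_map g t \<in> rel_ideal V S"
    if g: "\<And>s. s \<in> S \<Longrightarrow> free_map g s \<in> S" "g \<in> carrier (GL V)" and t: "t \<in> rel_ideal V S" for g t
  proof -
    have "rel_ideal V S \<subseteq> {t \<in> carrier (Free V). free_map g t \<in> rel_ideal V S}"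
    proof (rule min[OF ideal_vimage_Free[OF ring_Free free_map_hom[OF g(2)] ideal]])
      show "linear_rels V \<subseteq> {t \<in> carrier (Free V). free_map g t \<in> rel_ideal V S}"
        using linear_rels_Free[OF V] free_map_linear_rels[OF g(2)] lin by blast
      show "S \<subseteq> {t \<in> carrier (Free V). free_map g t \<in> rel_ideal V S}"
        using S g(1) S' by blast
    qed
    then show ?thesis
      using t by blast
  qed
qed

context
  fixes V :: "('e::ab_group_add, 'k::field) grp_alg set"
  assumes V: "kscale.subspace V"
begin

lemma commutators_Free:
  "{free_var u * free_var v - free_var v * free_var u | u v. u \<in> V \<and> v \<in> V} \<subseteq> carrier (Free V)"
  by (auto intro!: diff_in_Free mult_in_Free free_var_in_Free)

lemma squares_Free: "{free_var v * free_var v | v. v \<in> V} \<subseteq> carrier (Free V)"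
  by (auto intro!: mult_in_Free free_var_in_Free)

lemma commutators_stable:
  assumes "g \<in> carrier (GL V)" "s \<in> {free_var u * free_var v - free_var v * free_var u | u v. u \<in> V \<and> v \<in> V}"
  shows "free_map g s \<in> {free_var u * free_var v - free_var v * free_var u | u v. u \<in> V \<and> v \<in> V}"
proof -
  obtain u v where uv: "u \<in> V" "v \<in> V" "s = free_var u * free_var v - free_var v * free_var u"
    using assms(2) by blast
  then have "free_map g s = free_var (g u) * free_var (g v) - free_var (g v) * free_var (g u)"
    by (simp add: free_map_diff free_map_mult)
  then show ?thesis
    using GL_D(4)[OF assms(1)] uv by blast
qed

lemma squares_stable:
  assumes "g \<in> carrier (GL V)" "s \<in> {free_var v * free_var v | v. v \<in> V}"
  shows "free_map g s \<in> {free_var v * free_var v | v. v \<in> V}"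
proof -
  obtain v where v: "v \<in> V" "s = free_var v * free_var v"
    using assms(2) by blast
  then have "free_map g s = free_var (g v) * free_var (g v)"
    by (simp add: free_map_mult)
  then show ?thesis
    using GL_D(4)[OF assms(1)] v by blast
qed

lemmas sym_ideal = rel_ideal[OF V commutators_Free, folded sym_ideal_def]
  and ext_ideal = rel_ideal[OF V squares_Free, folded ext_ideal_def]

lemma free_quotient_Sym: "free_quotient (Sym V) V (Sym_map V)"
  and Sym_map_zero: "t \<in> carrier (Free V) \<Longrightarrow> Sym_map V t = \<zero>\<^bsub>Sym V\<^esub> \<longleftrightarrow> t \<in> sym_ideal V"
  using free_quotient_Quot[OF V sym_ideal(1) sym_ideal(5)[OF commutators_stable]]
  by (simp_all add: Sym_def Sym_map_def[abs_def])

lemma free_quotient_Ext: "free_quotient (Ext V) V (Ext_map V)"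
  and Ext_map_zero: "t \<in> carrier (Free V) \<Longrightarrow> Ext_map V t = \<zero>\<^bsub>Ext V\<^esub> \<longleftrightarrow> t \<in> ext_ideal V"
  using free_quotient_Quot[OF V ext_ideal(1) ext_ideal(5)[OF squares_stable]]
  by (simp_all add: Ext_def Ext_map_def[abs_def])

text \<open>For two words, both products have the same multiset of letters; bilinearity does the
  rest.\<close>

lemma sym_ideal_commutator:
  assumes "s \<in> carrier (Free V)" "t \<in> carrier (Free V)"
  shows "s * t - t * s \<in> sym_ideal V"
proof -
  note I = ideal_FreeD[OF sym_ideal(1)]
  have comm: "free_var u * free_var v - free_var v * free_var u \<in> sym_ideal V" if "u \<in> V" "v \<in> V" for u v
    using sym_ideal(3) that by blast
  have word: "Poly_Mapping.single (Free_mon w) c * t - t * Poly_Mapping.single (Free_mon w) c \<in> sym_ideal V"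
    if w: "set w \<subseteq> V" for w c
    using assms(2)
  proof (induction rule: Free_induct)
    case (mono w' c')
    have "Poly_Mapping.single (Free_mon (w @ w')) (c * c') - Poly_Mapping.single (Free_mon (w' @ w)) (c * c') \<in> sym_ideal V"
      using w mono by (intro word_mset_cong[OF sym_ideal(1) comm]) auto
    then show ?case
      by (simp add: mult_single mult.commute)
  next
    case (add s t)
    from I(2)[OF add(3,4)] show ?case
      by (simp add: algebra_simps)
  qed (simp add: I(1))
  show ?thesis
    using assms(1)
  proof (induction rule: Free_induct)
    case (add s s')
    from I(2)[OF add(3,4)] show ?case
      by (simp add: algebra_simps)
  qed (simp_all add: I(1) word)
qed

lemma cring_Sym: "cring (Sym V)"
proof -
  interpret Sym: free_quotient "Sym V" V "Sym_map V"
    by (rule free_quotient_Sym)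
  show ?thesis
  proof (rule cring.intro[OF Sym.ring_axioms])
    show "Group.comm_monoid (Sym V)"
    proof (rule Group.monoid.monoid_comm_monoidI[OF Sym.is_monoid])
      fix x y assume "x \<in> carrier (Sym V)" "y \<in> carrier (Sym V)"
      then obtain s t where st: "s \<in> carrier (Free V)" "x = Sym_map V s" "t \<in> carrier (Free V)" "y = Sym_map V t"
        by (metis Sym.lift)
      have "Sym_map V (s * t) = Sym_map V (t * s)"
        using st sym_ideal_commutator[OF st(1,3)]
        by (simp add: Sym.eq_iff_diff Sym_map_zero mult_in_Free diff_in_Free)
      then show "x \<otimes>\<^bsub>Sym V\<^esub> y = y \<otimes>\<^bsub>Sym V\<^esub> x"
        using st by (simp add: Sym.sig_mult)
    qed
  qed
qed

lemma sym_ideal_ge: "sym_ideal V \<subseteq> Free_ge V 1"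
proof (rule sym_ideal(4)[OF ideal_Free_ge])
  have v: "free_var v \<in> Free_ge V 1" if "v \<in> V" for v
    using that by (auto simp: free_var_def intro: word_in_Free_ge)
  show "{free_var u * free_var v - free_var v * free_var u | u v. u \<in> V \<and> v \<in> V} \<subseteq> Free_ge V 1"
    by (rule subsetI, elim CollectE exE conjE, hypsubst)
      (intro diff_in_Free_ge mult_in_Free_ge'(1) free_var_in_Free v)
  show "linear_rels V \<subseteq> Free_ge V 1"
    unfolding linear_rels_def
    by (rule subsetI, elim UnE CollectE exE conjE; hypsubst)
      (intro diff_in_Free_ge add_in_Free_ge mult_in_Free_ge'(1) free_const_in_Free v
        kscale.subspace_add[OF V] kscale.subspace_scale[OF V]; assumption)+
qed

context
  fixes q :: nat
  assumes q: "q > 0"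
begin

interpretation Sym: free_quotient "Sym V" V "Sym_map V"
  by (rule free_quotient_Sym)

lemma power_generators:
  "{Sym_map V (free_var v) [^]\<^bsub>Sym V\<^esub> q | v. v \<in> V} = {Sym_map V (free_var v ^ q) | v. v \<in> V}"
  using Sym.sig_pow[OF free_var_in_Free] by metis

lemma free_var_power_Free_ge: "v \<in> V \<Longrightarrow> free_var v ^ l \<in> Free_ge V l"
  unfolding free_var_power by (intro word_in_Free_ge) (auto simp: set_replicate_conv_if)

lemma power_ideal:
  "ideal (power_ideal q V) (Sym V)" "v \<in> V \<Longrightarrow> Sym_map V (free_var v ^ q) \<in> power_ideal q V"
  "ideal I (Sym V) \<Longrightarrow> (\<And>v. v \<in> V \<Longrightarrow> Sym_map V (free_var v ^ q) \<in> I) \<Longrightarrow> power_ideal q V \<subseteq> I"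
proof -
  have sub: "{Sym_map V (free_var v ^ q) | v. v \<in> V} \<subseteq> carrier (Sym V)"
    using Sym.sig_closed Free_ge_carrier[OF free_var_power_Free_ge] by blast
  show "ideal (power_ideal q V) (Sym V)"
    unfolding power_ideal_def power_generators by (rule Sym.genideal_ideal[OF sub])
  show "Sym_map V (free_var v ^ q) \<in> power_ideal q V" if "v \<in> V"
    unfolding power_ideal_def power_generators using Sym.genideal_self[OF sub] that by blast
  show "power_ideal q V \<subseteq> I" if "ideal I (Sym V)" "\<And>v. v \<in> V \<Longrightarrow> Sym_map V (free_var v ^ q) \<in> I"
    unfolding power_ideal_def power_generators using that by (intro Sym.genideal_minimal) auto
qed

lemma kG_map_zero: "t \<in> carrier (Free V) \<Longrightarrow> kG_map q V t = \<zero>\<^bsub>kG q V\<^esub> \<longleftrightarrow> Sym_map V t \<in> power_ideal q V"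
proof -
  assume t: "t \<in> carrier (Free V)"
  have "Sym_map V t \<ominus>\<^bsub>Sym V\<^esub> \<zero>\<^bsub>Sym V\<^esub> = Sym_map V t"
    using Sym.sig_closed[OF t] by (simp add: a_minus_def)
  then show ?thesis
    using Sym.quotient_eq_iff_same_a_r_cos[OF power_ideal(1) Sym.sig_closed[OF t] Sym.zero_closed]
      Sym.a_rcos_zero[OF power_ideal(1) additive_subgroup.zero_closed[OF ideal.axioms(1)[OF power_ideal(1)]]]
    by (simp add: FactRing_def kG_def kG_map_def)
qed

lemma kG_map_hom: "kG_map q V \<in> ring_hom (Free V) (kG q V)"
  using ring_hom_trans[OF Sym.hom ideal.rcos_ring_hom[OF power_ideal(1)]]
  by (simp add: kG_def kG_map_def[abs_def] comp_def)

text \<open>The power relations live in \<open>Sym V\<close>, not among words. Stability is thus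
  shown there: the preimage of \<open>power_ideal q V\<close> under the automorphism induced by
  \<open>g\<close> contains the generating powers.\<close>

lemma free_quotient_kG: "free_quotient (kG q V) V (kG_map q V)"
proof (intro free_quotient.intro free_quotient_axioms.intro V kG_map_hom)
  show ring: "ring (kG q V)"
    unfolding kG_def by (rule ideal.quotient_is_ring[OF power_ideal(1)])
  show "carrier (kG q V) \<subseteq> kG_map q V ` carrier (Free V)"
  proof
    fix x assume "x \<in> carrier (kG q V)"
    then obtain y where y: "y \<in> carrier (Sym V)" "x = power_ideal q V +>\<^bsub>Sym V\<^esub> y"
      by (auto simp: kG_def FactRing_def A_RCOSETS_def')
    then show "x \<in> kG_map q V ` carrier (Free V)"
      using Sym.lift[OF y(1)] by (metis imageI kG_map_def)
  qed
  fix g t assume g: "g \<in> carrier (GL V)" and t: "t \<in> carrier (Free V)" and t0: "kG_map q V t = \<zero>\<^bsub>kG q V\<^esub>"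
  let ?\<phi> = "gl_ext (Sym V) (Sym_map V) V g"
  have "?\<phi> \<in> ring_iso (Sym V) (Sym V)"
    using theI'[OF Sym.gl_ext_unique(1)[OF g]] unfolding gl_ext_def by blast
  then have \<phi>: "?\<phi> \<in> ring_hom (Sym V) (Sym V)"
    by (simp add: ring_iso_def)
  have "power_ideal q V \<subseteq> {x \<in> carrier (Sym V). ?\<phi> x \<in> power_ideal q V}"
  proof (rule power_ideal(3))
    show "ideal {x \<in> carrier (Sym V). ?\<phi> x \<in> power_ideal q V} (Sym V)"
      using ring_hom_ring.ideal_vimage[OF ring_hom_ringI2[OF Sym.ring_axioms Sym.ring_axioms \<phi>] power_ideal(1)] .
    fix v assume v: "v \<in> V"
    note vF = Free_ge_carrier[OF free_var_power_Free_ge[OF v, of q]]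
    have "?\<phi> (Sym_map V (free_var v ^ q)) = Sym_map V (free_var (g v) ^ q)"
      unfolding Sym.gl_ext_unique(2)[OF g vF] by (simp add: free_var_power)
    then show "Sym_map V (free_var v ^ q) \<in> {x \<in> carrier (Sym V). ?\<phi> x \<in> power_ideal q V}"
      using power_ideal(2)[OF GL_D(4)[OF g v]] Sym.sig_closed[OF vF] by simp
  qed
  then have "?\<phi> (Sym_map V t) \<in> power_ideal q V"
    using t0 unfolding kG_map_zero[OF t] by blast
  moreover have "free_map g t \<in> carrier (Free V)"
    by (rule ring_hom_closed[OF free_map_hom[OF g] t])
  ultimately show "kG_map q V (free_map g t) = \<zero>\<^bsub>kG q V\<^esub>"
    using kG_map_zero Sym.gl_ext_unique(2)[OF g t] by simp
qed

lemma cring_kG: "cring (kG q V)"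
  unfolding kG_def by (rule ideal.quotient_is_cring[OF power_ideal(1) cring_Sym])

lemma Rad_kG: "Rad (kG q V) = kG_map q V ` Free_ge V 1"
proof -
  interpret kG: free_quotient "kG q V" V "kG_map q V"
    by (rule free_quotient_kG)
  show ?thesis
  proof (rule kG.Rad_eq_ge[OF cring_kG])
    fix t assume t: "t \<in> carrier (Free V)" "kG_map q V t = \<zero>\<^bsub>kG q V\<^esub>"
    \<comment> \<open>Positivity of \<open>q\<close> enters here: no generating power has a constant
      term.\<close>
    have "power_ideal q V \<subseteq> Sym.ge 1"
    proof (rule power_ideal(3)[OF Sym.ideal_ge])
      show "Sym_map V (free_var v ^ q) \<in> Sym.ge 1" if "v \<in> V" for v
        using free_var_power_Free_ge[OF that, of q] Free_ge_mono[of 1 q V] q by auto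
    qed
    then obtain t' where t': "t' \<in> Free_ge V 1" "Sym_map V t = Sym_map V t'"
      using t(2) unfolding kG_map_zero[OF t(1)] by blast
    note t'F = Free_ge_carrier[OF t'(1)]
    \<comment> \<open>Equality in \<open>Sym V\<close> determines \<open>t\<close> only up to
      \<open>sym_ideal V\<close>, which has no constant terms either.\<close>
    have "t - t' \<in> sym_ideal V"
      using t'(2) unfolding Sym.eq_iff_diff[OF t(1) t'F] Sym_map_zero[OF diff_in_Free[OF t(1) t'F]] .
    then have "t - t' + t' \<in> Free_ge V 1"
      using sym_ideal_ge t'(1) by (intro add_in_Free_ge) auto
    then show "t \<in> Free_ge V 1"
      by simp
  next
    fix v assume v: "v \<in> V"
    have "kG_map q V (free_var v ^ q) = \<zero>\<^bsub>kG q V\<^esub>"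
      unfolding kG_map_zero[OF Free_ge_carrier[OF free_var_power_Free_ge[OF v]]] by (rule power_ideal(2)[OF v])
    then show "\<exists>m. kG_map q V (free_var v ^ m) = \<zero>\<^bsub>kG q V\<^esub>"
      by blast
  qed
qed

end

end


section \<open>The four families of modules\<close>

context group_algebra_complement
begin

text \<open>All relations of \<open>kE\<close> lie in the ideal \<open>Free_ge V 1\<close>, and
  therefore so does the whole kernel.\<close>

lemma Rad_kE_ge: "Rad kE = kE_map ` Free_ge V 1"
proof (rule kE.Rad_eq_ge[OF cring_kE])
  fix t assume t: "t \<in> carrier (Free V)" "kE_map t = \<zero>\<^bsub>kE\<^esub>"
  have v: "free_var v \<in> Free_ge V 1" if "v \<in> V" for v
    using that by (auto simp: free_var_def intro: word_in_Free_ge)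
  show "t \<in> Free_ge V 1"
  proof (rule kernel_kE_map[OF ideal_Free_ge _ _ _ t(1)])
    show "linear_rels V \<subseteq> Free_ge V 1"
      using sym_ideal(2)[OF subspace] sym_ideal_ge[OF subspace] by blast
    show "free_var u * free_var v - free_var v * free_var u \<in> Free_ge V 1" if "u \<in> V" "v \<in> V" for u v
      using that v by (intro diff_in_Free_ge mult_in_Free_ge'(1) free_var_in_Free)
    show "free_var v ^ p \<in> Free_ge V 1" if "v \<in> V" for v
      using free_var_power_Free_ge[OF subspace p_pos that, of p] Free_ge_mono[of 1 p V] p_pos by auto
  qed (use t in simp)
next
  fix v assume "v \<in> V"
  then have "kE_map (free_var v ^ p) = \<zero>\<^bsub>kE\<^esub>"
    using V_A by (auto simp: free_var_power prod_list_replicate Rad_kE)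
  then show "\<exists>m. kE_map (free_var v ^ m) = \<zero>\<^bsub>kE\<^esub>"
    by blast
qed

text \<open>Reconciles the direct action in \<open>kE_subquotient\<close> with the action through
  lifts; surjectivity of \<open>kE_map\<close> is the point.\<close>

lemma lifts_kE: "lifts V kE_map x = {x}"
proof -
  obtain t where "t \<in> carrier (Free V)" "kE_map t = x"
    using kE_map_surj by (metis UNIV_I image_iff)
  then have "{t \<in> carrier (Free V). kE_map t = x} \<noteq> {}"
    by blast
  then show ?thesis
    unfolding lifts_def by blast
qed

text \<open>The relations of \<open>kE\<close> map into degree \<open>\<ge> d\<close> of \<open>R\<close>, so that \<open>kE\<close> acts on subquotients of
  length \<open>d\<close>.\<close>

lemma kernel_ge:
  assumes R: "free_quotient R V \<sigma>"
    and linear: "linear_rels V \<subseteq> {t \<in> carrier (Free V). \<sigma> t = \<zero>\<^bsub>R\<^esub>}"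
    and comm: "\<And>u v. u \<in> V \<Longrightarrow> v \<in> V \<Longrightarrow> \<sigma> (free_var u * free_var v - free_var v * free_var u) \<in> \<sigma> ` Free_ge V d"
    and d: "d \<le> p" and t: "t \<in> carrier (Free V)" "kE_map t = 0"
  shows "\<sigma> t \<in> \<sigma> ` Free_ge V d"
proof -
  interpret R: free_quotient R V \<sigma>
    by (rule R)
  have zero: "\<zero>\<^bsub>R\<^esub> \<in> R.ge d"
    by (rule additive_subgroup.zero_closed[OF ideal.axioms(1)[OF R.ideal_ge]])
  have "t \<in> {t \<in> carrier (Free V). \<sigma> t \<in> R.ge d}"
  proof (rule kernel_kE_map[OF ideal_vimage_Free[OF R.ring_axioms R.hom R.ideal_ge] _ _ _ t])
    show "linear_rels V \<subseteq> {t \<in> carrier (Free V). \<sigma> t \<in> R.ge d}"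
      using linear zero by auto
    show "free_var u * free_var v - free_var v * free_var u \<in> {t \<in> carrier (Free V). \<sigma> t \<in> R.ge d}"
      if "u \<in> V" "v \<in> V" for u v
      using comm[OF that] that by (simp add: diff_in_Free mult_in_Free free_var_in_Free)
    \<comment> \<open>The bound \<open>d <= p\<close> is needed for this relation only.\<close>
    show "free_var v ^ p \<in> {t \<in> carrier (Free V). \<sigma> t \<in> R.ge d}" if "v \<in> V" for v
      using free_var_power_Free_ge[OF subspace p_pos that, of p] Free_ge_mono[OF d, of V] Free_ge_carrier by blast
  qed
  then show ?thesis
    by simp
qed

lemma subquotient_constant_types:
  assumes "free_subquotient R V \<sigma> i j M"
  shows "gl_equivariant V M (coset_action R \<sigma> V M) \<and>
    (\<forall>r\<in>{1..n}. constant_radical_type p V r M \<and> constant_socle_type p V r M)"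
proof -
  interpret M: free_subquotient R V \<sigma> i j M
    by fact
  obtain S where S: "finite S" "card S \<le> n" "S \<subseteq> V" "V \<subseteq> kscale.span S"
    by (rule spanning_set)
  interpret E: equivariant_module V M "coset_action R \<sigma> V M"
    by (intro equivariant_module.intro equivariant_module_axioms.intro kE.free_quotient_axioms M.equivariant)
  show ?thesis
    using M.equivariant E.constant_types[OF M.fin_dim[OF S(1,3,4)] S(1,4)] by simp
qed

lemma free_subquotientI:
  assumes "free_quotient R V \<sigma>" and "i \<le> j"
    and "linear_rels V \<subseteq> {t \<in> carrier (Free V). \<sigma> t = \<zero>\<^bsub>R\<^esub>}"
    and "\<And>t. t \<in> carrier (Free V) \<Longrightarrow> kE_map t = 0 \<Longrightarrow> \<sigma> t \<in> \<sigma> ` Free_ge V (j - i)"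
    and "M = subquotient R (lifts V \<sigma>) (\<sigma> ` Free_ge V i) (\<sigma> ` Free_ge V j)"
  shows "free_subquotient R V \<sigma> i j M"
  using assms by (intro free_subquotient.intro free_subquotient_axioms.intro kE.free_quotient_axioms)

text \<open>Elements of the kernel of \<open>kE_map\<close> map to zero, which has every degree, so
  \<open>j - i\<close> is unrestricted.\<close>

lemma free_subquotient_kE:
  assumes "i \<le> j"
  shows "free_subquotient kE V kE_map i j (kE_subquotient i j)"
proof (rule free_subquotientI[OF kE.free_quotient_axioms assms])
  show "linear_rels V \<subseteq> {t \<in> carrier (Free V). kE_map t = \<zero>\<^bsub>kE\<^esub>}"
    using linear_rels_Free[OF subspace] kE_map_linear_rels by auto
  show "kE_map t \<in> kE.ge (j - i)" if "kE_map t = 0" for t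
    unfolding that by (rule image_eqI[of _ _ 0]) simp_all
  show "kE_subquotient i j = subquotient kE (lifts V kE_map) (kE.ge i) (kE.ge j)"
    unfolding kE_subquotient_def Rad_kE_ge kE.ideal_power_ge using lifts_kE by presburger
qed

text \<open>In \<open>Ext V\<close> the commutator of \<open>u\<close> and \<open>v\<close> is twice
  their product, nonzero in general for odd \<open>p\<close> but of degree 2; and
  \<open>v ^ p\<close> has degree \<open>p >= 2\<close>. Relations therefore act as zero on
  subquotients of length 2.\<close>

lemma free_subquotient_Ext: "free_subquotient (Ext V) V (Ext_map V) i (i + 2) (Ext_subquotient V i (i + 2))"
proof -
  interpret Ext: free_quotient "Ext V" V "Ext_map V"
    by (rule free_quotient_Ext[OF subspace])
  have linear: "linear_rels V \<subseteq> {t \<in> carrier (Free V). Ext_map V t = \<zero>\<^bsub>Ext V\<^esub>}"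
    using linear_rels_Free[OF subspace] ext_ideal(2)[OF subspace] Ext_map_zero[OF subspace] by blast
  have v: "free_var v \<in> Free_ge V 1" if "v \<in> V" for v
    using that by (auto simp: free_var_def intro: word_in_Free_ge)
  have vv: "free_var u * free_var v \<in> Free_ge V 2" if "u \<in> V" "v \<in> V" for u v
    using mult_in_Free_ge[OF v[OF that(1)] v[OF that(2)]] by (simp add: numeral_2_eq_2)
  show ?thesis
  proof (rule free_subquotientI[OF Ext.free_quotient_axioms _ linear])
    fix t :: "('e, 'k) free_alg" assume t: "t \<in> carrier (Free V)" "kE_map t = 0"
    have "Ext_map V t \<in> Ext.ge 2"
      by (rule kernel_ge[OF Ext.free_quotient_axioms linear _ _ t])
        (auto intro!: imageI diff_in_Free_ge vv prime_ge_2_nat prime_p)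
    then show "Ext_map V t \<in> Ext.ge (i + 2 - i)"
      by simp
  next
    have "Ext_aug V = Ext.ge 1"
      unfolding Ext_aug_def Free_ge_1 ..
    then show "Ext_subquotient V i (i + 2) = subquotient (Ext V) (lifts V (Ext_map V)) (Ext.ge i) (Ext.ge (i + 2))"
      by (simp only: Ext_subquotient_def Ext.ideal_power_ge)
  qed simp
qed

lemma Sym_linear: "linear_rels V \<subseteq> {t \<in> carrier (Free V). Sym_map V t = \<zero>\<^bsub>Sym V\<^esub>}"
  using linear_rels_Free[OF subspace] sym_ideal(2)[OF subspace] Sym_map_zero[OF subspace] by blast

lemma Sym_comm:
  assumes "u \<in> V" "v \<in> V"
  shows "Sym_map V (free_var u * free_var v - free_var v * free_var u) = \<zero>\<^bsub>Sym V\<^esub>"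
  using assms sym_ideal_commutator[OF subspace, of "free_var u" "free_var v"]
  by (subst Sym_map_zero[OF subspace]) (simp_all add: free_var_in_Free diff_in_Free mult_in_Free)

text \<open>Commutators and linear relations vanish in \<open>Sym V\<close>, so
  \<open>j - i <= p\<close> only has to absorb \<open>v ^ p\<close>.\<close>

lemma free_subquotient_Sym:
  assumes ij: "i \<le> j" "j - i \<le> p"
  shows "free_subquotient (Sym V) V (Sym_map V) i j (Sym_subquotient V i j)"
proof -
  interpret Sym: free_quotient "Sym V" V "Sym_map V"
    by (rule free_quotient_Sym[OF subspace])
  show ?thesis
  proof (rule free_subquotientI[OF Sym.free_quotient_axioms ij(1) Sym_linear])
    fix t :: "('e, 'k) free_alg" assume t: "t \<in> carrier (Free V)" "kE_map t = 0"
    show "Sym_map V t \<in> Sym.ge (j - i)"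
    proof (rule kernel_ge[OF Sym.free_quotient_axioms Sym_linear _ ij(2) t])
      show "Sym_map V (free_var u * free_var v - free_var v * free_var u) \<in> Sym.ge (j - i)"
        if "u \<in> V" "v \<in> V" for u v
        unfolding Sym_comm[OF that]
        by (rule additive_subgroup.zero_closed[OF ideal.axioms(1)[OF Sym.ideal_ge]])
    qed
  next
    show "Sym_subquotient V i j = subquotient (Sym V) (lifts V (Sym_map V)) (Sym.ge i) (Sym.ge j)"
      by (simp add: Sym_subquotient_def Sym_ge_def Free_ge_def)
  qed
qed

lemma free_subquotient_kG:
  assumes q: "q > 0" and ij: "i \<le> j" "j - i \<le> p"
  shows "free_subquotient (kG q V) V (kG_map q V) i j (kG_subquotient q V i j)"
proof -
  interpret kG: free_quotient "kG q V" V "kG_map q V"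
    by (rule free_quotient_kG[OF subspace q])
  have Sym_zero: "kG_map q V t = \<zero>\<^bsub>kG q V\<^esub>" if "t \<in> carrier (Free V)" "Sym_map V t = \<zero>\<^bsub>Sym V\<^esub>" for t
    unfolding kG_map_zero[OF subspace q that(1)] that(2)
    by (rule additive_subgroup.zero_closed[OF ideal.axioms(1)[OF power_ideal(1)[OF subspace q]]])
  have linear: "linear_rels V \<subseteq> {t \<in> carrier (Free V). kG_map q V t = \<zero>\<^bsub>kG q V\<^esub>}"
    using Sym_linear Sym_zero by blast
  show ?thesis
  proof (rule free_subquotientI[OF kG.free_quotient_axioms ij(1) linear])
    fix t :: "('e, 'k) free_alg" assume t: "t \<in> carrier (Free V)" "kE_map t = 0"
    show "kG_map q V t \<in> kG.ge (j - i)"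
    proof (rule kernel_ge[OF kG.free_quotient_axioms linear _ ij(2) t])
      show "kG_map q V (free_var u * free_var v - free_var v * free_var u) \<in> kG.ge (j - i)"
        if "u \<in> V" "v \<in> V" for u v
        unfolding Sym_zero[OF diff_in_Free[OF mult_in_Free mult_in_Free] Sym_comm[OF that],
            OF free_var_in_Free free_var_in_Free free_var_in_Free free_var_in_Free, OF that that(2,1)]
        by (rule additive_subgroup.zero_closed[OF ideal.axioms(1)[OF kG.ideal_ge]])
    qed
  next
    show "kG_subquotient q V i j = subquotient (kG q V) (lifts V (kG_map q V)) (kG.ge i) (kG.ge j)"
      by (simp only: kG_subquotient_def Rad_kG[OF subspace q] kG.ideal_power_ge)
  qed
qed

end

theorem proposition3p7:
  fixes V :: "('e::{finite, ab_group_add}, 'k::alg_closed_field) grp_alg set"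
    and p n :: nat
  assumes "CHAR('k) = p" and "p > 0"
    and "elementary_abelian TYPE('e) p n" and "n \<ge> 1"
    and "rad_complement V"
  shows
    "(\<forall>i j. i < j \<longrightarrow>
        (let M = kE_subquotient i j :: (('e, 'k) grp_alg, ('e, 'k) grp_alg set) module in
          gl_equivariant V M (coset_action kE kE_map V M) \<and>
          (\<forall>r\<in>{1..n}. constant_radical_type p V r M \<and> constant_socle_type p V r M))) \<and>
     (\<forall>i.
        (let M = Ext_subquotient V i (i + 2) in
          gl_equivariant V M (coset_action (Ext V) (Ext_map V) V M) \<and>
          (\<forall>r\<in>{1..n}. constant_radical_type p V r M \<and> constant_socle_type p V r M))) \<and>
     (\<forall>i j. i < j \<and> j - i \<le> p \<longrightarrow>
        (let M = Sym_subquotient V i j in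
          gl_equivariant V M (coset_action (Sym V) (Sym_map V) V M) \<and>
          (\<forall>r\<in>{1..n}. constant_radical_type p V r M \<and> constant_socle_type p V r M))) \<and>
     (\<forall>m i j. m > 0 \<and> i < j \<and> j - i \<le> p \<longrightarrow>
        (let M = kG_subquotient (p ^ m) V i j in
          gl_equivariant V M (coset_action (kG (p ^ m) V) (kG_map (p ^ m) V) V M) \<and>
          (\<forall>r\<in>{1..n}. constant_radical_type p V r M \<and> constant_socle_type p V r M)))"
proof -
  interpret group_algebra_complement V p n
    using assms by unfold_locales
  show ?thesis
    unfolding Let_def
    by (rule conjI[OF _ conjI[OF _ conjI]]; intro allI impI; rule subquotient_constant_types;
        rule free_subquotient_kE free_subquotient_Ext free_subquotient_Sym free_subquotient_kG)
      (simp_all add: p_pos)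
qed

end
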